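(* A closed critical curve of the total strain functional is equivalent (congruent under $G$) to a symmetrical configuration of the second kind $\eta_{r,\rho}$, with positive torus knot type $(p,q)$, where $\frac pq\in(0,1)$, with spectral parameter $r=\frac{p-2q}{p+q}$ and Clifford parameter $$\rho=\sqrt{\frac{6+6r+4\sqrt{3(1+r+r^2)}-4\sqrt{5+8r+5r^2+3(1+r)\sqrt{3(1+r+r^2)}}}{1-r}}.$$
   Context: $\mathbb C^{2,1}$ is $\mathbb C^3$ with the Hermitian form $\langle \mathbf z,\mathbf w\rangle={}^t\overline{\mathbf z}\,\mathbf h\,\mathbf w$, $\mathbf h=\begin{pmatrix}0&0&i\\0&1&0\\-i&0&0\end{pmatrix}$. $\mathcal N$ is the set of nonzero null vectors, $\mathcal S=\{[\mathbf z]\in\mathbb{CP}^2:\langle\mathbf z,\mathbf z\rangle=0\}$ (a model of the standard CR 3-sphere), with contact form $\zeta$ equal to the restriction to $T\mathcal S$ of $-i\langle\mathbf z,d\mathbf z\rangle/({}^t\overline{\mathbf z}\mathbf z)$. $G=\{A\in SL(3,\mathbb C):{}^t\bar A\mathbf hA=\mathbf h\}$ acts on $\mathcal S$ by $A[\mathbf z]=[A\mathbf z]$; curves are equivalent (congruent) if, up to reparametrization, they are related by an element of $G$. Curves. Let $J\subseteq\mathbb R$ be an interval. A lift of a smooth curve $\gamma:J\to\mathcal S$ is a smooth $\Gamma:J\to\mathcal N$ with $\gamma=[\Gamma]$. $\gamma$ is transversal if $\zeta(\gamma')\ne0$ everywhere; transversal curves are always positively parametrized, $-i\langle\Gamma,\Gamma'\rangle>0$.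 It is generic if $\det(\Gamma,\Gamma',\Gamma'')$ never vanishes. A Wilczynski lift is a lift with $\det(\Gamma,\Gamma',\Gamma'')=-1$ (unique up to cube roots of unity). The infinitesimal strain of a generic transversal curve is the 1-form $ds=a_\gamma\,dt$, $a_\gamma=i\langle\Gamma,\Gamma'\rangle^{-1}>0$, with $\Gamma$ a Wilczynski lift; it is invariant under reparametrization and under $G$. Total strain functional. For a closed interval $C\subset J$ the total strain of $\gamma(C)$ is $\mathfrak S_{\gamma,C}=\int_C ds$. A generic transversal curve $\gamma:J\to\mathcal S$ is critical if for every compact interval $C\subset J$ and every smooth variation $\gamma_u$ ($|u|$ small) of $\gamma=\gamma_0$ through generic transversal curves with $\gamma_u=\gamma$ outside a compact subset of the interior of $C$, one has $\frac{d}{du}\big|_{u=0}\mathfrak S_{\gamma_u,C}=0$. A closed critical curve is a periodic critical curve $\gamma:\mathbb R\to\mathcal S$. Symmetrical configurations of the second kind. For $(r,\rho)\in(-2,-\frac12)\times(0,\sqrt2)$ let $$\mu_2(r,\rho)=\frac{-4+4r-12\rho^2(1+r)+(r-1)\rho^4}{-4+4r-12\rho^2(1+r)+(r-1)\rho^4-2\big((2+3r-3r^2-2r^3)(-4\rho+\rho^5)\big)^{2/3}}\in(0,1),$$ $e_2^1=r\frac{\mu_2}{1-\mu_2}$, $e_2^2=-(1+r)\frac{\mu_2}{1-\mu_2}$, $e_2^3=\frac{\mu_2}{1-\mu_2}$, $D_2(r,\rho)=\mathrm{diag}(-ie_2^3,-ie_2^2,-ie_2^1)$, $\mathcal U=\begin{pmatrix}\frac1{\sqrt2}&0&\frac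 i{\sqrt2}\\0&1&0\\\frac i{\sqrt2}&0&\frac1{\sqrt2}\end{pmatrix}$, $S(\rho)=[{}^t(1,\rho,i\rho^2/2)]\in\mathcal S$. For $r\in\mathbb Q$, the symmetrical configuration of the second kind with spectral parameter $r$ and Clifford parameter $\rho$ is $\eta_{r,\rho}(s)=\big(\mathcal U\exp(sD_2(r,\rho))\,\mathcal U^{-1}\big)S(\rho)$. Torus knot type. For $\theta_1,\theta_2\in\mathbb R$ let $$R(\theta_1,\theta_2)=\begin{pmatrix}e^{-\frac i6(\theta_1+2\theta_2)}\cos\frac{\theta_1}2&0&e^{-\frac i6(\theta_1+2\theta_2)}\sin\frac{\theta_1}2\\0&e^{\frac i3(\theta_1+2\theta_2)}&0\\-e^{-\frac i6(\theta_1+2\theta_2)}\sin\frac{\theta_1}2&0&e^{-\frac i6(\theta_1+2\theta_2)}\cos\frac{\theta_1}2\end{pmatrix}\in G.$$ For $\rho\in(0,\sqrt2)$ the set $\mathcal T_\rho=\{R(\theta_1,\theta_2)S(\rho)\}$ is an embedded 2-torus in $\mathcal S$ with angular coordinates $(\theta_1,\theta_2)\in(\mathbb R/2\pi\mathbb Z)^2$. Under the Heisenberg projection $[\mathbf z]\mapsto(\mathrm{Re}(z_2/z_1),\mathrm{Im}(z_2/z_1),\mathrm{Re}(z_3/z_1))$ onto $\mathbb R^3$, $R(0,\theta_2)$ is the counterclockwise rotation by $\theta_2$ about the $z$-axis and $R(\theta_1,0)$ rotates around the Clifford circle $x^2+y^2=2,\ z=0$. A simple closed curve on $\mathcal T_\rho$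 along which $\theta_1,\theta_2$ are linear in the parameter is a torus knot of type $(p,q)$, $p,q$ coprime, if $p/q=-\theta_2'/\theta_1'$; it is positive if $pq>0$ (here $p,q>0$). *)

theory Defs
  imports "HOL-Analysis.Analysis"
begin

section \<open>Smooth maps on open subsets of normed spaces\<close>

primrec C_k_on :: "nat \<Rightarrow> 'a::real_normed_vector set \<Rightarrow> ('a \<Rightarrow> 'b::real_normed_vector) \<Rightarrow> bool"
  where
    "C_k_on 0 S f \<longleftrightarrow> continuous_on S f"
  | "C_k_on (Suc k) S f \<longleftrightarrow> (\<forall>x\<in>S. f differentiable (at x)) \<and>
       (\<forall>v. C_k_on k S (\<lambda>x. frechet_derivative f (at x) v))"

text \<open>Only meaningful for open S.\<close>

definition smooth_on :: "'a::real_normed_vector set \<Rightarrow> ('a \<Rightarrow> 'b::real_normed_vector) \<Rightarrow> bool"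
  where "smooth_on S f \<longleftrightarrow> (\<forall>k. C_k_on k S f)"

definition vderiv :: "(real \<Rightarrow> 'b::real_normed_vector) \<Rightarrow> real \<Rightarrow> 'b"
  where "vderiv f t = vector_derivative f (at t)"

section \<open>The pseudo-Hermitian space and the CR sphere\<close>

definition hmat :: "complex^3^3"
  where "hmat = vector [vector [0, 0, \<i>], vector [0, 1, 0], vector [- \<i>, 0, 0]]"

text \<open>The form is conjugate-linear in the first argument.\<close>

definition herm :: "complex^3 \<Rightarrow> complex^3 \<Rightarrow> complex"
  where "herm z w = (\<Sum>i\<in>UNIV. cnj (z $ i) * (hmat *v w) $ i)"

definition null_vectors :: "(complex^3) set"
  where "null_vectors = {z. z \<noteq> 0 \<and> herm z z = 0}"

text \<open>Points of the complex projective plane are the one-dimensional linear subspaces of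
  \<open>complex^3\<close>; \<open>proj z\<close> is the point with homogeneous coordinates z (for nonzero z).\<close>

definition proj :: "complex^3 \<Rightarrow> (complex^3) set"
  where "proj z = range (\<lambda>c. c *s z)"

definition CP2 :: "(complex^3) set set"
  where "CP2 = proj ` {z. z \<noteq> 0}"

definition CR_sphere :: "(complex^3) set set"
  where "CR_sphere = {proj z | z. z \<noteq> 0 \<and> herm z z = 0}"

text \<open>The standard affine charts of the projective plane: on \<open>chart_dom j\<close> a point is described by
  its representative whose j-th homogeneous coordinate is 1.\<close>

definition chart_dom :: "3 \<Rightarrow> (complex^3) set set"
  where "chart_dom j = {L \<in> CP2. \<exists>w\<in>L. w $ j \<noteq> 0}"

definition chart :: "3 \<Rightarrow> (complex^3) set \<Rightarrow> complex^3"
  where "chart j L = (THE w. w \<in> L \<and> w $ j = 1)"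

text \<open>Smoothness of a map from an open set into the projective plane. The CR sphere is an embedded
  submanifold, so this is also smoothness of maps with values in the CR sphere.\<close>

definition CP2_smooth_on :: "'a::real_normed_vector set \<Rightarrow> ('a \<Rightarrow> (complex^3) set) \<Rightarrow> bool"
  where "CP2_smooth_on S f \<longleftrightarrow> f ` S \<subseteq> CP2 \<and>
    (\<forall>j. open {x \<in> S. f x \<in> chart_dom j} \<and>
         smooth_on {x \<in> S. f x \<in> chart_dom j} (\<lambda>x. chart j (f x)))"

definition adjoint_mat :: "complex^3^3 \<Rightarrow> complex^3^3"
  where "adjoint_mat A = (\<chi> i j. cnj (A $ j $ i))"

definition G_grp :: "(complex^3^3) set"
  where "G_grp = {A. det A = 1 \<and> adjoint_mat A ** hmat ** A = hmat}"

definition act :: "complex^3^3 \<Rightarrow> (complex^3) set \<Rightarrow> (complex^3) set"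
  where "act A L = (\<lambda>z. A *v z) ` L"

section \<open>Transversal curves and the infinitesimal strain\<close>

definition smooth_curve :: "(real \<Rightarrow> (complex^3) set) \<Rightarrow> bool"
  where "smooth_curve \<gamma> \<longleftrightarrow> CP2_smooth_on UNIV \<gamma> \<and> range \<gamma> \<subseteq> CR_sphere"

definition lift_of :: "(real \<Rightarrow> (complex^3) set) \<Rightarrow> (real \<Rightarrow> complex^3) \<Rightarrow> bool"
  where "lift_of \<gamma> \<Gamma> \<longleftrightarrow> smooth_on UNIV \<Gamma> \<and> range \<Gamma> \<subseteq> null_vectors \<and> (\<forall>t. \<gamma> t = proj (\<Gamma> t))"

text \<open>The value of the contact form on the tangent vector represented by v at the point represented
  by the null vector z. Along a lift \<open>\<Gamma>\<close> with \<open>v = \<Gamma>'\<close> it is real, and it does not depend on the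
  lift.\<close>

definition contact_form :: "complex^3 \<Rightarrow> complex^3 \<Rightarrow> complex"
  where "contact_form z v = - \<i> * herm z v / (\<Sum>i\<in>UNIV. cnj (z $ i) * z $ i)"

definition transversal :: "(real \<Rightarrow> (complex^3) set) \<Rightarrow> bool"
  where "transversal \<gamma> \<longleftrightarrow> smooth_curve \<gamma> \<and>
    (\<exists>\<Gamma>. lift_of \<gamma> \<Gamma> \<and> (\<forall>t. contact_form (\<Gamma> t) (vderiv \<Gamma> t) \<noteq> 0))"

text \<open>\<open>herm (\<Gamma> t) (\<Gamma>' t)\<close> is purely imaginary for a null lift, so taking the real part loses
  nothing.\<close>

definition positively_parametrized :: "(real \<Rightarrow> (complex^3) set) \<Rightarrow> bool"
  where "positively_parametrized \<gamma> \<longleftrightarrow>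
    (\<exists>\<Gamma>. lift_of \<gamma> \<Gamma> \<and> (\<forall>t. Re (- \<i> * herm (\<Gamma> t) (vderiv \<Gamma> t)) > 0))"

definition lift_det :: "(real \<Rightarrow> complex^3) \<Rightarrow> real \<Rightarrow> complex"
  where "lift_det \<Gamma> t = det (transpose
    (vector [\<Gamma> t, vderiv \<Gamma> t, vderiv (vderiv \<Gamma>) t] :: complex^3^3))"

definition generic :: "(real \<Rightarrow> (complex^3) set) \<Rightarrow> bool"
  where "generic \<gamma> \<longleftrightarrow> (\<exists>\<Gamma>. lift_of \<gamma> \<Gamma> \<and> (\<forall>t. lift_det \<Gamma> t \<noteq> 0))"

definition generic_transversal :: "(real \<Rightarrow> (complex^3) set) \<Rightarrow> bool"
  where "generic_transversal \<gamma> \<longleftrightarrow> transversal \<gamma> \<and> positively_parametrized \<gamma> \<and> generic \<gamma>"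

definition wilczynski_lift :: "(real \<Rightarrow> (complex^3) set) \<Rightarrow> (real \<Rightarrow> complex^3) \<Rightarrow> bool"
  where "wilczynski_lift \<gamma> \<Gamma> \<longleftrightarrow> lift_of \<gamma> \<Gamma> \<and> (\<forall>t. lift_det \<Gamma> t = - 1)"

text \<open>Wilczynski lifts differ by constant cube roots of unity, so the choice is immaterial; the
  quotient is real (and positive), so taking the real part loses nothing.\<close>

definition strain_density :: "(real \<Rightarrow> (complex^3) set) \<Rightarrow> real \<Rightarrow> real"
  where "strain_density \<gamma> t =
    (let \<Gamma> = (SOME \<Gamma>. wilczynski_lift \<gamma> \<Gamma>) in Re (\<i> / herm (\<Gamma> t) (vderiv \<Gamma> t)))"

definition total_strain :: "(real \<Rightarrow> (complex^3) set) \<Rightarrow> real \<Rightarrow> real \<Rightarrow> real"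
  where "total_strain \<gamma> a b = integral {a..b} (strain_density \<gamma>)"

section \<open>Critical curves\<close>

definition admissible_variation ::
  "(real \<Rightarrow> (complex^3) set) \<Rightarrow> real \<Rightarrow> real \<Rightarrow> real \<Rightarrow> (real \<Rightarrow> real \<Rightarrow> (complex^3) set) \<Rightarrow> bool"
  where "admissible_variation \<gamma> a b \<epsilon> g \<longleftrightarrow> 0 < \<epsilon> \<and>
    CP2_smooth_on ({- \<epsilon><..<\<epsilon>} \<times> UNIV) (\<lambda>(u, t). g u t) \<and>
    (\<forall>u\<in>{- \<epsilon><..<\<epsilon>}. generic_transversal (g u)) \<and>
    (\<forall>t. g 0 t = \<gamma> t) \<and>
    (\<exists>K. compact K \<and> K \<subseteq> {a<..<b} \<and> (\<forall>u\<in>{- \<epsilon><..<\<epsilon>}. \<forall>t. t \<notin> K \<longrightarrow> g u t = \<gamma> t))"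

definition critical_curve :: "(real \<Rightarrow> (complex^3) set) \<Rightarrow> bool"
  where "critical_curve \<gamma> \<longleftrightarrow> generic_transversal \<gamma> \<and>
    (\<forall>a b \<epsilon> g. a < b \<longrightarrow> admissible_variation \<gamma> a b \<epsilon> g \<longrightarrow>
       ((\<lambda>u. total_strain (g u) a b) has_real_derivative 0) (at 0))"

definition closed_critical_curve :: "(real \<Rightarrow> (complex^3) set) \<Rightarrow> bool"
  where "closed_critical_curve \<gamma> \<longleftrightarrow> critical_curve \<gamma> \<and> (\<exists>T>0. \<forall>t. \<gamma> (t + T) = \<gamma> t)"

text \<open>Reparametrizations preserve the orientation because transversal curves are always positively
  parametrized.\<close>

definition congruent_curves ::
  "(real \<Rightarrow> (complex^3) set) \<Rightarrow> (real \<Rightarrow> (complex^3) set) \<Rightarrow> bool"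
  where "congruent_curves \<gamma> \<eta> \<longleftrightarrow>
    (\<exists>A\<in>G_grp. \<exists>\<phi>::real \<Rightarrow> real. smooth_on UNIV \<phi> \<and> bij \<phi> \<and> (\<forall>t. deriv \<phi> t > 0) \<and>
       (\<forall>t. \<gamma> t = act A (\<eta> (\<phi> t))))"

section \<open>Symmetrical configurations of the second kind\<close>

definition mu2 :: "real \<Rightarrow> real \<Rightarrow> real"
  where "mu2 r \<rho> =
    (- 4 + 4 * r - 12 * \<rho>^2 * (1 + r) + (r - 1) * \<rho>^4) /
    (- 4 + 4 * r - 12 * \<rho>^2 * (1 + r) + (r - 1) * \<rho>^4
       - 2 * ((2 + 3 * r - 3 * r^2 - 2 * r^3) * (- 4 * \<rho> + \<rho>^5)) powr (2 / 3))"

definition e21 :: "real \<Rightarrow> real \<Rightarrow> real"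
  where "e21 r \<rho> = r * (mu2 r \<rho> / (1 - mu2 r \<rho>))"

definition e22 :: "real \<Rightarrow> real \<Rightarrow> real"
  where "e22 r \<rho> = - (1 + r) * (mu2 r \<rho> / (1 - mu2 r \<rho>))"

definition e23 :: "real \<Rightarrow> real \<Rightarrow> real"
  where "e23 r \<rho> = mu2 r \<rho> / (1 - mu2 r \<rho>)"

definition D2 :: "real \<Rightarrow> real \<Rightarrow> complex^3^3"
  where "D2 r \<rho> = vector [
    vector [- \<i> * of_real (e23 r \<rho>), 0, 0],
    vector [0, - \<i> * of_real (e22 r \<rho>), 0],
    vector [0, 0, - \<i> * of_real (e21 r \<rho>)]]"

definition U_mat :: "complex^3^3"
  where "U_mat = vector [
    vector [1 / of_real (sqrt 2), 0, \<i> / of_real (sqrt 2)],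
    vector [0, 1, 0],
    vector [\<i> / of_real (sqrt 2), 0, 1 / of_real (sqrt 2)]]"

definition mat_exp :: "complex^3^3 \<Rightarrow> complex^3^3"
  where "mat_exp A = (\<Sum>n. (1 / fact n) *\<^sub>R (((**) A ^^ n) (mat 1)))"

definition S_pt :: "real \<Rightarrow> (complex^3) set"
  where "S_pt \<rho> = proj (vector [1, of_real \<rho>, \<i> * of_real (\<rho>^2) / 2])"

definition eta_curve :: "real \<Rightarrow> real \<Rightarrow> real \<Rightarrow> (complex^3) set"
  where "eta_curve r \<rho> s =
    act (U_mat ** mat_exp (s *\<^sub>R D2 r \<rho>) ** matrix_inv U_mat) (S_pt \<rho>)"

definition symmetrical_configuration_2 ::
  "real \<Rightarrow> real \<Rightarrow> (real \<Rightarrow> (complex^3) set) \<Rightarrow> bool"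
  where "symmetrical_configuration_2 r \<rho> \<eta> \<longleftrightarrow>
    r \<in> \<rat> \<and> r \<in> {- 2<..<- (1 / 2)} \<and> \<rho> \<in> {0<..<sqrt 2} \<and> \<eta> = eta_curve r \<rho>"

section \<open>Torus knot type\<close>

definition R_mat :: "real \<Rightarrow> real \<Rightarrow> complex^3^3"
  where "R_mat \<theta>1 \<theta>2 = vector [
    vector [cis (- (\<theta>1 + 2 * \<theta>2) / 6) * of_real (cos (\<theta>1 / 2)), 0,
            cis (- (\<theta>1 + 2 * \<theta>2) / 6) * of_real (sin (\<theta>1 / 2))],
    vector [0, cis ((\<theta>1 + 2 * \<theta>2) / 3), 0],
    vector [- cis (- (\<theta>1 + 2 * \<theta>2) / 6) * of_real (sin (\<theta>1 / 2)), 0,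
            cis (- (\<theta>1 + 2 * \<theta>2) / 6) * of_real (cos (\<theta>1 / 2))]]"

definition simple_closed_curve :: "(real \<Rightarrow> (complex^3) set) \<Rightarrow> bool"
  where "simple_closed_curve c \<longleftrightarrow> (\<exists>T>0. (\<forall>t. c (t + T) = c t) \<and> inj_on c {0..<T})"

text \<open>The angular coordinates of a curve on the torus are taken as functions with values in the
  universal cover of \<open>(\<real>/2\<pi>\<int>)\<^sup>2\<close>; linear in the parameter means affine there.\<close>

definition torus_knot_type :: "real \<Rightarrow> (real \<Rightarrow> (complex^3) set) \<Rightarrow> int \<Rightarrow> int \<Rightarrow> bool"
  where "torus_knot_type \<rho> c p q \<longleftrightarrow> simple_closed_curve c \<and> coprime p q \<and> q \<noteq> 0 \<and>
    (\<exists>a1 b1 a2 b2. a1 \<noteq> 0 \<and>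
       (\<forall>t. c t = act (R_mat (a1 * t + b1) (a2 * t + b2)) (S_pt \<rho>)) \<and>
       of_int p / of_int q = - a2 / a1)"

definition clifford_param :: "real \<Rightarrow> real"
  where "clifford_param r =
    sqrt ((6 + 6 * r + 4 * sqrt (3 * (1 + r + r^2))
           - 4 * sqrt (5 + 8 * r + 5 * r^2 + 3 * (1 + r) * sqrt (3 * (1 + r + r^2))))
          / (1 - r))"

end

theory Submission
  imports Defs
begin

text \<open>Along a generic transversal curve the lift \<open>F1\<close> that is scaled by the strain extends to a frame
  \<open>(F1, F2, F3)\<close> with values in \<open>G_grp\<close>, up to a fixed matrix, whose structure equations involve two
  invariants \<open>k\<close> and \<open>\<tau>\<close>. Varying \<open>F1\<close> in the direction \<open>\<phi> F2\<close>, for compactly supported complex \<open>\<phi>\<close>,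
  gives the Euler--Lagrange equations \<open>\<tau> = - 9 k\<^sup>2\<close>, \<open>k' = 0\<close>. So a critical curve is an orbit of the
  one-parameter group whose eigenvalues are \<open>\<i> y\<close> with \<open>(y + 2k)\<^sup>2 (y - 4k) = 1\<close>. If the curve is
  closed, the monodromy of the frame is a scalar of modulus one, which forces three distinct real roots
  \<open>y1 < y2 < y3\<close> with commensurable differences. Such an orbit is determined up to congruence
  and scaling of the parameter by the ratios of the roots and the ratios of the norms
  \<open>1 / (3 (y - 2k))\<close> of the spectral components of \<open>F1\<close>; comparing them with those of
  \<open>eta_curve r \<rho>\<close> gives \<open>r = y3 / y1\<close> and \<open>\<rho> = clifford_param r\<close>, and the knot type \<open>p / q\<close> is
  \<open>(y2 - y1) / (y3 - y1) = (2 + r) / (1 - r)\<close>.\<close>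

section \<open>Calculus of smooth maps\<close>

text \<open>\<open>strain_density\<close> rests on a choice of Wilczynski lift, which is awkward to
  follow along a variation. The way round is scaling: multiplying a lift by \<mu> multiplies its
  determinant by \<mu>^3 and \<open>herm \<Gamma> \<Gamma>'\<close> by |\<mu>|^2, so the density is
  |det|^(2/3) / Im \<open>herm \<Gamma> \<Gamma>'\<close> for every lift with nonvanishing
  determinant, in particular for one that is polynomial in the variation parameter. The direction
  \<open>F2\<close> suffices because, among vectors tangent to the null cone at \<open>F1\<close>,
  multiples of \<open>F1\<close> only rescale the lift and real multiples of \<open>F3\<close> agree
  modulo \<open>F1\<close> with multiples of the velocity. In signature (2,1) exactly one spectral
  component has negative norm, that of \<open>y1\<close>; this fixes its partner in the eigenbasis
  of the model curve. Matching the three norms up to one common factor leaves one condition on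
  \<rho>, namely \<rho>^2 = 2 (B - A) / (B + A), where A^2 and B^2 are |y1 + 2c| and y3 + 2c divided
  by |y1|, with c = -k; \<open>clifford_param\<close> is its solution written with nested
  radicals.\<close>

lemma C_k_on_cong:
  assumes "open S" "\<And>x. x \<in> S \<Longrightarrow> f x = g x" "C_k_on k S f"
  shows "C_k_on k S g"
  using assms(2,3)
proof (induction k arbitrary: f g)
  case 0
  then show ?case by (simp cong: continuous_on_cong)
next
  case (Suc k)
  have d: "(g has_derivative frechet_derivative f (at x)) (at x)" if "x \<in> S" for x
    using Suc.prems that \<open>open S\<close> frechet_derivative_works[of f "at x"]
    by (auto intro: has_derivative_transform_within_open)
  then have eq: "frechet_derivative g (at x) = frechet_derivative f (at x)" if "x \<in> S" for x
    using frechet_derivative_at[OF d[OF that]] by simp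
  have "C_k_on k S (\<lambda>x. frechet_derivative g (at x) v)" for v
    by (rule Suc.IH[of "\<lambda>x. frechet_derivative f (at x) v"]) (use Suc.prems eq in auto)
  then show ?case using d by (auto simp: differentiable_def)
qed

lemma C_k_on_SucI:
  assumes "\<And>x. x \<in> S \<Longrightarrow> (f has_derivative f' x) (at x)"
    and "\<And>v. C_k_on k S (\<lambda>x. f' x v)" and "open S"
  shows "C_k_on (Suc k) S f"
proof -
  have "frechet_derivative f (at x) = f' x" if "x \<in> S" for x
    using frechet_derivative_at[OF assms(1)[OF that]] by simp
  then have "C_k_on k S (\<lambda>x. frechet_derivative f (at x) v)" for v
    by (intro C_k_on_cong[OF assms(3) _ assms(2)[of v]]) simp
  then show ?thesis using assms(1) by (auto simp: differentiable_def)
qed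

lemma C_k_on_SucD:
  assumes "C_k_on (Suc k) S f"
  shows "\<And>x. x \<in> S \<Longrightarrow> (f has_derivative frechet_derivative f (at x)) (at x)"
    and "\<And>v. C_k_on k S (\<lambda>x. frechet_derivative f (at x) v)"
  using assms frechet_derivative_works by auto

text \<open>The product rule depends on this: the undifferentiated factor is known at order k + 1
  and needed at order k.\<close>

lemma C_k_on_Suc_imp: "C_k_on (Suc k) S f \<Longrightarrow> C_k_on k S f"
proof (induction k arbitrary: f)
  case 0
  then show ?case
    by (auto intro!: continuous_at_imp_continuous_on differentiable_imp_continuous_within)
next
  case (Suc k)
  then show ?case by auto
qed

lemma C_k_on_subset: "C_k_on k S f \<Longrightarrow> T \<subseteq> S \<Longrightarrow> C_k_on k T f"
  by (induction k arbitrary: f) (auto intro: continuous_on_subset)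

lemma C_k_on_const: "open S \<Longrightarrow> C_k_on k S (\<lambda>x. c)"
  by (induction k arbitrary: c) (auto intro!: C_k_on_SucI[where f' = "\<lambda>x v. 0"] simp del: C_k_on.simps(2))

lemma C_k_on_add:
  assumes "open S" "C_k_on k S f" "C_k_on k S g"
  shows "C_k_on k S (\<lambda>x. f x + g x)"
  using assms(2,3)
proof (induction k arbitrary: f g)
  case 0
  then show ?case by (simp add: continuous_on_add)
next
  case (Suc k)
  show ?case
    by (rule C_k_on_SucI[where f' = "\<lambda>x v. frechet_derivative f (at x) v + frechet_derivative g (at x) v"])
      (intro has_derivative_add C_k_on_SucD[OF Suc.prems(1)] C_k_on_SucD[OF Suc.prems(2)] Suc.IH
        \<open>open S\<close>; assumption)+
qed

lemma C_k_on_bounded_linear: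
  assumes "open S" "bounded_linear T" "C_k_on k S f"
  shows "C_k_on k S (\<lambda>x. T (f x))"
  using assms(3)
proof (induction k arbitrary: f)
  case 0
  then show ?case using assms(2) by (simp add: bounded_linear.continuous_on)
next
  case (Suc k)
  show ?case
    by (rule C_k_on_SucI[where f' = "\<lambda>x v. T (frechet_derivative f (at x) v)"])
      (use C_k_on_SucD[OF Suc.prems] Suc.IH assms in \<open>auto intro: bounded_linear.has_derivative\<close>)
qed

lemma C_k_on_bilinear:
  assumes "open S" "bounded_bilinear B" "C_k_on k S f" "C_k_on k S g"
  shows "C_k_on k S (\<lambda>x. B (f x) (g x))"
  using assms(3,4)
proof (induction k arbitrary: f g)
  case 0
  then show ?case using assms(2) by (simp add: bounded_bilinear.continuous_on)
next
  case (Suc k)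
  show ?case
  proof (rule C_k_on_SucI[where f' = "\<lambda>x v. B (f x) (frechet_derivative g (at x) v)
       + B (frechet_derivative f (at x) v) (g x)"])
    show "C_k_on k S (\<lambda>x. B (f x) (frechet_derivative g (at x) v)
       + B (frechet_derivative f (at x) v) (g x))" for v
      by (intro C_k_on_add Suc.IH \<open>open S\<close> C_k_on_SucD(2)[OF Suc.prems(1)]
          C_k_on_SucD(2)[OF Suc.prems(2)] C_k_on_Suc_imp[OF Suc.prems(1)] C_k_on_Suc_imp[OF Suc.prems(2)])
  qed (use C_k_on_SucD[OF Suc.prems(1)] C_k_on_SucD[OF Suc.prems(2)] assms(1,2) in
      \<open>auto intro: bounded_bilinear.FDERIV\<close>)
qed

lemma C_k_on_inverse:
  fixes f :: "'a::real_normed_vector \<Rightarrow> 'b::real_normed_field"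
  assumes "open S" "C_k_on k S f" "\<And>x. x \<in> S \<Longrightarrow> f x \<noteq> 0"
  shows "C_k_on k S (\<lambda>x. inverse (f x))"
  using assms(2,3)
proof (induction k arbitrary: f)
  case 0
  then show ?case by (simp add: continuous_on_inverse)
next
  case (Suc k)
  show ?case
  proof (rule C_k_on_SucI[where f' = "\<lambda>x v. - (inverse (f x) * frechet_derivative f (at x) v
       * inverse (f x))"])
    have "C_k_on k S (\<lambda>x. inverse (f x))"
      using Suc C_k_on_Suc_imp by blast
    then show "C_k_on k S (\<lambda>x. - (inverse (f x) * frechet_derivative f (at x) v * inverse (f x)))" for v
      by (intro C_k_on_bounded_linear[OF \<open>open S\<close> bounded_linear_minus[OF bounded_linear_ident]]
          C_k_on_bilinear[OF \<open>open S\<close> bounded_bilinear_mult] C_k_on_SucD[OF Suc.prems(1)])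
  qed (use C_k_on_SucD[OF Suc.prems(1)] Suc.prems(2) assms(1) in \<open>auto intro: has_derivative_inverse\<close>)
qed

text \<open>Since \<open>L\<close> is the same at all points, a directional derivative of the
  composite is a directional derivative of \<open>f\<close>, in the fixed direction
  \<open>L v\<close>, composed with \<open>g\<close>. The induction therefore stays within one shape
  of function.\<close>

lemma C_k_on_affine_compose:
  assumes "open S" "\<And>x. (g has_derivative L) (at x)" "C_k_on k UNIV f"
  shows "C_k_on k S (\<lambda>x. f (g x))"
  using assms(3)
proof (induction k arbitrary: f)
  case 0
  have "continuous_on S g"
    using assms(2) by (meson continuous_at_imp_continuous_on has_derivative_continuous)
  with 0 show ?case by (auto intro: continuous_on_compose2)
next
  case (Suc k)
  show ?case
  proof (rule C_k_on_SucI[where f' = "\<lambda>x v. frechet_derivative f (at (g x)) (L v)"])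
    show "((\<lambda>x. f (g x)) has_derivative (\<lambda>v. frechet_derivative f (at (g x)) (L v))) (at x)" for x
      using has_derivative_compose[OF assms(2) C_k_on_SucD(1)[OF Suc.prems]] by simp
  qed (use C_k_on_SucD(2)[OF Suc.prems] Suc.IH assms in auto)
qed

named_theorems smooth

lemma smooth_onD: "smooth_on S f \<Longrightarrow> C_k_on k S f"
  by (simp add: smooth_on_def)

lemma smooth_on_subset: "smooth_on S f \<Longrightarrow> T \<subseteq> S \<Longrightarrow> smooth_on T f"
  unfolding smooth_on_def using C_k_on_subset by blast

lemma smooth_on_cong: "open S \<Longrightarrow> (\<And>x. x \<in> S \<Longrightarrow> f x = g x) \<Longrightarrow> smooth_on S f \<Longrightarrow> smooth_on S g"
  unfolding smooth_on_def using C_k_on_cong by blast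

lemma smooth_on_imp_continuous_on: "smooth_on S f \<Longrightarrow> continuous_on S f"
  using smooth_onD[of S f 0] by simp

lemma smooth_on_const [smooth]: "open S \<Longrightarrow> smooth_on S (\<lambda>x. c)"
  by (simp add: smooth_on_def C_k_on_const)

lemma smooth_on_add [smooth]:
  "open S \<Longrightarrow> smooth_on S f \<Longrightarrow> smooth_on S g \<Longrightarrow> smooth_on S (\<lambda>x. f x + g x)"
  by (simp add: smooth_on_def C_k_on_add)

lemma smooth_on_bounded_linear:
  "bounded_linear T \<Longrightarrow> open S \<Longrightarrow> smooth_on S f \<Longrightarrow> smooth_on S (\<lambda>x. T (f x))"
  by (simp add: smooth_on_def C_k_on_bounded_linear)

lemmas smooth_on_uminus [smooth] =
  smooth_on_bounded_linear[OF bounded_linear_minus[OF bounded_linear_ident]]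
lemmas smooth_on_cnj [smooth] = smooth_on_bounded_linear[OF bounded_linear_cnj]
lemmas smooth_on_Re [smooth] = smooth_on_bounded_linear[OF bounded_linear_Re]
lemmas smooth_on_Im [smooth] = smooth_on_bounded_linear[OF bounded_linear_Im]
lemmas smooth_on_nth [smooth] = smooth_on_bounded_linear[OF bounded_linear_vec_nth]
lemmas smooth_on_of_real [smooth] = smooth_on_bounded_linear[OF bounded_linear_of_real]

lemma smooth_on_diff [smooth]:
  "open S \<Longrightarrow> smooth_on S f \<Longrightarrow> smooth_on S g \<Longrightarrow> smooth_on S (\<lambda>x. f x - g x)"
  using smooth_on_add[OF _ _ smooth_on_uminus, of S f g] by simp

lemma smooth_on_bilinear:
  "bounded_bilinear B \<Longrightarrow> open S \<Longrightarrow> smooth_on S f \<Longrightarrow> smooth_on S g \<Longrightarrow>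
    smooth_on S (\<lambda>x. B (f x) (g x))"
  by (simp add: smooth_on_def C_k_on_bilinear)

lemmas smooth_on_mult [smooth] = smooth_on_bilinear[OF bounded_bilinear_mult]

lemma smooth_on_power [smooth]:
  fixes f :: "'a::real_normed_vector \<Rightarrow> 'b::real_normed_field"
  shows "open S \<Longrightarrow> smooth_on S f \<Longrightarrow> smooth_on S (\<lambda>x. f x ^ n)"
  by (induction n) (auto intro: smooth)

lemma smooth_on_inverse [smooth]:
  fixes f :: "'a::real_normed_vector \<Rightarrow> 'b::real_normed_field"
  shows "open S \<Longrightarrow> smooth_on S f \<Longrightarrow> (\<And>x. x \<in> S \<Longrightarrow> f x \<noteq> 0) \<Longrightarrow> smooth_on S (\<lambda>x. inverse (f x))"
  by (simp add: smooth_on_def C_k_on_inverse)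

lemma smooth_on_divide [smooth]:
  fixes f :: "'a::real_normed_vector \<Rightarrow> 'b::real_normed_field"
  shows "open S \<Longrightarrow> smooth_on S f \<Longrightarrow> smooth_on S g \<Longrightarrow> (\<And>x. x \<in> S \<Longrightarrow> g x \<noteq> 0) \<Longrightarrow>
    smooth_on S (\<lambda>x. f x / g x)"
  unfolding divide_inverse by (intro smooth)

lemma smooth_on_affine_compose:
  "(\<And>x. (g has_derivative L) (at x)) \<Longrightarrow> open S \<Longrightarrow> smooth_on UNIV f \<Longrightarrow> smooth_on S (\<lambda>x. f (g x))"
  unfolding smooth_on_def using C_k_on_affine_compose by blast

lemma smooth_on_linear_map:
  assumes "open S" "bounded_linear T"
  shows "smooth_on S T"
  unfolding smooth_on_def
proof
  fix k
  show "C_k_on k S T"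
  proof (cases k)
    case 0
    then show ?thesis using assms by (simp add: linear_continuous_on)
  next
    case (Suc m)
    show ?thesis unfolding Suc
      by (rule C_k_on_SucI[where f' = "\<lambda>x. T"])
        (use assms in \<open>auto simp: C_k_on_const bounded_linear_imp_has_derivative\<close>)
  qed
qed

lemmas smooth_on_fst [smooth] = smooth_on_linear_map[OF _ bounded_linear_fst]

lemma smooth_on_compose_snd [smooth]:
  "open S \<Longrightarrow> smooth_on UNIV f \<Longrightarrow> smooth_on S (\<lambda>x. f (snd x))"
  by (rule smooth_on_affine_compose[where L = snd]) (auto intro: bounded_linear_imp_has_derivative bounded_linear_snd)

lemma smooth_on_shift: "smooth_on UNIV f \<Longrightarrow> smooth_on UNIV (\<lambda>t::real. f (t + c))"
  by (rule smooth_on_affine_compose[where L = "\<lambda>h. h"]) (auto intro!: derivative_eq_intros)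

subsection \<open>Smooth functions of one real variable\<close>

lemma vderiv_eq: "(f has_vector_derivative f') (at t) \<Longrightarrow> vderiv f t = f'"
  unfolding vderiv_def by (rule vector_derivative_at)

lemma smooth_on_has_vector_derivative:
  assumes "smooth_on UNIV f"
  shows "(f has_vector_derivative vderiv f t) (at t)"
  unfolding vderiv_def
  using smooth_onD[OF assms, of 1] by (simp add: vector_derivative_works)

lemma smooth_on_vderiv [smooth]:
  assumes "smooth_on UNIV f"
  shows "smooth_on UNIV (vderiv f)"
proof -
  have "frechet_derivative f (at x) 1 = vderiv f x" for x
    using frechet_derivative_at[OF smooth_on_has_vector_derivative[OF assms, of x, unfolded has_vector_derivative_def]]
    by (metis scaleR_one)
  then have "(\<lambda>x. frechet_derivative f (at x) 1) = vderiv f" by auto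
  then show ?thesis
    using assms unfolding smooth_on_def by (metis C_k_on_SucD(2))
qed

lemma C_k_on_SucI_vector:
  assumes "\<And>t. (f has_vector_derivative f' t) (at t)" "C_k_on k UNIV f'"
  shows "C_k_on (Suc k) UNIV f"
  by (rule C_k_on_SucI[where f' = "\<lambda>t v. v *\<^sub>R f' t"])
    (use assms in \<open>auto simp: has_vector_derivative_def intro: C_k_on_bounded_linear[OF _ bounded_linear_scaleR_right]\<close>)

lemma smooth_onI_vector:
  assumes "\<And>t. (f has_vector_derivative f' t) (at t)" "smooth_on UNIV f'"
  shows "smooth_on UNIV f"
  unfolding smooth_on_def
  using C_k_on_SucI_vector[OF assms(1) smooth_onD[OF assms(2)]] C_k_on_Suc_imp by blast

text \<open>Bootstrap: if \<open>f\<close> is of class k, so is the right-hand side, hence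
  \<open>f\<close> is of class k + 1. It yields smoothness of the exponential of an antiderivative
  without composing smooth maps.\<close>

lemma smooth_on_linear_ode:
  fixes f :: "real \<Rightarrow> complex"
  assumes "\<And>t. (f has_vector_derivative h t * f t) (at t)" "smooth_on UNIV h"
  shows "smooth_on UNIV f"
  unfolding smooth_on_def
proof
  show "C_k_on k UNIV f" for k
  proof (induction k)
    case 0
    show ?case
      using assms(1) by (auto intro!: continuous_at_imp_continuous_on has_vector_derivative_continuous)
  next
    case (Suc k)
    then show ?case
      by (intro C_k_on_SucI_vector[OF assms(1)] C_k_on_bilinear[OF _ bounded_bilinear_mult]
          smooth_onD[OF assms(2)]) auto
  qed
qed

lemma antiderivative_exists:
  fixes f :: "real \<Rightarrow> 'a::euclidean_space"
  assumes "continuous_on UNIV f"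
  obtains F where "\<And>t. (F has_vector_derivative f t) (at t)"
  using einterval_antiderivative[of "-\<infinity>" "\<infinity>" f] assms
  by (auto simp: continuous_on_eq_continuous_at)

text \<open>The family \<open>t\<^sup>-\<^sup>n e\<^sup>-\<^sup>1\<^sup>/\<^sup>t\<close> is closed under differentiation, hence consists of
  smooth functions.\<close>

definition flat :: "nat \<Rightarrow> real \<Rightarrow> real"
  where "flat n t = (if t \<le> 0 then 0 else inverse t ^ n * exp (- inverse t))"

lemma flat_has_derivative:
  "(flat n has_real_derivative flat (n + 2) t - real n * flat (n + 1) t) (at t)"
proof (cases t "0::real" rule: linorder_cases)
  case less
  have "((\<lambda>t. 0) has_real_derivative 0) (at t)" by simp
  then have "(flat n has_real_derivative 0) (at t)"
    by (rule has_field_derivative_transform_within_open[where S = "{..<0}"])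
      (use less in \<open>auto simp: flat_def\<close>)
  then show ?thesis using less by (simp add: flat_def)
next
  case greater
  have i: "(inverse has_real_derivative - (inverse t ^ 2)) (at t)"
    using greater DERIV_inverse[of t UNIV] by (simp add: power2_eq_square)
  have p: "((\<lambda>t. inverse t ^ n) has_real_derivative - real n * inverse t ^ (n + 1)) (at t)"
    by (rule DERIV_cong[OF DERIV_power[OF i, of n]])
      (cases n; simp add: power2_eq_square algebra_simps)
  have "((\<lambda>t. exp (- inverse t)) has_real_derivative exp (- inverse t) * inverse t ^ 2) (at t)"
    using DERIV_chain2[OF DERIV_exp DERIV_minus[OF i]] by simp
  from DERIV_mult[OF p this]
  have "((\<lambda>t. inverse t ^ n * exp (- inverse t)) has_real_derivative
      flat (n + 2) t - real n * flat (n + 1) t) (at t)"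
    using greater by (simp add: flat_def algebra_simps power2_eq_square)
  then show ?thesis
    by (rule has_field_derivative_transform_within_open[where S = "{0<..}"])
      (use greater in \<open>auto simp: flat_def\<close>)
next
  case equal
  have lim: "((\<lambda>x. flat m x) \<longlongrightarrow> 0) (at 0)" for m
  proof (rule filterlim_split_at)
    show "((\<lambda>x. flat m x) \<longlongrightarrow> 0) (at_left 0)"
      by (rule tendsto_eventually) (auto simp: flat_def eventually_at_left_field intro!: exI[of _ "-1"])
    have "((\<lambda>x::real. x ^ m / exp x) \<longlongrightarrow> 0) at_top"
      by (rule tendsto_power_div_exp_0)
    then have "((\<lambda>x::real. inverse x ^ m / exp (inverse x)) \<longlongrightarrow> 0) (at_right 0)"
      by (rule filterlim_compose[OF _ filterlim_inverse_at_top_right])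
    then show "((\<lambda>x. flat m x) \<longlongrightarrow> 0) (at_right 0)"
      by (rule Lim_transform_eventually)
        (auto simp: flat_def eventually_at_right_field exp_minus divide_inverse intro!: exI[of _ 1])
  qed
  \<comment> \<open>The difference quotient of \<open>flat n\<close> at 0 is
    \<open>flat (n + 1)\<close>, so the limits of the family at 0 already give the
    derivative.\<close>
  have "((\<lambda>h. (flat n (0 + h) - flat n 0) / h) \<longlongrightarrow> 0) (at 0)"
    using lim[of "n + 1"]
    by (rule Lim_transform_eventually)
      (auto simp: flat_def eventually_at field_simps intro!: exI[of _ 1])
  then show ?thesis using equal by (simp add: DERIV_def flat_def)
qed

lemma smooth_on_flat: "smooth_on UNIV (flat n)"
  unfolding smooth_on_def
proof
  show "C_k_on k UNIV (flat n)" for k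
  proof (induction k arbitrary: n)
    case 0
    show ?case
      using flat_has_derivative by (auto intro!: continuous_at_imp_continuous_on DERIV_isCont)
  next
    case (Suc k)
    have "C_k_on k UNIV (\<lambda>t. flat (n + 2) t + (- real n) * flat (n + 1) t)"
      by (intro C_k_on_add C_k_on_bilinear[OF _ bounded_bilinear_mult] C_k_on_const Suc open_UNIV)
    then show ?case
      by (intro C_k_on_SucI_vector[OF flat_has_derivative[unfolded has_real_derivative_iff_has_vector_derivative]])
        simp
  qed
qed

lemma bump_function_exists:
  fixes c d :: real
  assumes "c < d"
  obtains f :: "real \<Rightarrow> real" where "smooth_on UNIV f" "\<And>t. f t \<ge> 0" "\<And>t. f t > 0 \<longleftrightarrow> t \<in> {c<..<d}"
proof
  let ?f = "\<lambda>t. flat 0 (t + (- c)) * flat 0 (d - t)"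
  show "smooth_on UNIV ?f"
    by (intro smooth smooth_on_shift smooth_on_flat open_UNIV, rule smooth_on_affine_compose[where L = "\<lambda>h. - h"])
      (auto intro!: derivative_eq_intros smooth_on_flat)
qed (auto simp: flat_def)

lemma vderiv_zero_on_open:
  assumes "open S" "\<And>x. x \<in> S \<Longrightarrow> f x = 0" "t \<in> S"
  shows "vderiv f t = 0"
proof (rule vderiv_eq)
  have "((\<lambda>x. 0) has_vector_derivative 0) (at t)" by simp
  then show "(f has_vector_derivative 0) (at t)"
    by (rule has_vector_derivative_transform_within_open[OF _ assms(1,3)]) (simp add: assms(2))
qed

section \<open>Hermitian form, determinant and lifts\<close>

definition det3 :: "complex^3 \<Rightarrow> complex^3 \<Rightarrow> complex^3 \<Rightarrow> complex"
  where "det3 x y z = det (transpose (vector [x, y, z] :: complex^3^3))"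

lemma det3_eq:
  "det3 x y z = x$1 * (y$2 * z$3 - y$3 * z$2) - x$2 * (y$1 * z$3 - y$3 * z$1)
    + x$3 * (y$1 * z$2 - y$2 * z$1)"
  unfolding det3_def det_transpose by (simp add: det_3 algebra_simps)

lemma lift_det_eq: "lift_det \<Gamma> t = det3 (\<Gamma> t) (vderiv \<Gamma> t) (vderiv (vderiv \<Gamma>) t)"
  by (simp add: lift_det_def det3_def)

lemma herm_eq: "herm z w = \<i> * cnj (z$1) * w$3 + cnj (z$2) * w$2 - \<i> * cnj (z$3) * w$1"
  by (simp add: herm_def hmat_def matrix_vector_mult_def sum_3 algebra_simps)

lemma herm_sym: "cnj (herm z w) = herm w z"
  by (simp add: herm_eq algebra_simps)

lemma herm_linear:
  "herm z (v + w) = herm z v + herm z w" "herm (v + w) z = herm v z + herm w z"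
  "herm z (v - w) = herm z v - herm z w" "herm (v - w) z = herm v z - herm w z"
  "herm z (c *s v) = c * herm z v" "herm (c *s v) z = cnj c * herm v z"
  "herm z (r *\<^sub>R v) = of_real r * herm z v" "herm (r *\<^sub>R v) z = of_real r * herm v z"
  "herm z (- v) = - herm z v" "herm (- v) z = - herm v z"
  by (simp_all add: herm_eq algebra_simps scaleR_conv_of_real[where 'a = complex])

lemma bounded_bilinear_herm: "bounded_bilinear herm"
  unfolding bilinear_conv_bounded_bilinear[symmetric] bilinear_def
  by (auto intro!: linearI simp: herm_linear scaleR_conv_of_real[where 'a = complex])

lemma bounded_bilinear_smult: "bounded_bilinear ((*s) :: complex \<Rightarrow> complex^3 \<Rightarrow> complex^3)"
  unfolding bilinear_conv_bounded_bilinear[symmetric] bilinear_def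
  by (auto intro!: linearI simp: vec_eq_iff algebra_simps scaleR_conv_of_real[where 'a = complex])

lemmas smooth_on_herm [smooth] = smooth_on_bilinear[OF bounded_bilinear_herm]
lemmas smooth_on_smult [smooth] = smooth_on_bilinear[OF bounded_bilinear_smult]

lemma smooth_on_det3 [smooth]:
  "open S \<Longrightarrow> smooth_on S x \<Longrightarrow> smooth_on S y \<Longrightarrow> smooth_on S z \<Longrightarrow>
    smooth_on S (\<lambda>t. det3 (x t) (y t) (z t))"
  unfolding det3_eq by (intro smooth)

lemma det3_has_vector_derivative:
  assumes "(x has_vector_derivative x') (at t within S)" "(y has_vector_derivative y') (at t within S)"
    "(z has_vector_derivative z') (at t within S)"
  shows "((\<lambda>t. det3 (x t) (y t) (z t)) has_vector_derivative
    det3 x' (y t) (z t) + det3 (x t) y' (z t) + det3 (x t) (y t) z') (at t within S)"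
proof -
  note c = bounded_linear.has_vector_derivative[OF bounded_linear_vec_nth]
  show ?thesis unfolding det3_eq
    by (rule has_vector_derivative_eq_rhs,
        (rule has_vector_derivative_add has_vector_derivative_diff has_vector_derivative_mult
          c[OF assms(1)] c[OF assms(2)] c[OF assms(3)])+)
      (simp add: algebra_simps)
qed

lemmas herm_has_vector_derivative = bounded_bilinear.has_vector_derivative[OF bounded_bilinear_herm]
lemmas smult_has_vector_derivative = bounded_bilinear.has_vector_derivative[OF bounded_bilinear_smult]

lemma det3_linear:
  "det3 (x + x') y z = det3 x y z + det3 x' y z"
  "det3 x (y + y') z = det3 x y z + det3 x y' z"
  "det3 x y (z + z') = det3 x y z + det3 x y z'"
  "det3 (c *s x) y z = c * det3 x y z"
  "det3 x (c *s y) z = c * det3 x y z"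
  "det3 x y (c *s z) = c * det3 x y z"
  "det3 (x - x') y z = det3 x y z - det3 x' y z"
  "det3 x (y - y') z = det3 x y z - det3 x y' z"
  "det3 x y (z - z') = det3 x y z - det3 x y z'"
  by (simp_all add: det3_eq algebra_simps scaleR_conv_of_real[where 'a = complex])

lemma det3_alternating [simp]: "det3 x x y = 0" "det3 x y x = 0" "det3 y x x = 0" "det3 0 x y = 0"
  by (simp_all add: det3_eq algebra_simps)

text \<open>The Gram determinant; the sign comes from \<open>det hmat = -1\<close>.\<close>

lemma gram_det3:
  "herm x x * (herm y y * herm z z - herm y z * herm z y)
    - herm x y * (herm y x * herm z z - herm y z * herm z x)
    + herm x z * (herm y x * herm z y - herm y y * herm z x) = - cnj (det3 x y z) * det3 x y z"
  unfolding herm_eq det3_eq by (simp add: algebra_simps)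

section \<open>Homogeneous coordinates, rescaling of lifts and the strain density\<close>

lemma proj_smult:
  assumes "c \<noteq> 0"
  shows "proj (c *s z) = proj z"
proof
  show "proj (c *s z) \<subseteq> proj z"
    unfolding proj_def by (auto simp: vector_smult_assoc)
  have "k *s z = (k / c) *s (c *s z)" for k
    using assms by (simp add: vector_smult_assoc)
  then show "proj z \<subseteq> proj (c *s z)"
    unfolding proj_def by blast
qed

lemma proj_eqD:
  assumes "proj z = proj w" "w \<noteq> 0"
  obtains c where "c \<noteq> 0" "w = c *s z"
proof -
  have "w \<in> proj w" unfolding proj_def by (metis rangeI vector_smult_lid)
  then obtain c where "w = c *s z" using assms(1) unfolding proj_def by auto
  moreover then have "c \<noteq> 0" using assms(2) by auto
  ultimately show ?thesis using that by blast
qed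

text \<open>Pointwise the factor comes from equality of lines. For smoothness it is written as a
  quotient of values of the positive definite product \<open>N\<close>; \<open>herm\<close> cannot
  serve here, as it vanishes on null vectors.\<close>

lemma lift_change:
  assumes "lift_of \<gamma> \<Gamma>" "lift_of \<gamma> \<Delta>"
  obtains \<mu> where "smooth_on UNIV \<mu>" "\<And>t. \<mu> t \<noteq> 0" "\<And>t. \<Delta> t = \<mu> t *s \<Gamma> t"
proof -
  define N where "N x y = cnj (x$1) * y$1 + cnj (x$2) * y$2 + cnj (x$3) * y$3" for x y :: "complex^3"
  have nz: "\<Gamma> t \<noteq> 0" "\<Delta> t \<noteq> 0" for t
    using assms by (auto simp: lift_of_def null_vectors_def image_subset_iff)
  have N: "N x x \<noteq> 0" if "x \<noteq> 0" for x
  proof -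
    have "N x x = of_real ((cmod (x$1))\<^sup>2 + (cmod (x$2))\<^sup>2 + (cmod (x$3))\<^sup>2)"
      unfolding N_def by (simp only: of_real_add complex_norm_square mult.commute)
    moreover have "(cmod (x$1))\<^sup>2 + (cmod (x$2))\<^sup>2 + (cmod (x$3))\<^sup>2 \<noteq> 0"
      using that by (auto simp: vec_eq_iff forall_3 add_nonneg_eq_0_iff)
    ultimately show ?thesis by (metis of_real_eq_0_iff)
  qed
  show ?thesis
  proof
    have s: "smooth_on UNIV \<Gamma>" "smooth_on UNIV \<Delta>" using assms by (auto simp: lift_of_def)
    show "smooth_on UNIV (\<lambda>t. N (\<Gamma> t) (\<Delta> t) / N (\<Gamma> t) (\<Gamma> t))"
      using N nz unfolding N_def by (intro smooth s) auto
  next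
    fix t
    have "proj (\<Gamma> t) = proj (\<Delta> t)" using assms by (auto simp: lift_of_def)
    then obtain c where c: "c \<noteq> 0" "\<Delta> t = c *s \<Gamma> t" using nz proj_eqD by metis
    then have "N (\<Gamma> t) (\<Delta> t) = c * N (\<Gamma> t) (\<Gamma> t)" by (simp add: N_def algebra_simps)
    then show "N (\<Gamma> t) (\<Delta> t) / N (\<Gamma> t) (\<Gamma> t) \<noteq> 0" "\<Delta> t = (N (\<Gamma> t) (\<Delta> t) / N (\<Gamma> t) (\<Gamma> t)) *s \<Gamma> t"
      using c N nz by auto
  qed
qed

lemma vderiv_smult:
  assumes "smooth_on UNIV \<mu>" "smooth_on UNIV \<Gamma>"
  shows "vderiv (\<lambda>t. \<mu> t *s \<Gamma> t :: complex^3) = (\<lambda>t. \<mu> t *s vderiv \<Gamma> t + vderiv \<mu> t *s \<Gamma> t)"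
  using assms by (auto intro!: vderiv_eq smult_has_vector_derivative smooth_on_has_vector_derivative)

lemma vderiv_add:
  assumes "smooth_on UNIV f" "smooth_on UNIV g"
  shows "vderiv (\<lambda>t. f t + g t) = (\<lambda>t. vderiv f t + vderiv g t)"
  using assms by (auto intro!: vderiv_eq has_vector_derivative_add smooth_on_has_vector_derivative)

lemma vderiv2_smult:
  assumes "smooth_on UNIV \<mu>" "smooth_on UNIV \<Gamma>"
  shows "vderiv (vderiv (\<lambda>t. \<mu> t *s \<Gamma> t :: complex^3)) =
    (\<lambda>t. \<mu> t *s vderiv (vderiv \<Gamma>) t + 2 * vderiv \<mu> t *s vderiv \<Gamma> t + vderiv (vderiv \<mu>) t *s \<Gamma> t)"
  using assms
  by (simp add: vderiv_smult vderiv_add smooth fun_eq_iff vec_eq_iff algebra_simps)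

text \<open>Every term containing a derivative of \<mu> is a combination of preceding columns and is
  killed by alternation.\<close>

lemma lift_det_smult:
  assumes "smooth_on UNIV \<mu>" "smooth_on UNIV \<Gamma>"
  shows "lift_det (\<lambda>t. \<mu> t *s \<Gamma> t) t = \<mu> t ^ 3 * lift_det \<Gamma> t"
  by (subst lift_det_eq, subst vderiv2_smult[OF assms], subst vderiv_smult[OF assms])
    (simp add: lift_det_eq det3_linear power3_eq_cube)

lemma herm_vderiv_smult:
  assumes "smooth_on UNIV \<mu>" "smooth_on UNIV \<Gamma>" "herm (\<Gamma> t) (\<Gamma> t) = 0"
  shows "herm (\<mu> t *s \<Gamma> t) (vderiv (\<lambda>t. \<mu> t *s \<Gamma> t) t) = of_real ((cmod (\<mu> t))\<^sup>2) * herm (\<Gamma> t) (vderiv \<Gamma> t)"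
proof -
  have "of_real ((cmod (\<mu> t))\<^sup>2) = \<mu> t * cnj (\<mu> t)" by (rule complex_norm_square)
  then show ?thesis
    by (simp only: vderiv_smult[OF assms(1,2)] herm_linear assms(3)) (simp add: algebra_simps)
qed

lemma lift_ofD:
  assumes "lift_of \<gamma> \<Gamma>"
  shows "smooth_on UNIV \<Gamma>" "\<Gamma> t \<noteq> 0" "herm (\<Gamma> t) (\<Gamma> t) = 0" "\<gamma> t = proj (\<Gamma> t)"
  using assms by (auto simp: lift_of_def null_vectors_def image_subset_iff)

lemma lift_of_smult:
  assumes "lift_of \<gamma> \<Gamma>" "smooth_on UNIV \<mu>" "\<And>t. \<mu> t \<noteq> 0"
  shows "lift_of \<gamma> (\<lambda>t. \<mu> t *s \<Gamma> t)"
  using lift_ofD[OF assms(1)] assms(2,3) unfolding lift_of_def null_vectors_def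
  by (auto simp: herm_linear proj_smult intro!: smooth)

text \<open>A smooth cube root of -1/det is needed. Taking it pointwise would meet branch cuts, so
  it is obtained as a solution of \<mu>' / \<mu> = - d' / (3 d): then \<mu>^3 d is constant, and the
  factor \<open>c\<close> adjusts its value at 0 to -1.\<close>

lemma wilczynski_lift_exists:
  assumes "lift_of \<gamma> \<Gamma>" "\<And>t. lift_det \<Gamma> t \<noteq> 0"
  obtains \<mu> where "smooth_on UNIV \<mu>" "\<And>t. \<mu> t \<noteq> 0" "wilczynski_lift \<gamma> (\<lambda>t. \<mu> t *s \<Gamma> t)"
proof -
  define d where "d = lift_det \<Gamma>"
  have sG: "smooth_on UNIV \<Gamma>" using assms lift_ofD by blast
  have sd: "smooth_on UNIV d"
    unfolding d_def lift_det_eq[abs_def] by (intro smooth sG open_UNIV)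
  have d0: "d t \<noteq> 0" for t using assms d_def by simp
  define h where "h t = - vderiv d t / (3 * d t)" for t
  have sh: "smooth_on UNIV h"
    unfolding h_def by (intro smooth sd open_UNIV) (use d0 in auto)
  obtain L where L: "\<And>t. (L has_vector_derivative h t) (at t)"
    using antiderivative_exists[OF smooth_on_imp_continuous_on[OF sh]] by blast
  define c where "c = exp (Ln (- 1 / (exp (L 0) ^ 3 * d 0)) / 3)"
  have "c ^ 3 = - 1 / (exp (L 0) ^ 3 * d 0)"
    using d0 unfolding c_def by (subst exp_of_nat_mult[symmetric]) simp
  define \<mu> where "\<mu> t = c * exp (L t)" for t
  have \<mu>': "(\<mu> has_vector_derivative h t * \<mu> t) (at t)" for t
    unfolding \<mu>_def using field_vector_diff_chain_at[OF L DERIV_exp, of t]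
    by (auto intro!: derivative_eq_intros simp: o_def)
  then have s\<mu>: "smooth_on UNIV \<mu>" using smooth_on_linear_ode sh by blast
  have \<mu>0: "\<mu> t \<noteq> 0" for t by (simp add: \<mu>_def c_def)
  have "((\<lambda>t. \<mu> t * \<mu> t * \<mu> t * d t) has_vector_derivative 0) (at t)" for t
    by (rule has_vector_derivative_eq_rhs,
        (rule has_vector_derivative_mult \<mu>' smooth_on_has_vector_derivative[OF sd])+)
      (use d0[of t] in \<open>simp add: h_def field_simps\<close>)
  then have "\<mu> t * \<mu> t * \<mu> t * d t = \<mu> 0 * \<mu> 0 * \<mu> 0 * d 0" for t
    using has_vector_derivative_zero_constant[of UNIV "\<lambda>t. \<mu> t * \<mu> t * \<mu> t * d t"] by force
  also have "\<mu> 0 * \<mu> 0 * \<mu> 0 * d 0 = c ^ 3 * (exp (L 0) ^ 3 * d 0)"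
    by (simp add: \<mu>_def power3_eq_cube)
  also have "\<dots> = - 1"
    using d0 \<open>c ^ 3 = _\<close> by simp
  finally have "\<mu> t ^ 3 * d t = - 1" for t by (simp add: power3_eq_cube)
  then have "wilczynski_lift \<gamma> (\<lambda>t. \<mu> t *s \<Gamma> t)"
    unfolding wilczynski_lift_def using lift_of_smult[OF assms(1) s\<mu> \<mu>0]
    by (simp add: lift_det_smult[OF s\<mu> sG] d_def)
  with s\<mu> \<mu>0 show ?thesis using that by blast
qed

text \<open>The right-hand side has weight zero under rescaling of the lift, so the strain density can be
  computed from an arbitrary lift.\<close>

lemma strain_density_eq:
  assumes "lift_of \<gamma> \<Gamma>" "\<And>t. lift_det \<Gamma> t \<noteq> 0"
  shows "strain_density \<gamma> t = cmod (lift_det \<Gamma> t) powr (2 / 3) * Re (\<i> / herm (\<Gamma> t) (vderiv \<Gamma> t))"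
proof -
  define W where "W = (SOME \<Gamma>. wilczynski_lift \<gamma> \<Gamma>)"
  have "wilczynski_lift \<gamma> W"
    unfolding W_def using wilczynski_lift_exists[OF assms] by (metis someI)
  then have W: "lift_of \<gamma> W" "lift_det W t = - 1" by (auto simp: wilczynski_lift_def)
  obtain \<mu> where \<mu>: "smooth_on UNIV \<mu>" "\<And>t. \<mu> t \<noteq> 0" "\<And>t. W t = \<mu> t *s \<Gamma> t"
    using lift_change[OF assms(1) W(1)] by blast
  have Weq: "W = (\<lambda>t. \<mu> t *s \<Gamma> t)" using \<mu> by auto
  note G = lift_ofD[OF assms(1)]
  have "\<mu> t ^ 3 * lift_det \<Gamma> t = - 1"
    using W(2) unfolding Weq lift_det_smult[OF \<mu>(1) G(1)] .
  then have "cmod (\<mu> t) ^ 3 * cmod (lift_det \<Gamma> t) = 1"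
    by (metis norm_minus_cancel norm_mult norm_one norm_power)
  then have "(cmod (\<mu> t) ^ 3 * cmod (lift_det \<Gamma> t)) powr (2/3) = 1" by simp
  moreover have "(x ^ 3) powr (2/3) = x\<^sup>2" if "x > 0" for x :: real
  proof -
    have "(x ^ 3) powr (2/3) = (x powr 3) powr (2/3)" using that by simp
    also have "\<dots> = x powr 2" by (subst powr_powr) simp
    finally show ?thesis using that by simp
  qed
  from this[of "cmod (\<mu> t)"] have "(cmod (\<mu> t) ^ 3) powr (2/3) = (cmod (\<mu> t))\<^sup>2"
    using \<mu>(2)[of t] by simp
  ultimately have p: "(cmod (\<mu> t))\<^sup>2 * cmod (lift_det \<Gamma> t) powr (2/3) = 1"
    by (simp add: powr_mult)
  have "strain_density \<gamma> t = Re (\<i> / herm (W t) (vderiv W t))"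
    by (simp add: strain_density_def W_def[symmetric] Let_def)
  also have "herm (W t) (vderiv W t) = of_real ((cmod (\<mu> t))\<^sup>2) * herm (\<Gamma> t) (vderiv \<Gamma> t)"
    unfolding Weq by (rule herm_vderiv_smult[OF \<mu>(1) G(1,3)])
  also have "\<i> / \<dots> = of_real (1 / (cmod (\<mu> t))\<^sup>2) * (\<i> / herm (\<Gamma> t) (vderiv \<Gamma> t))" by simp
  also have "1 / (cmod (\<mu> t))\<^sup>2 = cmod (lift_det \<Gamma> t) powr (2/3)"
    using p \<mu>(2)[of t] by (simp add: field_simps)
  finally show ?thesis 
    by (simp only: times_complex.sel(1) Re_complex_of_real Im_complex_of_real mult_zero_left diff_zero)
qed

subsection \<open>Smooth maps into the projective plane\<close>

lemma chart_proj:
  assumes "z $ j \<noteq> 0"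
  shows "chart j (proj z) = inverse (z $ j) *s z"
  unfolding chart_def
proof (rule the_equality)
  show "inverse (z $ j) *s z \<in> proj z \<and> (inverse (z $ j) *s z) $ j = 1"
    using assms by (auto simp: proj_def)
  fix w assume w: "w \<in> proj z \<and> w $ j = 1"
  then obtain c where c: "w = c *s z" by (auto simp: proj_def)
  with w have "c * z $ j = 1" by simp
  then have "c = inverse (z $ j)" using assms by (simp add: field_simps)
  with c show "w = inverse (z $ j) *s z" by simp
qed

lemma chart_dom_proj:
  assumes "z \<noteq> 0"
  shows "proj z \<in> chart_dom j \<longleftrightarrow> z $ j \<noteq> 0"
proof
  assume "proj z \<in> chart_dom j"
  then obtain w where "w \<in> proj z" "w $ j \<noteq> 0" unfolding chart_dom_def by blast
  then show "z $ j \<noteq> 0" by (auto simp: proj_def)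
next
  assume "z $ j \<noteq> 0"
  moreover have "z \<in> proj z" unfolding proj_def by (metis rangeI vector_smult_lid)
  ultimately show "proj z \<in> chart_dom j" using assms unfolding chart_dom_def CP2_def by blast
qed

lemma CP2_smooth_on_proj:
  assumes "open S" "smooth_on S \<Gamma>" "\<And>x. x \<in> S \<Longrightarrow> \<Gamma> x \<noteq> 0" "\<And>x. x \<in> S \<Longrightarrow> f x = proj (\<Gamma> x)"
  shows "CP2_smooth_on S f"
  unfolding CP2_smooth_on_def
proof (intro conjI allI)
  show "f ` S \<subseteq> CP2" using assms(3,4) by (auto simp: CP2_def)
  fix j
  have eq: "{x \<in> S. f x \<in> chart_dom j} = {x \<in> S. \<Gamma> x $ j \<noteq> 0}" (is "?D = _")
    using assms(3,4) chart_dom_proj by auto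
  have "continuous_on S (\<lambda>x. \<Gamma> x $ j)"
    using smooth_on_imp_continuous_on[OF assms(2)] by (intro continuous_intros)
  then have "open ((\<lambda>x. \<Gamma> x $ j) -` (- {0}) \<inter> S)"
    using continuous_on_open_vimage[OF assms(1)] open_Compl[OF closed_singleton] by blast
  moreover have "(\<lambda>x. \<Gamma> x $ j) -` (- {0}) \<inter> S = {x \<in> S. \<Gamma> x $ j \<noteq> 0}" by auto
  ultimately have "open {x \<in> S. \<Gamma> x $ j \<noteq> 0}" by simp
  then show op: "open ?D" using eq by simp
  have "smooth_on ?D \<Gamma>" by (rule smooth_on_subset[OF assms(2)]) auto
  then have "smooth_on ?D (\<lambda>x. inverse (\<Gamma> x $ j) *s \<Gamma> x)"
    by (intro smooth op) (use eq in auto)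
  then show "smooth_on ?D (\<lambda>x. chart j (f x))"
    by (rule smooth_on_cong[OF op, rotated]) (use eq assms(4) in \<open>auto simp: chart_proj\<close>)
qed

section \<open>The moving frame\<close>

lemma cramer_det3:
  assumes "det3 x y z = 1"
  shows "v = det3 v y z *s x + det3 x v z *s y + det3 x y v *s z"
proof -
  have "det3 x y z *s v = det3 v y z *s x + det3 x v z *s y + det3 x y v *s z"
    unfolding vec_eq_iff forall_3 det3_eq by (simp add: algebra_simps)
  then show ?thesis using assms by simp
qed

lemma det3_swap: "det3 x y z = - det3 x z y"
  by (simp add: det3_eq algebra_simps)

lemma herm_const_deriv:
  assumes "(X has_vector_derivative X') (at t)" "(Y has_vector_derivative Y') (at t)"
    and "\<And>s. herm (X s) (Y s) = c"
  shows "herm (X t) Y' + herm X' (Y t) = 0"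
proof -
  have "((\<lambda>s. c) has_vector_derivative herm (X t) Y' + herm X' (Y t)) (at t)"
    using herm_has_vector_derivative[OF assms(1,2)] unfolding assms(3) .
  then show ?thesis
    using vector_derivative_unique_at has_vector_derivative_const by blast
qed

text \<open>The frame \<open>(F1, F2, F3)\<close> has Gram matrix \<open>hmat\<close>; \<open>a dt\<close> is the infinitesimal strain, while
  \<open>k\<close> and \<open>\<tau>\<close> are the two remaining differential invariants of the curve.\<close>

locale cr_frame =
  fixes a k \<tau> :: "real \<Rightarrow> real" and F1 F2 F3 :: "real \<Rightarrow> complex^3"
  assumes smooth_coeffs: "smooth_on UNIV a" "smooth_on UNIV k" "smooth_on UNIV \<tau>"
    and smooth_F: "smooth_on UNIV F1" "smooth_on UNIV F2" "smooth_on UNIV F3"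
    and a_pos: "\<And>t. a t > 0"
    and F1': "\<And>t. (F1 has_vector_derivative of_real (a t) *s ((\<i> * of_real (k t)) *s F1 t + F3 t)) (at t)"
    and F2': "\<And>t. (F2 has_vector_derivative
      of_real (a t) *s (- \<i> *s F1 t - (2 * \<i> * of_real (k t)) *s F2 t)) (at t)"
    and F3': "\<And>t. (F3 has_vector_derivative
      of_real (a t) *s (of_real (\<tau> t) *s F1 t + F2 t + (\<i> * of_real (k t)) *s F3 t)) (at t)"
    and gram: "\<And>t. herm (F1 t) (F1 t) = 0" "\<And>t. herm (F1 t) (F2 t) = 0" "\<And>t. herm (F2 t) (F2 t) = 1"
      "\<And>t. herm (F1 t) (F3 t) = \<i>" "\<And>t. herm (F3 t) (F3 t) = 0" "\<And>t. herm (F2 t) (F3 t) = 0"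
    and det_F: "\<And>t. det3 (F1 t) (F2 t) (F3 t) = 1"

text \<open>The hypotheses are the normalisations of \<open>a\<close> times a Wilczynski lift. The
  rest is forced: \<open>F3\<close> is the velocity per unit strain corrected along
  \<open>F1\<close> to be null, \<open>F2\<close> is the derivative of \<open>F3\<close> corrected
  to be orthogonal to \<open>F3\<close>, and the remaining relations follow by differentiating those
  already known.\<close>

lemma cr_frame_of_lift:
  assumes sF: "smooth_on UNIV F1" and sa: "smooth_on UNIV a" and apos: "\<And>t. a t > 0"
    and null: "\<And>t. herm (F1 t) (F1 t) = 0"
    and h1: "\<And>t. herm (F1 t) (vderiv F1 t) = \<i> * of_real (a t)"
    and d1: "\<And>t. lift_det F1 t = - (of_real (a t) ^ 3)"
  shows "\<exists>k \<tau> F2 F3. cr_frame a k \<tau> F1 F2 F3"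
proof -
  define b where "b t = inverse (complex_of_real (a t))" for t
  have ab: "of_real (a t) * b t = 1" "b t * of_real (a t) = 1" "cnj (b t) = b t" for t
    using apos[of t] by (auto simp: b_def)
  have sb: "smooth_on UNIV b"
    unfolding b_def by (intro smooth sa open_UNIV) (use apos in \<open>auto simp: less_imp_neq[symmetric]\<close>)
  define G where "G t = b t *s vderiv F1 t" for t
  have sG: "smooth_on UNIV G" unfolding G_def by (intro smooth sb sF open_UNIV)
  \<comment> \<open>The value for which subtracting \<i> k \<open>F1\<close> from \<open>G\<close>
    gives a null vector, as \<open>herm F1 G\<close> = \<i>.\<close>
  define k where "k t = Re (herm (G t) (G t)) / 2" for t
  have sk: "smooth_on UNIV k" unfolding k_def by (intro smooth sG open_UNIV) auto
  define F3 where "F3 t = G t - (\<i> * of_real (k t)) *s F1 t" for t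
  have sF3: "smooth_on UNIV F3" unfolding F3_def by (intro smooth sG sF sk open_UNIV)
  define P where "P t = b t *s vderiv F3 t" for t
  have sP: "smooth_on UNIV P" unfolding P_def by (intro smooth sb sF3 open_UNIV)
  \<comment> \<open>The value for which \<open>F2\<close> below becomes orthogonal to
    \<open>F3\<close>.\<close>
  define \<tau> where "\<tau> t = Re (\<i> * herm (F3 t) (P t))" for t
  have s\<tau>: "smooth_on UNIV \<tau>" unfolding \<tau>_def by (intro smooth sP sF3 open_UNIV)
  define F2 where "F2 t = P t - of_real (\<tau> t) *s F1 t - (\<i> * of_real (k t)) *s F3 t" for t
  have sF2: "smooth_on UNIV F2" unfolding F2_def by (intro smooth sP sF sF3 sk s\<tau> open_UNIV)
  define Q where "Q t = b t *s vderiv F2 t" for t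
  have v1: "vderiv F1 t = of_real (a t) *s ((\<i> * of_real (k t)) *s F1 t + F3 t)" for t
    by (simp add: F3_def G_def vec_eq_iff ab(1))
  have v3: "vderiv F3 t = of_real (a t) *s (of_real (\<tau> t) *s F1 t + F2 t + (\<i> * of_real (k t)) *s F3 t)" for t
    by (simp add: F2_def P_def vec_eq_iff ab(1))
  have v2: "vderiv F2 t = of_real (a t) *s Q t" for t
    by (simp add: Q_def vec_eq_iff ab(1))
  note hv = smooth_on_has_vector_derivative
  have D1: "(F1 has_vector_derivative of_real (a t) *s ((\<i> * of_real (k t)) *s F1 t + F3 t)) (at t)" for t
    using hv[OF sF, of t] v1 by simp
  have D3: "(F3 has_vector_derivative of_real (a t) *s
      (of_real (\<tau> t) *s F1 t + F2 t + (\<i> * of_real (k t)) *s F3 t)) (at t)" for t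
    using hv[OF sF3, of t] v3 by simp
  have D2: "(F2 has_vector_derivative of_real (a t) *s Q t) (at t)" for t
    using hv[OF sF2, of t] v2 by simp
  have nz: "complex_of_real (a t) \<noteq> 0" for t using apos[of t] by simp
  have g13: "herm (F1 t) (F3 t) = \<i>" for t
    using h1[of t] null[of t] nz[of t] unfolding v1 by (simp add: herm_linear)
  have g31: "herm (F3 t) (F1 t) = - \<i>" for t
    using herm_sym[of "F1 t" "F3 t"] g13 by simp
  have GG: "herm (G t) (G t) = of_real (2 * k t)" for t
    using herm_sym[of "G t" "G t"] by (simp add: k_def complex_eq_iff)
  have g1G: "herm (F1 t) (G t) = \<i>" for t
    using g13[of t] null[of t] by (simp add: F3_def herm_linear)
  then have gG1: "herm (G t) (F1 t) = - \<i>" for t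
    using herm_sym[of "F1 t" "G t"] by simp
  have g33: "herm (F3 t) (F3 t) = 0" for t
    using null[of t] by (simp add: F3_def herm_linear GG g1G gG1 algebra_simps)
  have Pim: "herm (F3 t) (P t) + herm (P t) (F3 t) = 0" for t
    using herm_const_deriv[OF hv[OF sF3] hv[OF sF3] g33, of t] ab(3)[of t]
    by (simp add: P_def herm_linear flip: distrib_left)
  have "Re (herm (F3 t) (P t)) = 0" for t
    using Pim[of t] herm_sym[of "F3 t" "P t"] by (metis add_eq_0_iff equal_neg_zero uminus_complex.simps(1) cnj.simps(1))
  then have \<tau>: "of_real (\<tau> t) = \<i> * herm (F3 t) (P t)" for t
    by (simp add: \<tau>_def complex_eq_iff)
  have g32: "herm (F3 t) (F2 t) = 0" for t
    by (simp add: F2_def herm_linear g31 g33 \<tau> complex_eq_iff)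
  have g23: "herm (F2 t) (F3 t) = 0" for t
    using herm_sym[of "F3 t" "F2 t"] g32 by simp
  have g12: "herm (F1 t) (F2 t) = 0" for t
  proof -
    have "of_real (a t) * herm (F1 t) (F2 t) = 0"
      using herm_const_deriv[OF D1 D3 g13, of t] by (simp add: herm_linear null g13 g33 algebra_simps)
    then show ?thesis using nz[of t] by simp
  qed
  have g21: "herm (F2 t) (F1 t) = 0" for t
    using herm_sym[of "F1 t" "F2 t"] g12 by simp
  have det: "det3 (F1 t) (F2 t) (F3 t) = 1" for t
  proof -
    have "vderiv F1 = (\<lambda>t. of_real (a t) *s ((\<i> * of_real (k t)) *s F1 t + F3 t))"
      using v1 by auto
    moreover have "((\<lambda>t. of_real (a t) *s ((\<i> * of_real (k t)) *s F1 t + F3 t)) has_vector_derivative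
        of_real (a t) *s (((\<i> * of_real (k t)) *s vderiv F1 t + vderiv (\<lambda>t. \<i> * of_real (k t)) t *s F1 t)
          + vderiv F3 t) + vderiv (\<lambda>t. of_real (a t)) t *s ((\<i> * of_real (k t)) *s F1 t + F3 t)) (at t)"
      by (intro smult_has_vector_derivative has_vector_derivative_add hv smooth sa sk sF sF3 open_UNIV)
    ultimately have V: "vderiv (vderiv F1) t =
        of_real (a t) *s (((\<i> * of_real (k t)) *s vderiv F1 t + vderiv (\<lambda>t. \<i> * of_real (k t)) t *s F1 t)
          + vderiv F3 t) + vderiv (\<lambda>t. of_real (a t)) t *s ((\<i> * of_real (k t)) *s F1 t + F3 t)"
      by (simp add: vderiv_eq)
    have "lift_det F1 t = - (of_real (a t) ^ 3 * det3 (F1 t) (F2 t) (F3 t))"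
      by (simp only: lift_det_eq V v1 v3)
        (simp add: det3_linear det3_swap[of "F1 t" "F3 t" "F2 t"] power3_eq_cube)
    then show ?thesis using d1[of t] nz[of t] by simp
  qed
  \<comment> \<open>In the Gram determinant only \<open>herm F1 F3\<close>, its conjugate and
    \<open>herm F2 F2\<close> survive, so determinant one fixes the norm of
    \<open>F2\<close>.\<close>
  have g22: "herm (F2 t) (F2 t) = 1" for t
    using gram_det3[of "F1 t" "F2 t" "F3 t"] by (simp add: null g12 g13 g21 g23 g31 g32 g33 det complex_eq_iff)
  have q1: "herm (F1 t) (Q t) = 0" for t
    using herm_const_deriv[OF D1 D2 g12, of t] nz[of t] by (simp add: herm_linear g12 g32)
  have q3: "herm (F3 t) (Q t) = - 1" for t
  proof -
    have "of_real (a t) * (herm (F3 t) (Q t) + 1) = 0"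
      using herm_const_deriv[OF D3 D2 g32, of t] by (simp add: herm_linear g12 g32 g22 algebra_simps)
    then show ?thesis using nz[of t] by (simp add: add_eq_0_iff2)
  qed
  \<comment> \<open>Constancy of the determinant makes the connection matrix trace-free; the entries
    \<i> k of \<open>F1\<close> and \<open>F3\<close> leave -2 \<i> k for \<open>F2\<close>.\<close>
  have tr: "det3 (F1 t) (Q t) (F3 t) = - 2 * \<i> * of_real (k t)" for t
  proof -
    have "((\<lambda>t. 1) has_vector_derivative
        det3 (vderiv F1 t) (F2 t) (F3 t) + det3 (F1 t) (vderiv F2 t) (F3 t)
        + det3 (F1 t) (F2 t) (vderiv F3 t)) (at t)"
      using det3_has_vector_derivative[OF hv[OF sF] hv[OF sF2] hv[OF sF3], of t] unfolding det .
    then have "det3 (vderiv F1 t) (F2 t) (F3 t) + det3 (F1 t) (vderiv F2 t) (F3 t)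
        + det3 (F1 t) (F2 t) (vderiv F3 t) = 0"
      using vector_derivative_unique_at has_vector_derivative_const by blast
    then have "of_real (a t) * (det3 (F1 t) (Q t) (F3 t) + 2 * \<i> * of_real (k t)) = 0"
      unfolding v1 v2 v3 by (simp add: det3_linear det algebra_simps)
    then show ?thesis using nz[of t] by (simp add: add_eq_0_iff)
  qed
  have Q: "Q t = - \<i> *s F1 t - (2 * \<i> * of_real (k t)) *s F2 t" for t
  proof -
    obtain x z where Qe: "Q t = x *s F1 t + (- 2 * \<i> * of_real (k t)) *s F2 t + z *s F3 t"
      using cramer_det3[OF det[of t], of "Q t"] unfolding tr by blast
    have "z = 0" using q1[of t] unfolding Qe by (simp add: herm_linear null g12 g13)
    moreover have "x = - \<i>" using q3[of t] unfolding Qe by (simp add: herm_linear g31 g32 g33 complex_eq_iff)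
    ultimately show ?thesis using Qe by (simp add: vec_eq_iff)
  qed
  have "cr_frame a k \<tau> F1 F2 F3"
    by unfold_locales (use sa sk s\<tau> sF sF2 sF3 apos D1 D2[unfolded Q] D3 null g12 g22 g13 g33 g23 det in auto)
  then show ?thesis by blast
qed

lemma herm_null_deriv_imaginary:
  assumes "smooth_on UNIV \<Gamma>" "\<And>t. herm (\<Gamma> t) (\<Gamma> t) = 0"
  shows "herm (\<Gamma> t) (vderiv \<Gamma> t) = \<i> * of_real (Im (herm (\<Gamma> t) (vderiv \<Gamma> t)))"
proof -
  have "herm (\<Gamma> t) (vderiv \<Gamma> t) + herm (vderiv \<Gamma> t) (\<Gamma> t) = 0"
    using herm_const_deriv[OF smooth_on_has_vector_derivative[OF assms(1)]
        smooth_on_has_vector_derivative[OF assms(1)] assms(2)] .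
  then show ?thesis
    using herm_sym[of "\<Gamma> t" "vderiv \<Gamma> t"] by (auto simp: complex_eq_iff)
qed

text \<open>Genericity and positivity are witnessed by different lifts. Both properties are carried
  to one Wilczynski lift \<open>W\<close>, since the change of lift multiplies \<open>herm\<close>
  by a positive factor.\<close>

lemma generic_transversal_frame:
  assumes "generic_transversal \<gamma>"
  obtains a k \<tau> F1 F2 F3 where "cr_frame a k \<tau> F1 F2 F3" "lift_of \<gamma> F1"
proof -
  obtain \<Gamma> where \<Gamma>: "lift_of \<gamma> \<Gamma>" "\<And>t. lift_det \<Gamma> t \<noteq> 0"
    using assms unfolding generic_transversal_def generic_def by blast
  obtain \<Delta> where \<Delta>: "lift_of \<gamma> \<Delta>" "\<And>t. Re (- \<i> * herm (\<Delta> t) (vderiv \<Delta> t)) > 0"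
    using assms unfolding generic_transversal_def positively_parametrized_def by blast
  obtain W where "wilczynski_lift \<gamma> W" using wilczynski_lift_exists[OF \<Gamma>] by blast
  then have W: "lift_of \<gamma> W" "\<And>t. lift_det W t = - 1" by (auto simp: wilczynski_lift_def)
  note WD = lift_ofD[OF W(1)]
  obtain \<mu> where \<mu>: "smooth_on UNIV \<mu>" "\<And>t. \<mu> t \<noteq> 0" "\<And>t. W t = \<mu> t *s \<Delta> t"
    using lift_change[OF \<Delta>(1) W(1)] by blast
  have Weq: "W = (\<lambda>t. \<mu> t *s \<Delta> t)" using \<mu> by auto
  define q where "q t = Im (herm (W t) (vderiv W t))" for t
  have qh: "herm (W t) (vderiv W t) = \<i> * of_real (q t)" for t
    unfolding q_def by (rule herm_null_deriv_imaginary[OF WD(1,3)])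
  have qpos: "q t > 0" for t
    unfolding q_def Weq herm_vderiv_smult[OF \<mu>(1) lift_ofD(1,3)[OF \<Delta>(1)]]
    using \<Delta>(2)[of t] \<mu>(2)[of t] by (simp del: of_real_power)
  define a where "a t = inverse (q t)" for t
  have sq: "smooth_on UNIV q" unfolding q_def by (intro smooth WD open_UNIV)
  have sa: "smooth_on UNIV a"
    unfolding a_def by (intro smooth sq open_UNIV) (use qpos in \<open>auto simp: less_imp_neq[symmetric]\<close>)
  have sac: "smooth_on UNIV (\<lambda>t. complex_of_real (a t))" by (intro smooth sa open_UNIV)
  have apos: "a t > 0" for t using qpos by (simp add: a_def)
  \<comment> \<open>By the weights 2 and 3, the values \<i> / a and -1 for \<open>W\<close> turn
    into \<i> a and -a^3.\<close>
  define F1 where "F1 = (\<lambda>t. complex_of_real (a t) *s W t)"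
  have L: "lift_of \<gamma> F1"
    unfolding F1_def by (rule lift_of_smult[OF W(1) sac]) (use apos in \<open>auto simp: less_imp_neq[symmetric]\<close>)
  have "\<exists>k \<tau> F2 F3. cr_frame a k \<tau> F1 F2 F3"
  proof (rule cr_frame_of_lift[OF lift_ofD(1)[OF L] sa apos lift_ofD(3)[OF L]])
    fix t
    have "a t * q t = 1" using qpos[of t] by (simp add: a_def)
    then show "herm (F1 t) (vderiv F1 t) = \<i> * of_real (a t)"
      unfolding F1_def herm_vderiv_smult[OF sac WD(1,3)] qh
      by (simp add: power2_eq_square complex_eq_iff)
    show "lift_det F1 t = - (of_real (a t) ^ 3)"
      unfolding F1_def lift_det_smult[OF sac WD(1)] W(2) by simp
  qed
  with L show ?thesis using that by blast
qed

section \<open>The Euler--Lagrange equations\<close>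

text \<open>Differentiation under the integral for the strain density, with \<open>d\<close> the
  determinant of the lift and \<open>h\<close> the imaginary part of
  \<open>herm \<Gamma> \<Gamma>'\<close>. The power |d|^(2/3) is written as the cube root of the
  squared modulus \<open>N\<close>, which is a polynomial in the real and imaginary parts of
  \<open>d\<close> and positive near u = 0.\<close>

lemma has_real_derivative_integral_quotient:
  fixes d du :: "real \<Rightarrow> real \<Rightarrow> complex" and h hu :: "real \<Rightarrow> real \<Rightarrow> real"
  assumes d: "\<And>u t. ((\<lambda>u. d u t) has_vector_derivative du u t) (at u)"
    and h: "\<And>u t. ((\<lambda>u. h u t) has_real_derivative hu u t) (at u)"
    and cont: "continuous_on UNIV (\<lambda>(u, t). d u t)" "continuous_on UNIV (\<lambda>(u, t). du u t)"
      "continuous_on UNIV (\<lambda>(u, t). h u t)" "continuous_on UNIV (\<lambda>(u, t). hu u t)"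
    and "\<epsilon> > 0" and nz: "\<And>u t. u \<in> {- \<epsilon><..<\<epsilon>} \<Longrightarrow> d u t \<noteq> 0" "\<And>u t. u \<in> {- \<epsilon><..<\<epsilon>} \<Longrightarrow> h u t > 0"
  defines "N \<equiv> \<lambda>u t. (Re (d u t))\<^sup>2 + (Im (d u t))\<^sup>2"
  defines "N' \<equiv> \<lambda>u t. 2 * (Re (d u t) * Re (du u t) + Im (d u t) * Im (du u t))"
  defines "L' \<equiv> \<lambda>u t. (1/3 * N u t powr (- 2/3) * N' u t * h u t - N u t powr (1/3) * hu u t) / (h u t * h u t)"
  shows "((\<lambda>u. integral {x..y} (\<lambda>t. N u t powr (1/3) / h u t)) has_real_derivative
    integral {x..y} (L' 0)) (at 0)"
proof -
  let ?U = "{- \<epsilon><..<\<epsilon>}"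
  have Npos: "N u t > 0" if "u \<in> ?U" for u t
    using nz(1)[OF that, of t] unfolding N_def
    by (simp add: complex_eq_iff sum_power2_gt_zero_iff)
  have c: "continuous_on S (\<lambda>p. d (fst p) (snd p))" "continuous_on S (\<lambda>p. du (fst p) (snd p))"
    "continuous_on S (\<lambda>p. h (fst p) (snd p))" "continuous_on S (\<lambda>p. hu (fst p) (snd p))" for S
    using cont by (auto simp: case_prod_unfold intro: continuous_on_subset)
  have dN: "((\<lambda>u. N u t) has_real_derivative N' u t) (at u)" for u t
  proof -
    have r: "((\<lambda>u. Re (d u t)) has_real_derivative Re (du u t)) (at u)"
      and i: "((\<lambda>u. Im (d u t)) has_real_derivative Im (du u t)) (at u)"
      using bounded_linear.has_vector_derivative[OF bounded_linear_Re d[where u=u and t=t]]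
        bounded_linear.has_vector_derivative[OF bounded_linear_Im d[where u=u and t=t]]
      by (auto simp: has_real_derivative_iff_has_vector_derivative)
    show ?thesis
      unfolding N_def N'_def
      by (rule DERIV_cong[OF DERIV_add[OF DERIV_power[OF r] DERIV_power[OF i]]]) simp
  qed
  have dL: "((\<lambda>u. N u t powr (1/3) / h u t) has_real_derivative L' u t) (at u)" if "u \<in> ?U" for u t
  proof -
    have "((\<lambda>u. N u t powr (1/3)) has_real_derivative (1/3 * N u t powr (1/3 - 1)) * N' u t) (at u)"
      using DERIV_chain2[OF has_real_derivative_powr[OF Npos[OF that]] dN] .
    from DERIV_divide[OF this h, of t] show ?thesis
      unfolding L'_def using nz(2)[OF that, of t] by simp
  qed
  have cL': "continuous_on (?U \<times> S) (\<lambda>p. L' (fst p) (snd p))" for S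
  proof -
    have "\<forall>p\<in>?U \<times> S. (Re (d (fst p) (snd p)))\<^sup>2 + (Im (d (fst p) (snd p)))\<^sup>2 \<noteq> 0"
      using Npos unfolding N_def by (metis less_irrefl mem_Sigma_iff prod.collapse)
    moreover have "\<forall>p\<in>?U \<times> S. h (fst p) (snd p) * h (fst p) (snd p) \<noteq> 0"
      using nz(2) by (metis less_irrefl mem_Sigma_iff mult_eq_0_iff prod.collapse)
    ultimately show ?thesis
      unfolding L'_def N_def N'_def by (intro continuous_intros c ballI; blast)
  qed
  have cL: "continuous_on S (\<lambda>t. N u t powr (1/3) / h u t)" if "u \<in> ?U" for u S
  proof -
    have "continuous_on S (\<lambda>t. (u, t))"
      by (intro continuous_on_Pair continuous_on_const continuous_on_id)
    from continuous_on_compose2[OF c(1)[of UNIV] this] continuous_on_compose2[OF c(3)[of UNIV] this]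
    have "continuous_on S (\<lambda>t. d u t)" "continuous_on S (\<lambda>t. h u t)" by auto
    moreover have "\<forall>t\<in>S. (Re (d u t))\<^sup>2 + (Im (d u t))\<^sup>2 \<noteq> 0" "\<forall>t\<in>S. h u t \<noteq> 0"
      using Npos[OF that] nz(2)[OF that] unfolding N_def by (metis less_irrefl)+
    ultimately show ?thesis
      unfolding N_def by (intro continuous_intros; blast)
  qed
  have "((\<lambda>u. integral (cbox x y) (\<lambda>t. N u t powr (1/3) / h u t)) has_real_derivative
    integral (cbox x y) (L' 0)) (at 0 within ?U)"
  proof (rule leibniz_rule_field_derivative)
    show "continuous_on (?U \<times> cbox x y) (\<lambda>(u, t). L' u t)"
      using cL' by (simp add: case_prod_unfold)
    show "0 \<in> ?U" using \<open>\<epsilon> > 0\<close> by simp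
  qed (use dL cL in \<open>auto intro: has_field_derivative_at_within integrable_continuous_real\<close>)
  then show "((\<lambda>u. integral {x..y} (\<lambda>t. N u t powr (1/3) / h u t)) has_real_derivative
    integral {x..y} (L' 0)) (at 0)"
    using \<open>\<epsilon> > 0\<close> by (simp add: at_within_open[of _ ?U])
qed

lemma sum_cnj_mult_self_nonzero:
  fixes z :: "complex^3"
  assumes "z \<noteq> 0"
  shows "(\<Sum>i\<in>UNIV. cnj (z $ i) * z $ i) \<noteq> 0"
proof -
  have "(\<Sum>i\<in>UNIV. cnj (z $ i) * z $ i) = of_real (\<Sum>i\<in>UNIV. (cmod (z $ i))\<^sup>2)"
    by (simp only: of_real_sum complex_norm_square mult.commute)
  moreover have "(\<Sum>i\<in>UNIV. (cmod (z $ i))\<^sup>2) \<noteq> 0"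
    using assms by (auto simp: vec_eq_iff sum_nonneg_eq_0_iff)
  ultimately show ?thesis by (metis of_real_eq_0_iff)
qed

text \<open>The fundamental lemma of the calculus of variations with bumps as test functions: a bump
  supported where \<open>G\<close> keeps a sign makes the integrand one-signed. The margin 1 around
  (c, d) agrees with \<open>first_variation\<close>, where the support has to be compact inside the
  open interval.\<close>

lemma fundamental_lemma_bump:
  fixes G :: "real \<Rightarrow> real"
  assumes cont: "continuous_on UNIV G"
    and ortho: "\<And>c d f. c < d \<Longrightarrow> smooth_on UNIV f \<Longrightarrow> (\<And>t. f t \<ge> 0) \<Longrightarrow> (\<And>t. f t > 0 \<longleftrightarrow> t \<in> {c<..<d}) \<Longrightarrow>
      integral {c - 1..d + 1} (\<lambda>t. f t * G t) = 0"
  shows "G t = 0"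
proof (rule ccontr)
  assume "G t \<noteq> 0"
  define s where "s = sgn (G t)"
  have s: "s * G t > 0" using \<open>G t \<noteq> 0\<close> by (simp add: s_def sgn_if)
  have "open {x. 0 < s * G x}"
    by (rule open_Collect_less) (use cont in \<open>auto intro!: continuous_intros\<close>)
  then obtain e where e: "e > 0" "\<And>x. dist x t < e \<Longrightarrow> s * G x > 0"
    using s unfolding open_dist by (metis mem_Collect_eq)
  have "t - e < t + e" using e(1) by simp
  from bump_function_exists[OF this] obtain f :: "real \<Rightarrow> real"
    where f: "smooth_on UNIV f" "\<And>x. f x \<ge> 0" "\<And>x. f x > 0 \<longleftrightarrow> x \<in> {t - e<..<t + e}"
    by blast
  have "integral {t - e - 1..t + e + 1} (\<lambda>x. f x * G x) = 0"
    using ortho[OF _ f] e(1) by simp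
  then have "integral {t - e - 1..t + e + 1} (\<lambda>x. s * (f x * G x)) = 0" by simp
  moreover have "0 \<le> s * (f x * G x)" for x
  proof (cases "x \<in> {t - e<..<t + e}")
    case True
    then have "s * G x > 0" by (intro e(2)) (auto simp: dist_real_def)
    then show ?thesis using f(2)[of x] by (metis mult.left_commute mult_nonneg_nonneg less_imp_le)
  next
    case False
    then have "f x = 0" using f(2)[of x] f(3)[of x] by linarith
    then show ?thesis by simp
  qed
  moreover have "continuous_on {t - e - 1..t + e + 1} (\<lambda>x. s * (f x * G x))"
    using continuous_on_subset[OF cont] continuous_on_subset[OF smooth_on_imp_continuous_on[OF f(1)]]
    by (intro continuous_intros) auto
  ultimately have "s * (f t * G t) = 0"
    using integral_eq_0_iff[of "t - e - 1" "t + e + 1" "\<lambda>x. s * (f x * G x)"] e(1) by auto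
  then show False using s f(3)[of t] e(1) by auto
qed

lemma vderiv_const [simp]: "vderiv (\<lambda>_. c) t = 0"
  by (simp add: vderiv_eq)

context cr_frame
begin

abbreviation "ac t \<equiv> complex_of_real (a t)"
abbreviation "kc t \<equiv> complex_of_real (k t)"

lemma a_nz: "a t \<noteq> 0"
  using a_pos[of t] by simp

lemma gram': "herm (F2 t) (F1 t) = 0" "herm (F3 t) (F1 t) = - \<i>" "herm (F3 t) (F2 t) = 0"
  using herm_sym[of "F1 t" "F2 t"] herm_sym[of "F1 t" "F3 t"] herm_sym[of "F2 t" "F3 t"]
  by (auto simp: gram)

lemma det3_frame:
  "det3 (x1 *s F1 t + x2 *s F2 t + x3 *s F3 t) (y1 *s F1 t + y2 *s F2 t + y3 *s F3 t)
     (z1 *s F1 t + z2 *s F2 t + z3 *s F3 t) =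
   x1 * (y2 * z3 - y3 * z2) - x2 * (y1 * z3 - y3 * z1) + x3 * (y1 * z2 - y2 * z1)"
proof -
  have "det3 (x1 *s u + x2 *s v + x3 *s w) (y1 *s u + y2 *s v + y3 *s w) (z1 *s u + z2 *s v + z3 *s w)
    = (x1 * (y2 * z3 - y3 * z2) - x2 * (y1 * z3 - y3 * z1) + x3 * (y1 * z2 - y2 * z1)) * det3 u v w" for u v w
    unfolding det3_eq by (simp add: algebra_simps)
  then show ?thesis by (simp add: det_F)
qed

lemma F1_comb: "F1 t = 1 *s F1 t + 0 *s F2 t + 0 *s F3 t"
  by simp

lemma vderiv_F:
  "vderiv F1 t = (\<i> * ac t * kc t) *s F1 t + 0 *s F2 t + ac t *s F3 t"
  "vderiv F2 t = (- \<i> * ac t) *s F1 t + (- 2 * \<i> * ac t * kc t) *s F2 t + 0 *s F3 t"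
  "vderiv F3 t = (ac t * of_real (\<tau> t)) *s F1 t + ac t *s F2 t + (\<i> * ac t * kc t) *s F3 t"
  unfolding vderiv_eq[OF F1'] vderiv_eq[OF F2'] vderiv_eq[OF F3']
  by (simp_all add: vec_eq_iff algebra_simps)

lemma vderiv_frame_comb:
  assumes "smooth_on UNIV x1" "smooth_on UNIV x2" "smooth_on UNIV x3"
  shows "vderiv (\<lambda>t. x1 t *s F1 t + x2 t *s F2 t + x3 t *s F3 t) t =
    (vderiv x1 t + \<i> * ac t * kc t * x1 t - \<i> * ac t * x2 t + ac t * of_real (\<tau> t) * x3 t) *s F1 t
    + (vderiv x2 t - 2 * \<i> * ac t * kc t * x2 t + ac t * x3 t) *s F2 t
    + (vderiv x3 t + ac t * x1 t + \<i> * ac t * kc t * x3 t) *s F3 t"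
proof -
  have "((\<lambda>t. x1 t *s F1 t + x2 t *s F2 t + x3 t *s F3 t) has_vector_derivative
    x1 t *s vderiv F1 t + vderiv x1 t *s F1 t + (x2 t *s vderiv F2 t + vderiv x2 t *s F2 t)
    + (x3 t *s vderiv F3 t + vderiv x3 t *s F3 t)) (at t)"
    by (intro has_vector_derivative_add smult_has_vector_derivative smooth_on_has_vector_derivative
        assms smooth_F)
  from vderiv_eq[OF this] show ?thesis
    by (simp only: vderiv_F) (simp add: vec_eq_iff algebra_simps)
qed

lemma vderiv_of_real: "smooth_on UNIV f \<Longrightarrow> vderiv (\<lambda>t. complex_of_real (f t)) t = of_real (vderiv f t)"
  by (intro vderiv_eq bounded_linear.has_vector_derivative[OF bounded_linear_of_real]
      smooth_on_has_vector_derivative)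

lemma vderiv2_F1:
  "vderiv (vderiv F1) t =
    (\<i> * (ac t * of_real (vderiv k t) + of_real (vderiv a t) * kc t) - ac t ^ 2 * kc t ^ 2
      + ac t ^ 2 * of_real (\<tau> t)) *s F1 t
    + ac t ^ 2 *s F2 t + (of_real (vderiv a t) + 2 * \<i> * ac t ^ 2 * kc t) *s F3 t"
proof -
  have "vderiv F1 = (\<lambda>t. (\<i> * ac t * kc t) *s F1 t + 0 *s F2 t + ac t *s F3 t)"
    using vderiv_F(1) by auto
  moreover have "vderiv (\<lambda>t. \<i> * ac t * kc t) t = \<i> * ac t * of_real (vderiv k t) + \<i> * of_real (vderiv a t) * kc t"
    by (intro vderiv_eq has_vector_derivative_mult has_vector_derivative_mult_right
        bounded_linear.has_vector_derivative[OF bounded_linear_of_real]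
        smooth_on_has_vector_derivative smooth_coeffs)
  moreover have "vderiv (\<lambda>t. 0::complex) t = 0" by (simp add: vderiv_eq)
  ultimately show ?thesis
    by (simp only:) (subst vderiv_frame_comb; (intro smooth smooth_coeffs open_UNIV)?;
      simp add: vderiv_of_real smooth_coeffs vec_eq_iff algebra_simps power2_eq_square)
qed

lemma lift_det_F1: "lift_det F1 t = - (ac t ^ 3)"
  unfolding lift_det_eq
  by (subst F1_comb, subst vderiv_F(1), subst vderiv2_F1, subst det3_frame)
    (simp add: power2_eq_square power3_eq_cube)

text \<open>The linear part of the variation is normal to \<open>F1\<close>; the quadratic term keeps it in the null
  cone.\<close>

definition variation :: "(real \<Rightarrow> complex) \<Rightarrow> real \<Rightarrow> real \<Rightarrow> complex^3"
  where "variation \<phi> u t = F1 t + of_real u *s (\<phi> t *s F2 t)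
    + of_real (u\<^sup>2) *s ((\<i> / 2 * (\<phi> t * cnj (\<phi> t))) *s F3 t)"

text \<open>The norm u^2 |\<phi>|^2 of the \<open>F2\<close> term cancels against the two cross
  terms of \<open>F1\<close> with \<open>F3\<close>, because \<open>herm F1 F3\<close> =
  \<i>.\<close>

lemma variation_null: "herm (variation \<phi> u t) (variation \<phi> u t) = 0"
  by (simp add: variation_def herm_linear gram gram' power2_eq_square algebra_simps)

lemma variation_nonzero: "variation \<phi> u t \<noteq> 0"
proof
  assume "variation \<phi> u t = 0"
  then have "det3 (variation \<phi> u t) (F2 t) (F3 t) = 0" by simp
  then show False by (simp add: variation_def det3_linear det_F)
qed

text \<open>Up to the factor -2/3 the integral is the derivative of the total strain along
  \<open>variation \<phi>\<close>. The numerator of the integrand is the real part of the derivative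
  of the determinant at u = 0; the contact term \<open>h\<close> is stationary there and contributes
  nothing.\<close>

lemma first_variation:
  assumes crit: "critical_curve \<gamma>" and \<gamma>: "\<And>t. \<gamma> t = proj (F1 t)" and "c < d"
    and s\<phi>: "smooth_on UNIV \<phi>" and supp: "\<And>t. t \<notin> {c<..<d} \<Longrightarrow> \<phi> t = 0"
  shows "integral {c - 1..d + 1} (\<lambda>t. Re (- ac t * vderiv (vderiv \<phi>) t + of_real (vderiv a t) * vderiv \<phi> t
    + ac t ^ 2 * (6 * \<i> * kc t * vderiv \<phi> t + 3 * \<i> * of_real (vderiv k t) * \<phi> t
      + ac t * \<phi> t * of_real (9 * (k t)\<^sup>2 + \<tau> t))) / (a t)\<^sup>2) = 0"
proof -
  define B where "B t = \<phi> t *s F2 t" for t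
  define C where "C t = (\<i> / 2 * (\<phi> t * cnj (\<phi> t))) *s F3 t" for t
  \<comment> \<open>The variation and its t-derivatives are quadratic polynomials \<open>q\<close>
    in u, with u-derivative \<open>qd\<close>; this makes \<open>D\<close>, \<open>h\<close> and
    their u-derivatives explicit for all real u.\<close>
  define q where "q u X Y Z = X + complex_of_real u *s Y + complex_of_real (u\<^sup>2) *s Z"
    for u and X Y Z :: "complex^3"
  define qd where "qd u Y Z = Y + complex_of_real (2 * u) *s Z" for u and Y Z :: "complex^3"
  let ?F1' = "vderiv F1" and ?B' = "vderiv B" and ?C' = "vderiv C"
  let ?F1'' = "vderiv ?F1'" and ?B'' = "vderiv ?B'" and ?C'' = "vderiv ?C'"
  define D where "D u t = det3 (q u (F1 t) (B t) (C t)) (q u (?F1' t) (?B' t) (?C' t)) (q u (?F1'' t) (?B'' t) (?C'' t))"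
    for u t
  define Du where "Du u t = det3 (qd u (B t) (C t)) (q u (?F1' t) (?B' t) (?C' t)) (q u (?F1'' t) (?B'' t) (?C'' t))
    + det3 (q u (F1 t) (B t) (C t)) (qd u (?B' t) (?C' t)) (q u (?F1'' t) (?B'' t) (?C'' t))
    + det3 (q u (F1 t) (B t) (C t)) (q u (?F1' t) (?B' t) (?C' t)) (qd u (?B'' t) (?C'' t))" for u t
  define h where "h u t = Im (herm (q u (F1 t) (B t) (C t)) (q u (?F1' t) (?B' t) (?C' t)))" for u t
  define hu where "hu u t = Im (herm (q u (F1 t) (B t) (C t)) (qd u (?B' t) (?C' t))
    + herm (qd u (B t) (C t)) (q u (?F1' t) (?B' t) (?C' t)))" for u t
  have sB: "smooth_on UNIV B" and sC: "smooth_on UNIV C"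
    unfolding B_def C_def by (intro smooth s\<phi> smooth_F open_UNIV; simp)+
  have veq: "variation \<phi> u = (\<lambda>t. q u (F1 t) (B t) (C t))" for u
    by (simp add: variation_def q_def B_def C_def fun_eq_iff)
  have sq: "smooth_on UNIV (\<lambda>p. q (fst p) (X (snd p)) (Y (snd p)) (Z (snd p)))"
    if "smooth_on UNIV X" "smooth_on UNIV Y" "smooth_on UNIV Z" for X Y Z :: "real \<Rightarrow> complex^3"
    unfolding q_def by (intro smooth that open_UNIV)
  have sqd: "smooth_on UNIV (\<lambda>p. qd (fst p) (Y (snd p)) (Z (snd p)))"
    if "smooth_on UNIV Y" "smooth_on UNIV Z" for Y Z :: "real \<Rightarrow> complex^3"
    unfolding qd_def by (intro smooth that open_UNIV)
  have sv: "smooth_on UNIV (variation \<phi> u)" for u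
    unfolding variation_def by (intro smooth s\<phi> smooth_F open_UNIV) simp
  have vq: "vderiv (\<lambda>t. q u (X t) (Y t) (Z t)) = (\<lambda>t. q u (vderiv X t) (vderiv Y t) (vderiv Z t))"
    if "smooth_on UNIV X" "smooth_on UNIV Y" "smooth_on UNIV Z" for u and X Y Z :: "real \<Rightarrow> complex^3"
  proof
    fix t
    have "((\<lambda>t. q u (X t) (Y t) (Z t)) has_vector_derivative
      vderiv X t + (of_real u *s vderiv Y t + 0 *s Y t) + (of_real (u\<^sup>2) *s vderiv Z t + 0 *s Z t)) (at t)"
      unfolding q_def
      by (intro has_vector_derivative_add smult_has_vector_derivative has_vector_derivative_const
          smooth_on_has_vector_derivative that)
    then show "vderiv (\<lambda>t. q u (X t) (Y t) (Z t)) t = q u (vderiv X t) (vderiv Y t) (vderiv Z t)"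
      by (simp add: vderiv_eq q_def)
  qed
  have v1: "vderiv (variation \<phi> u) = (\<lambda>t. q u (?F1' t) (?B' t) (?C' t))" for u
    unfolding veq by (rule vq[OF smooth_F(1) sB sC])
  have ld: "lift_det (variation \<phi> u) t = D u t" for u t
    unfolding lift_det_eq D_def v1 vq[OF smooth_F(1)[THEN smooth_on_vderiv] sB[THEN smooth_on_vderiv]
        sC[THEN smooth_on_vderiv]] by (simp add: veq)
  have hm: "herm (variation \<phi> u t) (vderiv (variation \<phi> u) t) = \<i> * of_real (h u t)" for u t
    using herm_null_deriv_imaginary[OF sv variation_null, of u t] unfolding v1 unfolding h_def veq .
  have dq: "((\<lambda>u. q u X Y Z) has_vector_derivative qd u Y Z) (at u)" for u X Y Z
  proof -
    have r: "((\<lambda>u. complex_of_real u) has_vector_derivative 1) (at u)"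
      using bounded_linear.has_vector_derivative[OF bounded_linear_of_real has_vector_derivative_id]
      by simp
    have r2: "((\<lambda>u. complex_of_real (u\<^sup>2)) has_vector_derivative of_real (2 * u)) (at u)"
      by (rule bounded_linear.has_vector_derivative[OF bounded_linear_of_real])
        (auto simp flip: has_real_derivative_iff_has_vector_derivative intro!: derivative_eq_intros)
    have "((\<lambda>u. q u X Y Z) has_vector_derivative 0 + (of_real u *s 0 + 1 *s Y)
        + (of_real (u\<^sup>2) *s 0 + of_real (2 * u) *s Z)) (at u)"
      unfolding q_def
      by (intro has_vector_derivative_add smult_has_vector_derivative has_vector_derivative_const r r2)
    then show ?thesis by (simp add: qd_def)
  qed
  have dD: "((\<lambda>u. D u t) has_vector_derivative Du u t) (at u)" for u t
    unfolding D_def Du_def by (intro det3_has_vector_derivative dq)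
  have dh: "((\<lambda>u. h u t) has_real_derivative hu u t) (at u)" for u t
    unfolding h_def hu_def has_real_derivative_iff_has_vector_derivative
    by (intro bounded_linear.has_vector_derivative[OF bounded_linear_Im] herm_has_vector_derivative dq)
  note sm = smooth_F sB sC smooth_on_vderiv
  have cont: "continuous_on UNIV (\<lambda>(u, t). D u t)" "continuous_on UNIV (\<lambda>(u, t). Du u t)"
      "continuous_on UNIV (\<lambda>(u, t). h u t)" "continuous_on UNIV (\<lambda>(u, t). hu u t)"
    unfolding case_prod_unfold D_def Du_def h_def hu_def
    by (intro smooth_on_imp_continuous_on smooth_on_det3 smooth_on_herm smooth_on_add smooth_on_Im
        sq sqd sm open_UNIV)+
  have D0: "D 0 t = - (ac t ^ 3)" for t
    using lift_det_F1[of t] by (simp add: D_def q_def lift_det_eq)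
  have h0: "h 0 t = a t" for t
    unfolding h_def q_def by (simp add: vderiv_F(1) herm_linear gram)
  have vanish: "\<phi> t = 0" "B t = 0" "C t = 0" if "t \<in> - {c..d}" for t
    using supp[of t] that by (auto simp: B_def C_def)
  have op: "open (- {c..d})" by (simp add: open_Compl)
  have vanish': "?B' t = 0" "?C' t = 0" if "t \<in> - {c..d}" for t
    using vderiv_zero_on_open[OF op vanish(2) that] vderiv_zero_on_open[OF op vanish(3) that] by auto
  have vanish'': "?B'' t = 0" "?C'' t = 0" if "t \<in> - {c..d}" for t
    using vderiv_zero_on_open[OF op vanish'(1) that] vderiv_zero_on_open[OF op vanish'(2) that] by auto
  have out: "D u t = D 0 t" "h u t = h 0 t" if "t \<in> - {c..d}" for u t
    unfolding D_def h_def q_def by (simp_all add: vanish[OF that] vanish'[OF that] vanish''[OF that])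
  \<comment> \<open>One \<epsilon> must serve all t. On the compact interval [c, d] the tube lemma
    provides it; outside, the variation agrees with the original curve.\<close>
  define W where "W = {p. (case p of (u, t) \<Rightarrow> D u t) \<noteq> 0} \<inter> {p. 0 < (case p of (u, t) \<Rightarrow> h u t)}"
  have "open W" unfolding W_def
    using cont by (intro open_Int open_Collect_neq open_Collect_less continuous_intros) auto
  moreover have "{0} \<times> {c..d} \<subseteq> W"
    using a_pos a_nz by (auto simp: W_def D0 h0)
  ultimately obtain X0 where X0: "0 \<in> X0" "open X0" "X0 \<times> {c..d} \<subseteq> W"
    using Elementary_Topology.tube_lemma[of "{c..d}" W 0] by blast
  then obtain \<epsilon> where \<epsilon>: "\<epsilon> > 0" "ball 0 \<epsilon> \<subseteq> X0" using open_contains_ball by metis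
  let ?U = "{- \<epsilon><..<\<epsilon>}"
  have nz: "D u t \<noteq> 0 \<and> h u t > 0" if "u \<in> ?U" for u t
  proof (cases "t \<in> {c..d}")
    case True
    have "u \<in> X0" using that \<epsilon>(2) by (auto simp: dist_real_def)
    then have "(u, t) \<in> W" using X0(3) True by blast
    then show ?thesis by (simp add: W_def)
  next
    case False
    then show ?thesis using out[of t u] a_pos[of t] a_nz by (simp add: D0 h0)
  qed
  define g where "g u t = proj (variation \<phi> u t)" for u t
  have lift: "lift_of (g u) (variation \<phi> u)" for u
    unfolding lift_of_def g_def using sv variation_null variation_nonzero by (auto simp: null_vectors_def)
  have gt: "generic_transversal (g u)" if "u \<in> ?U" for u
  proof -
    have "smooth_curve (g u)"
      unfolding smooth_curve_def
    proof
      show "CP2_smooth_on UNIV (g u)"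
        by (rule CP2_smooth_on_proj[OF open_UNIV sv variation_nonzero]) (simp add: g_def)
      show "range (g u) \<subseteq> CR_sphere"
        using variation_null variation_nonzero by (auto simp: CR_sphere_def g_def)
    qed
    moreover have "contact_form (variation \<phi> u t) (vderiv (variation \<phi> u) t) \<noteq> 0" for t
    proof -
      have "(\<Sum>i\<in>UNIV. cnj (variation \<phi> u t $ i) * variation \<phi> u t $ i) \<noteq> 0"
        using sum_cnj_mult_self_nonzero[OF variation_nonzero] .
      then show ?thesis using nz[OF that, of t] unfolding contact_form_def hm by simp
    qed
    moreover have "Re (- \<i> * herm (variation \<phi> u t) (vderiv (variation \<phi> u) t)) > 0" for t
      using nz[OF that, of t] unfolding hm by simp
    moreover have "lift_det (variation \<phi> u) t \<noteq> 0" for t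
      using nz[OF that, of t] ld by simp
    ultimately show ?thesis
      unfolding generic_transversal_def transversal_def positively_parametrized_def generic_def
      using lift by blast
  qed
  have "admissible_variation \<gamma> (c - 1) (d + 1) \<epsilon> g"
    unfolding admissible_variation_def
  proof (intro conjI ballI allI)
    have "open (?U \<times> (UNIV :: real set))" by (simp add: open_Times)
    moreover have "smooth_on (?U \<times> UNIV) (\<lambda>(u, t). variation \<phi> u t)"
      unfolding case_prod_unfold veq
      by (rule smooth_on_subset[OF sq[OF smooth_F(1) sB sC]]) simp
    ultimately show "CP2_smooth_on (?U \<times> UNIV) (\<lambda>(u, t). g u t)"
      by (rule CP2_smooth_on_proj) (auto simp: g_def variation_nonzero)
    show "g 0 t = \<gamma> t" for t by (simp add: g_def \<gamma> variation_def)
    have "compact {c..d}" "{c..d} \<subseteq> {c - 1<..<d + 1}" by auto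
    moreover have "g u t = \<gamma> t" if "t \<notin> {c..d}" for u t
      using vanish[of t] that by (simp add: g_def \<gamma> variation_def)
    ultimately show "\<exists>K. compact K \<and> K \<subseteq> {c - 1<..<d + 1} \<and> (\<forall>u\<in>?U. \<forall>t. t \<notin> K \<longrightarrow> g u t = \<gamma> t)"
      by blast
  qed (use gt \<epsilon> in auto)
  then have crit0: "((\<lambda>u. total_strain (g u) (c - 1) (d + 1)) has_real_derivative 0) (at 0)"
    using crit \<open>c < d\<close> unfolding critical_curve_def by (metis diff_add_cancel add_less_cancel_right less_add_one less_trans)
  let ?N = "\<lambda>u t. (Re (D u t))\<^sup>2 + (Im (D u t))\<^sup>2"
  have sd: "strain_density (g u) t = ?N u t powr (1/3) / h u t" if "u \<in> ?U" for u t
  proof -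
    have "strain_density (g u) t = cmod (D u t) powr (2 / 3) * Re (\<i> / (\<i> * of_real (h u t)))"
      using strain_density_eq[OF lift, of u t] nz[OF that] unfolding ld hm by simp
    also have "Re (\<i> / (\<i> * of_real (h u t))) = 1 / h u t"
      by (simp flip: of_real_divide of_real_inverse add: divide_inverse)
    also have "cmod (D u t) powr (2 / 3) = ((cmod (D u t)) powr 2) powr (1 / 3)"
      by (subst powr_powr) simp
    also have "(cmod (D u t)) powr 2 = ?N u t"
      using nz[OF that, of t] by (simp add: cmod_power2)
    finally show ?thesis by simp
  qed
  note L = has_real_derivative_integral_quotient[OF dD dh cont \<epsilon>(1), of "c - 1" "d + 1"]
  have "((\<lambda>u. total_strain (g u) (c - 1) (d + 1)) has_real_derivative
    integral {c - 1..d + 1} (\<lambda>t. (1/3 * ?N 0 t powr (- 2/3) * (2 * (Re (D 0 t) * Re (Du 0 t) + Im (D 0 t) * Im (Du 0 t)))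
      * h 0 t - ?N 0 t powr (1/3) * hu 0 t) / (h 0 t * h 0 t))) (at 0)"
    by (rule has_field_derivative_transform_within_open[OF L, of ?U])
      (use nz \<epsilon>(1) sd in \<open>auto simp: total_strain_def intro!: integral_cong\<close>)
  from DERIV_unique[OF this crit0]
  have I0: "integral {c - 1..d + 1} (\<lambda>t. (1/3 * ?N 0 t powr (- 2/3) * (2 * (Re (D 0 t) * Re (Du 0 t) + Im (D 0 t) * Im (Du 0 t)))
      * h 0 t - ?N 0 t powr (1/3) * hu 0 t) / (h 0 t * h 0 t)) = 0" .
  have B': "?B' t = (- \<i> * ac t * \<phi> t) *s F1 t + (vderiv \<phi> t - 2 * \<i> * ac t * kc t * \<phi> t) *s F2 t + 0 *s F3 t" for t
    using vderiv_frame_comb[of "\<lambda>_. 0" \<phi> "\<lambda>_. 0" t] s\<phi>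
    by (simp add: B_def[abs_def] smooth vderiv_eq)
  \<comment> \<open>The \<open>F1\<close> component stays unnamed because \<open>B''\<close> is used
    only in a determinant whose first column is \<open>F1\<close>.\<close>
  have B'': "\<exists>x. ?B'' t = x *s F1 t
     + (vderiv (vderiv \<phi>) t - 2 * \<i> * (ac t * kc t * vderiv \<phi> t + ac t * of_real (vderiv k t) * \<phi> t
         + of_real (vderiv a t) * kc t * \<phi> t)
       - 2 * \<i> * ac t * kc t * (vderiv \<phi> t - 2 * \<i> * ac t * kc t * \<phi> t)) *s F2 t
     + (- \<i> * ac t ^ 2 * \<phi> t) *s F3 t" for t
  proof -
    have "?B' = (\<lambda>t. (- \<i> * ac t * \<phi> t) *s F1 t + (vderiv \<phi> t - 2 * \<i> * ac t * kc t * \<phi> t) *s F2 t + 0 *s F3 t)"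
      using B' by auto
    then have e: "?B'' t = vderiv (\<lambda>t. (- \<i> * ac t * \<phi> t) *s F1 t + (vderiv \<phi> t - 2 * \<i> * ac t * kc t * \<phi> t) *s F2 t + 0 *s F3 t) t"
      by simp
    have "((\<lambda>t. vderiv \<phi> t - 2 * \<i> * ac t * kc t * \<phi> t) has_vector_derivative
      vderiv (vderiv \<phi>) t - ((2 * \<i> * ac t * kc t) * vderiv \<phi> t
        + ((2 * \<i> * ac t) * of_real (vderiv k t) + (2 * \<i> * of_real (vderiv a t)) * kc t) * \<phi> t)) (at t)"
      by (intro has_vector_derivative_diff has_vector_derivative_mult has_vector_derivative_mult_right
          bounded_linear.has_vector_derivative[OF bounded_linear_of_real]
          smooth_on_has_vector_derivative smooth_coeffs s\<phi> smooth_on_vderiv)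
    note v2 = vderiv_eq[OF this]
    have v3: "vderiv (\<lambda>t. 0::complex) t = 0" by (simp add: vderiv_eq)
    have "?B'' t = (vderiv (\<lambda>t. - \<i> * ac t * \<phi> t) t + \<i> * ac t * kc t * (- \<i> * ac t * \<phi> t)
        - \<i> * ac t * (vderiv \<phi> t - 2 * \<i> * ac t * kc t * \<phi> t) + ac t * of_real (\<tau> t) * 0) *s F1 t
      + (vderiv (\<lambda>t. vderiv \<phi> t - 2 * \<i> * ac t * kc t * \<phi> t) t
          - 2 * \<i> * ac t * kc t * (vderiv \<phi> t - 2 * \<i> * ac t * kc t * \<phi> t) + ac t * 0) *s F2 t
      + (vderiv (\<lambda>t. 0) t + ac t * (- \<i> * ac t * \<phi> t) + \<i> * ac t * kc t * 0) *s F3 t"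
      unfolding e by (rule vderiv_frame_comb) (intro smooth smooth_coeffs s\<phi> open_UNIV)+
    then show ?thesis
      unfolding v2 v3 by (intro exI[of _ "vderiv (\<lambda>t. - \<i> * ac t * \<phi> t) t + \<i> * ac t * kc t * (- \<i> * ac t * \<phi> t)
        - \<i> * ac t * (vderiv \<phi> t - 2 * \<i> * ac t * kc t * \<phi> t)"])
        (simp add: vec_eq_iff algebra_simps power2_eq_square)
  qed
  have Du0: "Du 0 t = - ac t * vderiv (vderiv \<phi>) t + of_real (vderiv a t) * vderiv \<phi> t
    + ac t ^ 2 * (6 * \<i> * kc t * vderiv \<phi> t + 3 * \<i> * of_real (vderiv k t) * \<phi> t
      + ac t * \<phi> t * of_real (9 * (k t)\<^sup>2 + \<tau> t))" for t
  proof -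
    obtain x where x: "?B'' t = x *s F1 t
     + (vderiv (vderiv \<phi>) t - 2 * \<i> * (ac t * kc t * vderiv \<phi> t + ac t * of_real (vderiv k t) * \<phi> t
         + of_real (vderiv a t) * kc t * \<phi> t)
       - 2 * \<i> * ac t * kc t * (vderiv \<phi> t - 2 * \<i> * ac t * kc t * \<phi> t)) *s F2 t
     + (- \<i> * ac t ^ 2 * \<phi> t) *s F3 t" using B'' by blast
    have f: "B t = 0 *s F1 t + \<phi> t *s F2 t + 0 *s F3 t"
      by (simp add: B_def)
    have "Du 0 t = det3 (B t) (?F1' t) (?F1'' t) + det3 (F1 t) (?B' t) (?F1'' t) + det3 (F1 t) (?F1' t) (?B'' t)"
      by (simp add: Du_def q_def qd_def)
    also have "det3 (B t) (?F1' t) (?F1'' t) = \<phi> t * ac t ^ 2 * (kc t ^ 2 * ac t + \<i> * of_real (vderiv k t) + ac t * of_real (\<tau> t))"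
      by (subst f, subst vderiv_F(1), subst vderiv2_F1, subst det3_frame)
        (simp add: algebra_simps power2_eq_square)
    also have "det3 (F1 t) (?B' t) (?F1'' t) =
        (vderiv \<phi> t - 2 * \<i> * ac t * kc t * \<phi> t) * (of_real (vderiv a t) + 2 * \<i> * ac t ^ 2 * kc t)"
      by (subst F1_comb, subst B', subst vderiv2_F1, subst det3_frame) simp
    also have "det3 (F1 t) (?F1' t) (?B'' t) = - ac t *
       (vderiv (vderiv \<phi>) t - 2 * \<i> * (ac t * kc t * vderiv \<phi> t + ac t * of_real (vderiv k t) * \<phi> t
         + of_real (vderiv a t) * kc t * \<phi> t)
       - 2 * \<i> * ac t * kc t * (vderiv \<phi> t - 2 * \<i> * ac t * kc t * \<phi> t))"
      by (subst F1_comb, subst vderiv_F(1), subst x, subst det3_frame) simp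
    finally show ?thesis by (simp add: algebra_simps power2_eq_square)
  qed
  \<comment> \<open>\<open>B'\<close> has no \<open>F3\<close> component and the velocity of
    \<open>F1\<close> has no \<open>F2\<close> component, so both products vanish.\<close>
  have hu0: "hu 0 t = 0" for t
    unfolding hu_def q_def qd_def
    by (simp add: B' vderiv_F(1)) (simp add: B_def herm_linear gram gram')
  \<comment> \<open>At u = 0 one has D = -a^3, N = a^6 and h = a, which collapses the quotient rule
    to the factor -2/3 over a^2.\<close>
  have "(1/3 * ?N 0 t powr (- 2/3) * (2 * (Re (D 0 t) * Re (Du 0 t) + Im (D 0 t) * Im (Du 0 t)))
      * h 0 t - ?N 0 t powr (1/3) * hu 0 t) / (h 0 t * h 0 t) = - (2/3) * (Re (Du 0 t) / (a t)\<^sup>2)" for t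
  proof -
    have rd: "Re (D 0 t) = - (a t ^ 3)" "Im (D 0 t) = 0"
      unfolding D0 by (simp_all flip: of_real_power)
    have "?N 0 t = a t powr 6"
      using a_pos[of t] by (simp add: rd flip: power_mult)
    then have "?N 0 t powr (- 2/3) = a t powr (- 4)" by (simp add: powr_powr)
    also have "\<dots> = 1 / a t ^ 4" using a_pos[of t] by (simp add: powr_minus_divide)
    finally show ?thesis
      using a_pos[of t] by (simp add: rd hu0 h0 field_simps eval_nat_numeral)
  qed
  with I0 have "integral {c - 1..d + 1} (\<lambda>t. - (2/3) * (Re (Du 0 t) / (a t)\<^sup>2)) = 0" by simp
  then have "integral {c - 1..d + 1} (\<lambda>t. Re (Du 0 t) / (a t)\<^sup>2) = 0"
    by (simp only: integral_mult_right)
  then show ?thesis unfolding Du0 .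
qed

end

lemma integral_derivative_vanishing:
  fixes f :: "real \<Rightarrow> real"
  assumes "\<And>t. (f has_real_derivative f' t) (at t)" "x \<le> y" "f x = 0" "f y = 0"
  shows "(f' has_integral 0) {x..y}"
proof -
  have "(f' has_integral f y - f x) {x..y}"
    using assms(1,2) by (intro fundamental_theorem_of_calculus)
      (auto simp: has_real_derivative_iff_has_vector_derivative intro: has_vector_derivative_at_within)
  then show ?thesis using assms by simp
qed

lemma smooth_on_has_real_derivative:
  "smooth_on UNIV f \<Longrightarrow> (f has_real_derivative vderiv f t) (at t)"
  by (simp add: has_real_derivative_iff_has_vector_derivative smooth_on_has_vector_derivative)

context cr_frame
begin

text \<open>Real and imaginary test functions separate the two equations. For \<phi> = f the
  integrand is f a (9 k^2 + \<tau>) minus the derivative of f' / a; for \<phi> = \<i> f it is 3 f k'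
  minus 6 times the derivative of k f. The total derivatives integrate to zero.\<close>

lemma critical_invariants:
  assumes crit: "critical_curve \<gamma>" and \<gamma>: "\<And>t. \<gamma> t = proj (F1 t)"
  shows "\<tau> t = - 9 * (k t)\<^sup>2" and "vderiv k t = 0"
proof -
  note sc = smooth_on_imp_continuous_on[OF smooth_coeffs(1)] smooth_on_imp_continuous_on[OF smooth_coeffs(2)]
    smooth_on_imp_continuous_on[OF smooth_coeffs(3)]
  have ends: "f (c - 1) = 0" "f (d + 1) = 0" "vderiv f (c - 1) = 0" "vderiv f (d + 1) = 0"
    "\<And>t. t \<notin> {c<..<d} \<Longrightarrow> f t = 0"
    if "c < d" and f: "\<And>t. f t \<ge> 0" "\<And>t. f t > 0 \<longleftrightarrow> t \<in> {c<..<d}" for f :: "real \<Rightarrow> real" and c d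
  proof -
    show v: "f t = 0" if "t \<notin> {c<..<d}" for t
      using f(1)[of t] f(2)[of t] that by linarith
    have "open (- {c..d})" by (simp add: open_Compl)
    moreover have "\<And>t. t \<in> - {c..d} \<Longrightarrow> f t = 0" by (intro v) auto
    ultimately have "vderiv f t = 0" if "t \<in> - {c..d}" for t
      using vderiv_zero_on_open that by blast
    then show "vderiv f (c - 1) = 0" "vderiv f (d + 1) = 0" by auto
    show "f (c - 1) = 0" "f (d + 1) = 0" by (auto intro: v)
  qed
  have "a t * (9 * (k t)\<^sup>2 + \<tau> t) = 0"
  proof (rule fundamental_lemma_bump[where G = "\<lambda>t. a t * (9 * (k t)\<^sup>2 + \<tau> t)"])
    show "continuous_on UNIV (\<lambda>t. a t * (9 * (k t)\<^sup>2 + \<tau> t))"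
      by (intro continuous_intros sc)
    fix c d :: real and f :: "real \<Rightarrow> real"
    assume "c < d" and sf: "smooth_on UNIV f" and f: "\<And>t. f t \<ge> 0" "\<And>t. f t > 0 \<longleftrightarrow> t \<in> {c<..<d}"
    note e = ends[OF \<open>c < d\<close> f]
    define \<phi> where "\<phi> = (\<lambda>t. complex_of_real (f t))"
    have s\<phi>: "smooth_on UNIV \<phi>" unfolding \<phi>_def by (intro smooth sf open_UNIV)
    have v1: "vderiv \<phi> = (\<lambda>t. of_real (vderiv f t))"
      unfolding \<phi>_def using vderiv_of_real[OF sf] by auto
    have v2: "vderiv (vderiv \<phi>) t = of_real (vderiv (vderiv f) t)" for t
      unfolding v1 by (rule vderiv_of_real[OF smooth_on_vderiv[OF sf]])
    have D: "((\<lambda>t. vderiv f t / a t) has_real_derivative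
        (vderiv (vderiv f) t * a t - vderiv f t * vderiv a t) / (a t * a t)) (at t)" for t
      by (intro DERIV_divide smooth_on_has_real_derivative smooth_on_vderiv sf smooth_coeffs a_nz)
    have I: "((\<lambda>t. (vderiv (vderiv f) t * a t - vderiv f t * vderiv a t) / (a t * a t)) has_integral 0) {c - 1..d + 1}"
      by (rule integral_derivative_vanishing[OF D]) (use e \<open>c < d\<close> in auto)
    have "integral {c - 1..d + 1} (\<lambda>t. Re (- ac t * vderiv (vderiv \<phi>) t + of_real (vderiv a t) * vderiv \<phi> t
      + ac t ^ 2 * (6 * \<i> * kc t * vderiv \<phi> t + 3 * \<i> * of_real (vderiv k t) * \<phi> t
      + ac t * \<phi> t * of_real (9 * (k t)\<^sup>2 + \<tau> t))) / (a t)\<^sup>2) = 0"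
      by (rule first_variation[OF crit \<gamma> \<open>c < d\<close> s\<phi>]) (use e in \<open>auto simp: \<phi>_def\<close>)
    also have "(\<lambda>t. Re (- ac t * vderiv (vderiv \<phi>) t + of_real (vderiv a t) * vderiv \<phi> t
      + ac t ^ 2 * (6 * \<i> * kc t * vderiv \<phi> t + 3 * \<i> * of_real (vderiv k t) * \<phi> t
      + ac t * \<phi> t * of_real (9 * (k t)\<^sup>2 + \<tau> t))) / (a t)\<^sup>2) =
      (\<lambda>t. f t * (a t * (9 * (k t)\<^sup>2 + \<tau> t)) -
        (vderiv (vderiv f) t * a t - vderiv f t * vderiv a t) / (a t * a t))"
      (is "?l = ?r")
    proof
      fix t
      have "?l t = (- a t * vderiv (vderiv f) t + vderiv a t * vderiv f t
          + (a t)\<^sup>2 * (a t * f t * (9 * (k t)\<^sup>2 + \<tau> t))) / (a t)\<^sup>2"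
        unfolding v2 unfolding v1 unfolding \<phi>_def power2_eq_square by simp
      then show "?l t = ?r t" using a_nz[of t] by (simp add: field_simps power2_eq_square)
    qed
    also have "integral {c - 1..d + 1} \<dots> = integral {c - 1..d + 1} (\<lambda>t. f t * (a t * (9 * (k t)\<^sup>2 + \<tau> t)))"
    proof (subst integral_diff)
      have "continuous_on UNIV (\<lambda>t. f t * (a t * (9 * (k t)\<^sup>2 + \<tau> t)))"
        by (intro continuous_intros sc smooth_on_imp_continuous_on[OF sf])
      then show "(\<lambda>t. f t * (a t * (9 * (k t)\<^sup>2 + \<tau> t))) integrable_on {c - 1..d + 1}"
        by (intro integrable_continuous_real) (rule continuous_on_subset, auto)
    qed (use I in \<open>auto simp: has_integral_iff\<close>)
    finally show "integral {c - 1..d + 1} (\<lambda>t. f t * (a t * (9 * (k t)\<^sup>2 + \<tau> t))) = 0" .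
  qed
  then show "\<tau> t = - 9 * (k t)\<^sup>2" using a_nz[of t] by simp
  show "vderiv k t = 0"
  proof (rule fundamental_lemma_bump[where G = "vderiv k"])
    have sk': "continuous_on UNIV (vderiv k)"
      by (intro smooth_on_imp_continuous_on smooth_on_vderiv smooth_coeffs)
    then show "continuous_on UNIV (vderiv k)" .
    fix c d :: real and f :: "real \<Rightarrow> real"
    assume "c < d" and sf: "smooth_on UNIV f" and f: "\<And>t. f t \<ge> 0" "\<And>t. f t > 0 \<longleftrightarrow> t \<in> {c<..<d}"
    note e = ends[OF \<open>c < d\<close> f]
    define \<phi> where "\<phi> = (\<lambda>t. \<i> * complex_of_real (f t))"
    have s\<phi>: "smooth_on UNIV \<phi>" unfolding \<phi>_def by (intro smooth sf open_UNIV)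
    have vi: "vderiv (\<lambda>t. \<i> * complex_of_real (g t)) t = \<i> * of_real (vderiv g t)"
      if "smooth_on UNIV g" for g t
      by (intro vderiv_eq has_vector_derivative_mult_right
          bounded_linear.has_vector_derivative[OF bounded_linear_of_real] smooth_on_has_vector_derivative that)
    have v1: "vderiv \<phi> = (\<lambda>t. \<i> * of_real (vderiv f t))"
      unfolding \<phi>_def using vi[OF sf] by auto
    have v2: "vderiv (vderiv \<phi>) t = \<i> * of_real (vderiv (vderiv f) t)" for t
      unfolding v1 by (rule vi[OF smooth_on_vderiv[OF sf]])
    have D: "((\<lambda>t. k t * f t) has_real_derivative vderiv k t * f t + vderiv f t * k t) (at t)" for t
      by (intro DERIV_mult smooth_on_has_real_derivative sf smooth_coeffs)
    have I: "((\<lambda>t. vderiv k t * f t + vderiv f t * k t) has_integral 0) {c - 1..d + 1}"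
      by (rule integral_derivative_vanishing[OF D]) (use e \<open>c < d\<close> in auto)
    have "integral {c - 1..d + 1} (\<lambda>t. Re (- ac t * vderiv (vderiv \<phi>) t + of_real (vderiv a t) * vderiv \<phi> t
      + ac t ^ 2 * (6 * \<i> * kc t * vderiv \<phi> t + 3 * \<i> * of_real (vderiv k t) * \<phi> t
      + ac t * \<phi> t * of_real (9 * (k t)\<^sup>2 + \<tau> t))) / (a t)\<^sup>2) = 0"
      by (rule first_variation[OF crit \<gamma> \<open>c < d\<close> s\<phi>]) (use e in \<open>auto simp: \<phi>_def\<close>)
    also have "(\<lambda>t. Re (- ac t * vderiv (vderiv \<phi>) t + of_real (vderiv a t) * vderiv \<phi> t
      + ac t ^ 2 * (6 * \<i> * kc t * vderiv \<phi> t + 3 * \<i> * of_real (vderiv k t) * \<phi> t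
      + ac t * \<phi> t * of_real (9 * (k t)\<^sup>2 + \<tau> t))) / (a t)\<^sup>2) =
      (\<lambda>t. 3 * (f t * vderiv k t) - 6 * (vderiv k t * f t + vderiv f t * k t))"
      (is "?l = ?r")
    proof
      fix t
      have "?l t = (- ((a t)\<^sup>2 * (6 * k t * vderiv f t + 3 * vderiv k t * f t))) / (a t)\<^sup>2"
        unfolding v2 unfolding v1 unfolding \<phi>_def power2_eq_square by simp
      then show "?l t = ?r t" using a_nz[of t] by (simp add: field_simps)
    qed
    also have "integral {c - 1..d + 1} \<dots> = integral {c - 1..d + 1} (\<lambda>t. 3 * (f t * vderiv k t))"
    proof (subst integral_diff)
      have "continuous_on UNIV (\<lambda>t. 3 * (f t * vderiv k t))"
        by (intro continuous_intros sk' smooth_on_imp_continuous_on[OF sf])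
      then show "(\<lambda>t. 3 * (f t * vderiv k t)) integrable_on {c - 1..d + 1}"
        by (intro integrable_continuous_real) (rule continuous_on_subset, auto)
    qed (use has_integral_mult_right[OF I, of 6] in \<open>auto simp: has_integral_iff\<close>)
    finally show "integral {c - 1..d + 1} (\<lambda>t. f t * vderiv k t) = 0" by simp
  qed
qed

end

section \<open>Closed critical curves\<close>

text \<open>The cubic is stationary at 2\<kappa> and -2\<kappa>, with values -32\<kappa>^3 and 0, so
  three distinct real roots mean -32\<kappa>^3 > 1, and equality is a double root at 2\<kappa>. If
  the inequality fails strictly, a real root beyond 4|\<kappa>| leaves a quadratic cofactor with
  nonreal roots.\<close>

lemma cubic_real_roots:
  fixes \<kappa> :: real
  assumes real: "\<And>z::complex. (z + of_real (2 * \<kappa>))\<^sup>2 * (z - of_real (4 * \<kappa>)) = 1 \<Longrightarrow> Im z = 0"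
    and simple: "32 * \<kappa> ^ 3 \<noteq> - 1"
  obtains y1 y2 y3 where "\<kappa> < 0" "4 * \<kappa> < y1" "y1 < 2 * \<kappa>" "2 * \<kappa> < y2" "y2 < - 2 * \<kappa>"
    "- 2 * \<kappa> < y3" "y1 + y2 + y3 = 0" "y1\<^sup>2 + y1 * y2 + y2\<^sup>2 = 12 * \<kappa>\<^sup>2"
    "\<And>y. y \<in> {y1, y2, y3} \<Longrightarrow> (y + 2 * \<kappa>)\<^sup>2 * (y - 4 * \<kappa>) = 1"
proof -
  define g where "g y = (y + 2 * \<kappa>)\<^sup>2 * (y - 4 * \<kappa>) - 1" for y
  have cont: "continuous_on S g" for S unfolding g_def by (intro continuous_intros)
  have ivt: "\<exists>y. x < y \<and> y < z \<and> g y = 0" if "x < z" "g x < 0 \<and> g z > 0 \<or> g x > 0 \<and> g z < 0" for x z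
  proof -
    have "\<exists>y. x \<le> y \<and> y \<le> z \<and> g y = 0"
      using that(2)
    proof (elim disjE conjE)
      assume "g x < 0" "0 < g z"
      then show ?thesis using IVT'[of g x 0 z] cont that(1) by auto
    next
      assume "g x > 0" "0 > g z"
      then show ?thesis using IVT2'[of g z 0 x] cont that(1) by auto
    qed
    then obtain y where "x \<le> y" "y \<le> z" "g y = 0" by blast
    moreover have "y \<noteq> x" "y \<noteq> z" using \<open>g y = 0\<close> that by auto
    ultimately show ?thesis by (metis order_le_less)
  qed
  have big: "- (32 * \<kappa> ^ 3) > 1"
  proof (rule ccontr)
    assume "\<not> ?thesis"
    then have small: "- (32 * \<kappa> ^ 3) < 1" using simple by linarith
    have "g (4 * \<bar>\<kappa>\<bar>) < 0"
    proof (cases "\<kappa> \<ge> 0")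
      case True
      then show ?thesis by (simp add: g_def)
    next
      case False
      then have "g (4 * \<bar>\<kappa>\<bar>) = - (32 * \<kappa> ^ 3) - 1"
        by (simp add: g_def power2_eq_square power3_eq_cube algebra_simps)
      then show ?thesis using small by simp
    qed
    moreover have "g (4 * \<bar>\<kappa>\<bar> + 2) > 0"
    proof -
      have "4 * \<bar>\<kappa>\<bar> + 2 - 4 * \<kappa> \<ge> 2" "4 * \<bar>\<kappa>\<bar> + 2 + 2 * \<kappa> \<ge> 2" by linarith+
      then have "2\<^sup>2 * 2 \<le> (4 * \<bar>\<kappa>\<bar> + 2 + 2 * \<kappa>)\<^sup>2 * (4 * \<bar>\<kappa>\<bar> + 2 - 4 * \<kappa>)"
        by (intro mult_mono power_mono) auto
      then show ?thesis by (simp add: g_def)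
    qed
    ultimately obtain y where y: "y > 4 * \<bar>\<kappa>\<bar>" "g y = 0" using ivt[of "4 * \<bar>\<kappa>\<bar>" "4 * \<bar>\<kappa>\<bar> + 2"] by auto
    have "y\<^sup>2 > (4 * \<bar>\<kappa>\<bar>)\<^sup>2" using y by (intro power_strict_mono) auto
    then have disc: "3 * y\<^sup>2 / 4 - 12 * \<kappa>\<^sup>2 > 0" by (simp add: power_mult_distrib)
    define w where "w = sqrt (3 * y\<^sup>2 / 4 - 12 * \<kappa>\<^sup>2)"
    have w: "w > 0" "w\<^sup>2 = 3 * y\<^sup>2 / 4 - 12 * \<kappa>\<^sup>2" using disc by (auto simp: w_def)
    \<comment> \<open>Expanded, the cubic is z^3 - 12\<kappa>^2 z - 16\<kappa>^3. Dividing out the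
      real root y leaves z^2 + y z + y^2 - 12\<kappa>^2, whose discriminant is negative because y >
      4|\<kappa>|.\<close>
    define z where "z = Complex (- y / 2) w"
    have zz: "z\<^sup>2 + of_real y * z + of_real (y\<^sup>2 - 12 * \<kappa>\<^sup>2) = 0"
      using w(2) by (simp add: z_def complex_eq_iff power2_eq_square field_simps)
    have "(z + of_real (2 * \<kappa>))\<^sup>2 * (z - of_real (4 * \<kappa>)) - 1 =
        (z - of_real y) * (z\<^sup>2 + of_real y * z + of_real (y\<^sup>2 - 12 * \<kappa>\<^sup>2)) + of_real (g y)"
      by (simp add: g_def power2_eq_square algebra_simps)
    then have "(z + of_real (2 * \<kappa>))\<^sup>2 * (z - of_real (4 * \<kappa>)) = 1" using zz y(2) by simp
    then show False using real w(1) by (force simp: z_def)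
  qed
  have neg: "\<kappa> < 0"
  proof (rule ccontr)
    assume "\<not> ?thesis"
    then have "\<kappa> ^ 3 \<ge> 0" by simp
    with big show False by linarith
  qed
  \<comment> \<open>The points 4\<kappa> and -4\<kappa> repeat the critical values at -2\<kappa> and
    2\<kappa>, so the four signs follow from two numbers, -1 and -32\<kappa>^3 - 1.\<close>
  have "g (4 * \<kappa>) < 0" "g (2 * \<kappa>) > 0" "g (- 2 * \<kappa>) < 0" "g (- 4 * \<kappa>) > 0"
    using big by (simp_all add: g_def power2_eq_square power3_eq_cube algebra_simps)
  with neg ivt[of "4 * \<kappa>" "2 * \<kappa>"] ivt[of "2 * \<kappa>" "- 2 * \<kappa>"] ivt[of "- 2 * \<kappa>" "- 4 * \<kappa>"]
  obtain y1 y2 y3 where y: "4 * \<kappa> < y1" "y1 < 2 * \<kappa>" "2 * \<kappa> < y2" "y2 < - 2 * \<kappa>" "- 2 * \<kappa> < y3"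
    and g0: "g y1 = 0" "g y2 = 0" "g y3 = 0" by auto
  \<comment> \<open>Divided differences of the cubic; dividing once more gives the sum of the
    roots.\<close>
  have "(y1 - y2) * (y1\<^sup>2 + y1 * y2 + y2\<^sup>2 - 12 * \<kappa>\<^sup>2) = g y1 - g y2"
    "(y1 - y3) * (y1\<^sup>2 + y1 * y3 + y3\<^sup>2 - 12 * \<kappa>\<^sup>2) = g y1 - g y3"
    by (simp_all add: g_def power2_eq_square algebra_simps)
  then have 12: "y1\<^sup>2 + y1 * y2 + y2\<^sup>2 = 12 * \<kappa>\<^sup>2" and 13: "y1\<^sup>2 + y1 * y3 + y3\<^sup>2 = 12 * \<kappa>\<^sup>2"
    using g0 y by auto
  have "(y2 - y3) * (y1 + y2 + y3) = (y1\<^sup>2 + y1 * y2 + y2\<^sup>2) - (y1\<^sup>2 + y1 * y3 + y3\<^sup>2)"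
    by (simp add: power2_eq_square algebra_simps)
  then have "y1 + y2 + y3 = 0" using 12 13 y by auto
  with neg y 12 g0 show ?thesis using that[of y1 y2 y3] by (auto simp: g_def)
qed

section \<open>Monodromy of a periodic frame and the strain parameter\<close>

lemma vderiv_shift:
  assumes "smooth_on UNIV f"
  shows "vderiv (\<lambda>t. f (t + c)) t = vderiv f (t + c)"
proof (rule vderiv_eq)
  have "((\<lambda>t. t + c) has_vector_derivative 1) (at t)"
    by (auto simp flip: has_real_derivative_iff_has_vector_derivative intro!: derivative_eq_intros)
  from vector_diff_chain_at[OF this smooth_on_has_vector_derivative[OF assms]]
  show "((\<lambda>t. f (t + c)) has_vector_derivative vderiv f (t + c)) (at t)" by (simp add: o_def)
qed

lemma constant_of_zero_derivative:
  assumes "\<And>t. (f has_vector_derivative 0) (at t)"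
  shows "f s = f (t::real)"
  using has_vector_derivative_zero_constant[of UNIV f] assms by force

context cr_frame
begin

lemma herm_F1_vderiv: "herm (F1 t) (vderiv F1 t) = \<i> * ac t"
  by (simp add: vderiv_F(1) herm_linear gram)

text \<open>The shifted \<open>F1\<close> is another lift, hence \<mu>(t) \<open>F1\<close>. The
  normalisations of \<open>herm\<close> and of the determinant change by |\<mu>|^2 and \<mu>^3 while
  both are tied to the same density a, so |\<mu>| = 1 and then \<mu>^3 = 1, which makes \<mu>
  constant. The structure equations, having constant k and \<tau>, pass the factor on to
  \<open>F3\<close> and \<open>F2\<close>.\<close>

lemma periodic_frame:
  assumes \<gamma>: "\<And>t. \<gamma> t = proj (F1 t)" and per: "\<And>t. \<gamma> (t + T) = \<gamma> t"
    and const: "\<And>t. k t = \<kappa>" "\<And>t. \<tau> t = \<tau>0"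
  obtains \<mu> where "cmod \<mu> = 1" "\<And>t. a (t + T) = a t" "\<And>t. F1 (t + T) = \<mu> *s F1 t"
    "\<And>t. F2 (t + T) = \<mu> *s F2 t" "\<And>t. F3 (t + T) = \<mu> *s F3 t"
proof -
  have nz: "F1 t \<noteq> 0" for t using det_F[of t] by auto
  have L: "lift_of \<gamma> F1" "lift_of \<gamma> (\<lambda>t. F1 (t + T))"
    unfolding lift_of_def null_vectors_def using \<gamma> per gram nz smooth_F(1)
    by (auto intro: smooth_on_shift)
  obtain \<mu> where s\<mu>: "smooth_on UNIV \<mu>" and \<mu>0: "\<And>t. \<mu> t \<noteq> 0" and \<mu>: "\<And>t. F1 (t + T) = \<mu> t *s F1 t"
    using lift_change[OF L] by blast
  have eq: "(\<lambda>t. F1 (t + T)) = (\<lambda>t. \<mu> t *s F1 t)" using \<mu> by auto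
  have v1: "vderiv (\<lambda>t. F1 (t + T)) = (\<lambda>t. vderiv F1 (t + T))"
    using vderiv_shift[OF smooth_F(1)] by auto
  have v2: "vderiv (\<lambda>t. vderiv F1 (t + T)) = (\<lambda>t. vderiv (vderiv F1) (t + T))"
    using vderiv_shift[OF smooth_on_vderiv[OF smooth_F(1)]] by auto
  have "lift_det (\<lambda>t. F1 (t + T)) t = lift_det F1 (t + T)" for t
    unfolding lift_det_eq v1 v2 ..
  then have d: "ac (t + T) ^ 3 = \<mu> t ^ 3 * ac t ^ 3" for t
    using lift_det_smult[OF s\<mu> smooth_F(1), of t] unfolding eq lift_det_F1 by simp
  have h: "a (t + T) = (cmod (\<mu> t))\<^sup>2 * a t" for t
  proof -
    have "\<i> * ac (t + T) = of_real ((cmod (\<mu> t))\<^sup>2) * (\<i> * ac t)"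
      using herm_vderiv_smult[OF s\<mu> smooth_F(1) gram(1), of t]
      unfolding eq[symmetric] v1 herm_F1_vderiv \<mu>[symmetric] .
    then have "ac (t + T) = of_real ((cmod (\<mu> t))\<^sup>2 * a t)" by simp
    then show ?thesis by (simp only: of_real_eq_iff)
  qed
  have n1: "cmod (\<mu> t) = 1" for t
  proof -
    let ?m = "cmod (\<mu> t)"
    have "a (t + T) ^ 3 = ?m ^ 3 * a t ^ 3"
      using arg_cong[OF d[of t], of cmod] a_pos[of t] a_pos[of "t + T"] by (simp add: norm_mult norm_power)
    then have "(?m\<^sup>2) ^ 3 * a t ^ 3 = ?m ^ 3 * a t ^ 3" unfolding h by (simp add: power_mult_distrib)
    then have "(?m\<^sup>2) ^ 3 = ?m ^ 3" using a_nz[of t] by simp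
    then have "?m\<^sup>2 = ?m" by (rule power_eq_imp_eq_base) auto
    then show ?thesis using \<mu>0[of t] by (simp add: power2_eq_square)
  qed
  have per_a: "a (t + T) = a t" for t using h[of t] n1[of t] by simp
  have cube: "\<mu> t * \<mu> t * \<mu> t = 1" for t
    using d[of t] a_nz[of t] unfolding per_a by (simp add: power3_eq_cube)
  have "vderiv \<mu> t = 0" for t
  proof -
    note m = smooth_on_has_vector_derivative[OF s\<mu>]
    have "((\<lambda>t. \<mu> t * \<mu> t * \<mu> t) has_vector_derivative
        \<mu> t * \<mu> t * vderiv \<mu> t + (\<mu> t * vderiv \<mu> t + vderiv \<mu> t * \<mu> t) * \<mu> t) (at t)"
      by (intro has_vector_derivative_mult m)
    then have "\<mu> t * \<mu> t * vderiv \<mu> t + (\<mu> t * vderiv \<mu> t + vderiv \<mu> t * \<mu> t) * \<mu> t = 0"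
      unfolding cube using vector_derivative_unique_at has_vector_derivative_const by blast
    then have "(\<mu> t)\<^sup>2 * vderiv \<mu> t = 0" by (simp add: power2_eq_square algebra_simps)
    then show ?thesis using \<mu>0 by simp
  qed
  then have "\<mu> t = \<mu> 0" for t
    using constant_of_zero_derivative[of \<mu>] smooth_on_has_vector_derivative[OF s\<mu>] by metis
  then have p1: "F1 (t + T) = \<mu> 0 *s F1 t" for t using \<mu> by metis
  have sh: "vderiv f (t + T) = \<mu> 0 *s vderiv f t"
    if "smooth_on UNIV f" "\<And>t. f (t + T) = \<mu> 0 *s f t" for f :: "real \<Rightarrow> complex^3" and t
  proof -
    have "vderiv (\<lambda>t. f (t + T)) t = \<mu> 0 *s vderiv f t + 0 *s f t"
      unfolding that(2)
      by (intro vderiv_eq smult_has_vector_derivative has_vector_derivative_const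
          smooth_on_has_vector_derivative that(1))
    then show ?thesis by (simp add: vderiv_shift that(1))
  qed
  have p3: "F3 (t + T) = \<mu> 0 *s F3 t" for t
  proof -
    have "ac t *s F3 (t + T) = ac t *s (\<mu> 0 *s F3 t)"
      using sh[OF smooth_F(1) p1, of t] unfolding vderiv_F per_a const p1
      by (simp add: vec_eq_iff algebra_simps)
    then show ?thesis using a_nz[of t] by (simp add: vec_eq_iff)
  qed
  have p2: "F2 (t + T) = \<mu> 0 *s F2 t" for t
  proof -
    have "ac t *s F2 (t + T) = ac t *s (\<mu> 0 *s F2 t)"
      using sh[OF smooth_F(3) p3, of t] unfolding vderiv_F per_a const p1 p3
      by (simp add: vec_eq_iff algebra_simps)
    then show ?thesis using a_nz[of t] by (simp add: vec_eq_iff)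
  qed
  show ?thesis using that n1 per_a p1 p2 p3 by blast
qed

text \<open>Periodicity is what makes the strain parameter surjective: each period adds the fixed
  amount \<open>S\<close> > 0.\<close>

lemma arclength_exists:
  assumes "T > 0" and per: "\<And>t. a (t + T) = a t"
  obtains \<sigma> S where "\<And>t. (\<sigma> has_real_derivative a t) (at t)" "smooth_on UNIV \<sigma>" "bij \<sigma>"
    "\<sigma> 0 = 0" "S > 0" "\<And>t. \<sigma> (t + T) = \<sigma> t + S"
proof -
  obtain s where s: "\<And>t. (s has_vector_derivative a t) (at t)"
    using antiderivative_exists[OF smooth_on_imp_continuous_on[OF smooth_coeffs(1)]] by blast
  define \<sigma> where "\<sigma> t = s t - s 0" for t
  have d: "(\<sigma> has_real_derivative a t) (at t)" for t
    unfolding \<sigma>_def using s by (auto simp: has_real_derivative_iff_has_vector_derivative intro!: derivative_eq_intros)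
  define S where "S = \<sigma> T"
  have mono: "\<sigma> x < \<sigma> y" if "x < y" for x y
    using DERIV_pos_imp_increasing[OF that] d a_pos by blast
  have "((\<lambda>t. \<sigma> (t + T) - \<sigma> t) has_real_derivative a (t + T) - a t) (at t)" for t
    by (intro DERIV_diff d) (use d[of "t + T"] in \<open>simp add: DERIV_shift\<close>)
  then have c: "\<sigma> (t + T) - \<sigma> t = \<sigma> (0 + T) - \<sigma> 0" for t
    by (intro constant_of_zero_derivative[of "\<lambda>t. \<sigma> (t + T) - \<sigma> t"])
      (simp add: per has_real_derivative_iff_has_vector_derivative)
  have 0: "\<sigma> 0 = 0" by (simp add: \<sigma>_def)
  then have shift: "\<sigma> (t + T) = \<sigma> t + S" for t using c[of t] by (simp add: S_def)
  have S: "S > 0" using mono[OF \<open>T > 0\<close>] 0 by (simp add: S_def)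
  have mult: "\<sigma> (of_nat n * T) = of_nat n * S" for n
  proof (induction n)
    case (Suc n)
    then show ?case using shift[of "of_nat n * T"] by (simp add: algebra_simps)
  qed (simp add: 0)
  have mult': "\<sigma> (- (of_nat n * T)) = - (of_nat n * S)" for n
  proof (induction n)
    case (Suc n)
    then show ?case using shift[of "- (of_nat (Suc n) * T)"] by (simp add: algebra_simps)
  qed (simp add: 0)
  have "surj \<sigma>"
  proof
    show "UNIV \<subseteq> range \<sigma>"
    proof
      fix z :: real
      obtain n :: nat where n: "\<bar>z\<bar> < of_nat n * S" using S reals_Archimedean3 by blast
      have "\<exists>x. - (of_nat n * T) \<le> x \<and> x \<le> of_nat n * T \<and> \<sigma> x = z"
      proof (rule IVT')
        show "continuous_on {- (of_nat n * T)..of_nat n * T} \<sigma>"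
          using d by (meson DERIV_isCont continuous_at_imp_continuous_on)
        show "- (of_nat n * T) \<le> of_nat n * T" using \<open>T > 0\<close> by (simp add: mult_nonneg_nonneg order_trans[of _ 0])
      qed (use n mult mult' in auto)
      then show "z \<in> range \<sigma>" by blast
    qed
  qed simp
  moreover have "inj \<sigma>" using mono by (metis injI linorder_neqE_linordered_idom less_irrefl)
  moreover have "smooth_on UNIV \<sigma>"
    by (rule smooth_onI_vector[OF _ smooth_coeffs(1)]) (use d in \<open>simp add: has_real_derivative_iff_has_vector_derivative\<close>)
  ultimately show ?thesis using that d 0 S shift by (auto simp: bij_def)
qed

text \<open>\<open>eigen \<kappa> y t\<close> moves along an eigendirection of the frame equations when \<open>y\<close> is a root of
  \<open>(y + 2\<kappa>)\<^sup>2 (y - 4\<kappa>) = 1\<close>.\<close>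

definition eigen :: "real \<Rightarrow> complex \<Rightarrow> real \<Rightarrow> complex^3"
  where "eigen \<kappa> y t = (- (y - of_real \<kappa>) * (y + 2 * of_real \<kappa>)) *s F1 t + 1 *s F2 t
    + (\<i> * (y + 2 * of_real \<kappa>)) *s F3 t"

lemma eigen_nonzero: "eigen \<kappa> y t \<noteq> 0"
proof
  assume "eigen \<kappa> y t = 0"
  then have "det3 (eigen \<kappa> y t) (F1 t) (F3 t) = 0" by simp
  moreover have "det3 (eigen \<kappa> y t) (F1 t) (F3 t) = - det3 (F1 t) (F2 t) (F3 t)"
    by (simp add: eigen_def det3_linear) (simp add: det3_eq algebra_simps)
  ultimately show False by (simp add: det_F)
qed

text \<open>With the chosen coefficients the \<open>F2\<close> and \<open>F3\<close> components of
  the eigenvector equation hold for every y; the \<open>F1\<close> component is exactly the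
  cubic.\<close>

lemma eigen_has_vector_derivative:
  assumes const: "\<And>t. k t = \<kappa>" "\<And>t. \<tau> t = - 9 * \<kappa>\<^sup>2"
    and root: "(y + of_real (2 * \<kappa>))\<^sup>2 * (y - of_real (4 * \<kappa>)) = 1"
  shows "(eigen \<kappa> y has_vector_derivative (\<i> * y * ac t) *s eigen \<kappa> y t) (at t)"
proof -
  have s: "smooth_on UNIV (eigen \<kappa> y)"
    unfolding eigen_def by (intro smooth smooth_F open_UNIV)
  have "vderiv (eigen \<kappa> y) t = (\<i> * y * ac t) *s eigen \<kappa> y t"
  proof -
    let ?x1 = "- (y - of_real \<kappa>) * (y + 2 * of_real \<kappa>)" and ?x3 = "\<i> * (y + 2 * of_real \<kappa>)"
    have "vderiv (eigen \<kappa> y) t =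
      (0 + \<i> * ac t * of_real \<kappa> * ?x1 - \<i> * ac t * 1 + ac t * of_real (- 9 * \<kappa>\<^sup>2) * ?x3) *s F1 t
      + (0 - 2 * \<i> * ac t * of_real \<kappa> * 1 + ac t * ?x3) *s F2 t
      + (0 + ac t * ?x1 + \<i> * ac t * of_real \<kappa> * ?x3) *s F3 t"
      unfolding eigen_def[abs_def]
      by (subst vderiv_frame_comb) (auto simp only: const vderiv_const intro!: smooth)
    also have "0 + \<i> * ac t * of_real \<kappa> * ?x1 - \<i> * ac t * 1 + ac t * of_real (- 9 * \<kappa>\<^sup>2) * ?x3
        = (\<i> * y * ac t) * ?x1 + \<i> * ac t * ((y + of_real (2 * \<kappa>))\<^sup>2 * (y - of_real (4 * \<kappa>)) - 1)"
      by (simp add: power2_eq_square algebra_simps)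
    also have "\<dots> = (\<i> * y * ac t) * ?x1" using root by simp
    also have "0 - 2 * \<i> * ac t * of_real \<kappa> * 1 + ac t * ?x3 = (\<i> * y * ac t) * 1"
      by (simp add: algebra_simps)
    also have "0 + ac t * ?x1 + \<i> * ac t * of_real \<kappa> * ?x3 = (\<i> * y * ac t) * ?x3"
      by (simp add: algebra_simps)
    finally have e: "vderiv (eigen \<kappa> y) t = (\<i> * y * ac t * ?x1) *s F1 t + (\<i> * y * ac t * 1) *s F2 t
      + (\<i> * y * ac t * ?x3) *s F3 t" .
    show ?thesis unfolding e eigen_def by (simp add: vec_eq_iff algebra_simps)
  qed
  then show ?thesis using smooth_on_has_vector_derivative[OF s, of t] by simp
qed

lemma exp_arclength_has_vector_derivative:
  assumes "(\<sigma> has_real_derivative a t) (at t)"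
  shows "((\<lambda>t. exp (z * of_real (\<sigma> t))) has_vector_derivative z * ac t * exp (z * of_real (\<sigma> t))) (at t)"
proof -
  have "((\<lambda>t. z * of_real (\<sigma> t)) has_vector_derivative z * ac t) (at t)"
    by (intro has_vector_derivative_mult_right bounded_linear.has_vector_derivative[OF bounded_linear_of_real])
      (use assms in \<open>simp add: has_real_derivative_iff_has_vector_derivative\<close>)
  from field_vector_diff_chain_at[OF this DERIV_exp] show ?thesis by (simp add: o_def)
qed

lemma eigen_eq:
  assumes const: "\<And>t. k t = \<kappa>" "\<And>t. \<tau> t = - 9 * \<kappa>\<^sup>2"
    and root: "(y + of_real (2 * \<kappa>))\<^sup>2 * (y - of_real (4 * \<kappa>)) = 1"
    and \<sigma>: "\<And>t. (\<sigma> has_real_derivative a t) (at t)" "\<sigma> 0 = 0"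
  shows "eigen \<kappa> y t = exp (\<i> * y * of_real (\<sigma> t)) *s eigen \<kappa> y 0"
proof -
  define X where "X t = exp (- (\<i> * y) * of_real (\<sigma> t)) *s eigen \<kappa> y t" for t
  have "(X has_vector_derivative exp (- (\<i> * y) * of_real (\<sigma> t)) *s ((\<i> * y * ac t) *s eigen \<kappa> y t)
    + (- (\<i> * y) * ac t * exp (- (\<i> * y) * of_real (\<sigma> t))) *s eigen \<kappa> y t) (at t)" for t
    unfolding X_def
    by (intro smult_has_vector_derivative exp_arclength_has_vector_derivative \<sigma>
        eigen_has_vector_derivative const root)
  then have "(X has_vector_derivative 0) (at t)" for t
    by (rule has_vector_derivative_eq_rhs) (simp add: vec_eq_iff algebra_simps)
  then have "X t = X 0" by (rule constant_of_zero_derivative)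
  then have "exp (\<i> * y * of_real (\<sigma> t)) *s X t = exp (\<i> * y * of_real (\<sigma> t)) *s X 0" by simp
  then show ?thesis by (simp add: X_def \<sigma>(2) vector_smult_assoc flip: exp_add)
qed

end

section \<open>Spectral decomposition of the lift \<open>F1\<close>\<close>

lemma cubic_root_exists: "\<exists>y::real. (y + 2 * \<kappa>)\<^sup>2 * (y - 4 * \<kappa>) = 1"
proof -
  have "\<exists>y. 4 * \<kappa> \<le> y \<and> y \<le> 4 * \<bar>\<kappa>\<bar> + 2 \<and> (y + 2 * \<kappa>)\<^sup>2 * (y - 4 * \<kappa>) = 1"
  proof (rule IVT')
    have "4 * \<bar>\<kappa>\<bar> + 2 - 4 * \<kappa> \<ge> 2" "4 * \<bar>\<kappa>\<bar> + 2 + 2 * \<kappa> \<ge> 2" by linarith+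
    then have "2\<^sup>2 * 2 \<le> (4 * \<bar>\<kappa>\<bar> + 2 + 2 * \<kappa>)\<^sup>2 * (4 * \<bar>\<kappa>\<bar> + 2 - 4 * \<kappa>)"
      by (intro mult_mono power_mono) auto
    then show "1 \<le> (4 * \<bar>\<kappa>\<bar> + 2 + 2 * \<kappa>)\<^sup>2 * (4 * \<bar>\<kappa>\<bar> + 2 - 4 * \<kappa>)" by simp
    show "continuous_on {4 * \<kappa>..4 * \<bar>\<kappa>\<bar> + 2} (\<lambda>y. (y + 2 * \<kappa>)\<^sup>2 * (y - 4 * \<kappa>))"
      by (intro continuous_intros)
  qed auto
  then show ?thesis by blast
qed

text \<open>Each d is 1 / p'(y) for the monic cubic p with these roots. The sums of y^j / p'(y) are
  the leading coefficients of the quadratic interpolants of 1, y and y^2.\<close>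

lemma lagrange_inverse_derivative:
  fixes y1 y2 y3 :: real
  assumes "y1 + y2 + y3 = 0" "y1 \<noteq> y2" "y1 \<noteq> y3" "y2 \<noteq> y3"
  defines "d1 \<equiv> 1 / ((y1 - y2) * (y1 - y3))" and "d2 \<equiv> 1 / ((y2 - y1) * (y2 - y3))"
    and "d3 \<equiv> 1 / ((y3 - y1) * (y3 - y2))"
  shows "d1 + d2 + d3 = 0" "d1 * y1 + d2 * y2 + d3 * y3 = 0"
    "d1 * y1\<^sup>2 + d2 * y2\<^sup>2 + d3 * y3\<^sup>2 = 1"
proof -
  let ?p = "(y1 - y2) * (y1 - y3) * (y2 - y3)"
  have p: "?p \<noteq> 0" using assms by simp
  have d: "d1 = (y2 - y3) / ?p" "d2 = - (y1 - y3) / ?p" "d3 = (y1 - y2) / ?p"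
    unfolding d1_def d2_def d3_def using assms(2-4)
    by (subst frac_eq_eq, simp, simp, simp add: algebra_simps)+
  have "d1 + d2 + d3 = ((y2 - y3) + - (y1 - y3) + (y1 - y2)) / ?p"
    unfolding d by (simp only: add_divide_distrib)
  then show "d1 + d2 + d3 = 0" by simp
  have "d1 * y1 + d2 * y2 + d3 * y3 = ((y2 - y3) * y1 + - (y1 - y3) * y2 + (y1 - y2) * y3) / ?p"
    unfolding d by (simp only: add_divide_distrib times_divide_eq_left)
  then show "d1 * y1 + d2 * y2 + d3 * y3 = 0" by (simp add: algebra_simps)
  have "d1 * y1\<^sup>2 + d2 * y2\<^sup>2 + d3 * y3\<^sup>2 = ((y2 - y3) * y1\<^sup>2 + - (y1 - y3) * y2\<^sup>2 + (y1 - y2) * y3\<^sup>2) / ?p"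
    unfolding d by (simp only: add_divide_distrib times_divide_eq_left)
  also have "(y2 - y3) * y1\<^sup>2 + - (y1 - y3) * y2\<^sup>2 + (y1 - y2) * y3\<^sup>2 = ?p"
    by (simp add: power2_eq_square algebra_simps)
  finally show "d1 * y1\<^sup>2 + d2 * y2\<^sup>2 + d3 * y3\<^sup>2 = 1" using p by simp
qed

context cr_frame
begin

lemma herm_eigen:
  "herm (eigen \<kappa> (of_real y) t) (eigen \<kappa> (of_real z) t) =
    of_real (1 + (y + 2 * \<kappa>) * (z + 2 * \<kappa>) * (y + z - 2 * \<kappa>))"
  by (simp add: eigen_def herm_linear gram gram' algebra_simps)

text \<open>\<open>eigen \<kappa> y\<close> is a quadratic polynomial in y with leading coefficient
  -\<open>F1\<close>, and 3 (y^2 - 4\<kappa>^2) is the derivative of the cubic. The Lagrange weights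
  therefore extract \<open>F1\<close> and annihilate the lower terms.\<close>

lemma F1_eq_eigen_sum:
  assumes "y1 + y2 + y3 = 0" "y1\<^sup>2 + y1 * y2 + y2\<^sup>2 = 12 * \<kappa>\<^sup>2" "y1 \<noteq> y2" "y1 \<noteq> y3" "y2 \<noteq> y3"
  shows "F1 t = of_real (- 1 / (3 * (y1\<^sup>2 - 4 * \<kappa>\<^sup>2))) *s eigen \<kappa> (of_real y1) t
    + of_real (- 1 / (3 * (y2\<^sup>2 - 4 * \<kappa>\<^sup>2))) *s eigen \<kappa> (of_real y2) t
    + of_real (- 1 / (3 * (y3\<^sup>2 - 4 * \<kappa>\<^sup>2))) *s eigen \<kappa> (of_real y3) t"
proof -
  have y3: "y3 = - y1 - y2" using assms(1) by simp
  define d1 d2 d3 where "d1 = 1 / ((y1 - y2) * (y1 - y3))" and "d2 = 1 / ((y2 - y1) * (y2 - y3))"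
    and "d3 = 1 / ((y3 - y1) * (y3 - y2))"
  note L = lagrange_inverse_derivative[OF assms(1,3,4,5), folded d1_def d2_def d3_def]
  have "3 * (y1\<^sup>2 - 4 * \<kappa>\<^sup>2) = (y1 - y2) * (y1 - y3)" "3 * (y2\<^sup>2 - 4 * \<kappa>\<^sup>2) = (y2 - y1) * (y2 - y3)"
    "3 * (y3\<^sup>2 - 4 * \<kappa>\<^sup>2) = (y3 - y1) * (y3 - y2)"
    using assms(2) unfolding y3 by (simp_all add: power2_eq_square algebra_simps)
  then have c: "- 1 / (3 * (y1\<^sup>2 - 4 * \<kappa>\<^sup>2)) = - d1" "- 1 / (3 * (y2\<^sup>2 - 4 * \<kappa>\<^sup>2)) = - d2"
    "- 1 / (3 * (y3\<^sup>2 - 4 * \<kappa>\<^sup>2)) = - d3"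
    by (simp_all only: d1_def d2_def d3_def minus_divide_left)
  have s: "of_real (- d1) *s eigen \<kappa> (of_real y1) t + of_real (- d2) *s eigen \<kappa> (of_real y2) t
      + of_real (- d3) *s eigen \<kappa> (of_real y3) t =
    of_real ((d1 * y1\<^sup>2 + d2 * y2\<^sup>2 + d3 * y3\<^sup>2) + \<kappa> * (d1 * y1 + d2 * y2 + d3 * y3)
      - 2 * \<kappa>\<^sup>2 * (d1 + d2 + d3)) *s F1 t
    + of_real (- (d1 + d2 + d3)) *s F2 t
    + (- \<i> * of_real ((d1 * y1 + d2 * y2 + d3 * y3) + 2 * \<kappa> * (d1 + d2 + d3))) *s F3 t"
    by (simp add: eigen_def vec_eq_iff power2_eq_square algebra_simps)
  show ?thesis unfolding c s L by (simp add: vec_eq_iff)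
qed

text \<open>Over one period an eigendirection is multiplied by exp(\<i> y \<sigma>(T)) and also by
  \<mu>; equal moduli force y to be real. A double root would bring a Jordan block, whose solutions
  grow linearly in \<sigma>, against a scalar monodromy.\<close>

lemma closed_invariants:
  assumes const: "\<And>t. k t = \<kappa>" "\<And>t. \<tau> t = - 9 * \<kappa>\<^sup>2"
    and \<sigma>: "\<And>t. (\<sigma> has_real_derivative a t) (at t)" "\<sigma> 0 = 0" "\<sigma> T > 0"
    and per: "\<And>t. F1 (t + T) = \<mu> *s F1 t" "\<And>t. F2 (t + T) = \<mu> *s F2 t" "\<And>t. F3 (t + T) = \<mu> *s F3 t"
    and \<mu>: "cmod \<mu> = 1"
    and root: "(y + of_real (2 * \<kappa>))\<^sup>2 * (y - of_real (4 * \<kappa>)) = 1"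
  shows "exp (\<i> * y * of_real (\<sigma> T)) = \<mu>" and "Im y = 0" and "32 * \<kappa> ^ 3 \<noteq> - 1"
proof -
  have pe: "eigen \<kappa> y T = \<mu> *s eigen \<kappa> y 0" for y
    using per[of 0] by (simp add: eigen_def vec_eq_iff algebra_simps)
  have ex: "exp (\<i> * y * of_real (\<sigma> T)) = \<mu>"
    if "(y + of_real (2 * \<kappa>))\<^sup>2 * (y - of_real (4 * \<kappa>)) = 1" for y
  proof -
    have "exp (\<i> * y * of_real (\<sigma> T)) *s eigen \<kappa> y 0 = \<mu> *s eigen \<kappa> y 0"
      by (rule trans[OF eigen_eq[OF const that \<sigma>(1,2), symmetric] pe])
    then have "(exp (\<i> * y * of_real (\<sigma> T)) - \<mu>) *s eigen \<kappa> y 0 = 0"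
      by (simp only: vector_sub_rdistrib right_minus_eq)
    then show ?thesis using eigen_nonzero by simp
  qed
  then show 1: "exp (\<i> * y * of_real (\<sigma> T)) = \<mu>" using root by blast
  from \<mu> \<sigma>(3) show "Im y = 0" unfolding 1[symmetric] by simp
  show "32 * \<kappa> ^ 3 \<noteq> - 1"
  proof
    assume double: "32 * \<kappa> ^ 3 = - 1"
    define y where "y = complex_of_real (2 * \<kappa>)"
    have root2: "(y + of_real (2 * \<kappa>))\<^sup>2 * (y - of_real (4 * \<kappa>)) = 1"
    proof -
      have "(2 * \<kappa> + 2 * \<kappa>)\<^sup>2 * (2 * \<kappa> - 4 * \<kappa>) = 1"
        using double by (simp add: power2_eq_square power3_eq_cube algebra_simps)
      then show ?thesis unfolding y_def by (metis of_real_add of_real_diff of_real_mult of_real_power of_real_1)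
    qed
    \<comment> \<open>\<open>U\<close> is \<open>- \<i>\<close> times the \<open>y\<close>-derivative of \<open>eigen \<kappa> y\<close> at the double root, hence a generalised eigendirection.\<close>
    define U where "U t = (5 * \<i> * of_real \<kappa>) *s F1 t + 0 *s F2 t + 1 *s F3 t" for t
    have "vderiv U t = (0 + \<i> * ac t * of_real \<kappa> * (5 * \<i> * of_real \<kappa>) - \<i> * ac t * 0 + ac t * of_real (- 9 * \<kappa>\<^sup>2) * 1) *s F1 t
      + (0 - 2 * \<i> * ac t * of_real \<kappa> * 0 + ac t * 1) *s F2 t
      + (0 + ac t * (5 * \<i> * of_real \<kappa>) + \<i> * ac t * of_real \<kappa> * 1) *s F3 t" for t
      unfolding U_def[abs_def]
      by (subst vderiv_frame_comb) (auto simp only: const vderiv_const intro!: smooth)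
    then have U': "vderiv U t = ac t *s (eigen \<kappa> y t + (\<i> * y) *s U t)" for t
      by (simp add: eigen_def U_def y_def vec_eq_iff power2_eq_square algebra_simps)
    have sU: "smooth_on UNIV U" unfolding U_def by (intro smooth smooth_F open_UNIV)
    \<comment> \<open>Removing the exponential and the linear term from the generalised
      eigendirection leaves a constant vector; comparing 0 and T isolates the term \<sigma>(T)
      \<open>eigen \<kappa> y T\<close>, which is nonzero.\<close>
    define X where "X t = exp (- (\<i> * y) * of_real (\<sigma> t)) *s (U t - of_real (\<sigma> t) *s eigen \<kappa> y t)" for t
    have "(X has_vector_derivative exp (- (\<i> * y) * of_real (\<sigma> t)) *s
        (vderiv U t - (of_real (\<sigma> t) *s ((\<i> * y * ac t) *s eigen \<kappa> y t) + ac t *s eigen \<kappa> y t))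
      + (- (\<i> * y) * ac t * exp (- (\<i> * y) * of_real (\<sigma> t))) *s (U t - of_real (\<sigma> t) *s eigen \<kappa> y t)) (at t)" for t
      unfolding X_def
      by (intro smult_has_vector_derivative has_vector_derivative_diff exp_arclength_has_vector_derivative
          bounded_linear.has_vector_derivative[OF bounded_linear_of_real]
          \<sigma>(1)[unfolded has_real_derivative_iff_has_vector_derivative] \<sigma>(1)
          eigen_has_vector_derivative const root2 smooth_on_has_vector_derivative sU)
    then have "(X has_vector_derivative 0) (at t)" for t
      by (rule has_vector_derivative_eq_rhs) (simp add: U' vec_eq_iff algebra_simps)
    then have "X T = X 0" by (rule constant_of_zero_derivative)
    moreover have "X 0 = U 0" by (simp add: X_def \<sigma>(2))
    ultimately have "exp (\<i> * y * of_real (\<sigma> T)) *s X T = exp (\<i> * y * of_real (\<sigma> T)) *s U 0" by simp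
    moreover have "exp (\<i> * y * of_real (\<sigma> T)) *s X T = U T - of_real (\<sigma> T) *s eigen \<kappa> y T"
      by (simp add: X_def vector_smult_assoc flip: exp_add)
    ultimately have "U T - of_real (\<sigma> T) *s eigen \<kappa> y T = \<mu> *s U 0"
      unfolding ex[OF root2] by simp
    moreover have "U T = \<mu> *s U 0" using per[of 0] by (simp add: U_def vec_eq_iff algebra_simps)
    ultimately have "of_real (\<sigma> T) *s eigen \<kappa> y T = 0" by simp
    then show False using eigen_nonzero \<sigma>(3) by simp
  qed
qed

end

theorem closed_critical_curve_spectral:
  assumes "closed_critical_curve \<gamma>"
  obtains c y1 y2 y3 :: real and W1 W2 W3 :: "complex^3" and \<sigma> :: "real \<Rightarrow> real" and S :: real and m n :: int
  where "c > 0" "- 4 * c < y1" "y1 < - 2 * c" "- 2 * c < y2" "y2 < 2 * c" "2 * c < y3"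
    "y1 + y2 + y3 = 0" "y1\<^sup>2 + y1 * y2 + y2\<^sup>2 = 12 * c\<^sup>2"
    "herm W1 W1 = of_real (1 / (3 * (y1 + 2 * c)))" "herm W2 W2 = of_real (1 / (3 * (y2 + 2 * c)))"
    "herm W3 W3 = of_real (1 / (3 * (y3 + 2 * c)))"
    "herm W1 W2 = 0" "herm W1 W3 = 0" "herm W2 W3 = 0"
    "smooth_on UNIV \<sigma>" "bij \<sigma>" "\<And>t. deriv \<sigma> t > 0"
    "\<And>t. \<gamma> t = proj (exp (\<i> * of_real (y1 * \<sigma> t)) *s W1 + exp (\<i> * of_real (y2 * \<sigma> t)) *s W2
      + exp (\<i> * of_real (y3 * \<sigma> t)) *s W3)"
    "S > 0" "(y2 - y1) * S = 2 * pi * of_int m" "(y3 - y1) * S = 2 * pi * of_int n"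
proof -
  have crit: "critical_curve \<gamma>" using assms by (simp add: closed_critical_curve_def)
  obtain T where T: "T > 0" "\<And>t. \<gamma> (t + T) = \<gamma> t" using assms by (auto simp: closed_critical_curve_def)
  obtain a k \<tau> F1 F2 F3 where "cr_frame a k \<tau> F1 F2 F3" and L: "lift_of \<gamma> F1"
    using generic_transversal_frame crit unfolding critical_curve_def by metis
  then interpret cr_frame a k \<tau> F1 F2 F3 by simp
  note \<gamma> = lift_ofD(4)[OF L]
  define \<kappa> where "\<kappa> = k 0"
  have k: "k t = \<kappa>" for t
    unfolding \<kappa>_def
    using constant_of_zero_derivative[of k] smooth_on_has_vector_derivative[OF smooth_coeffs(2)]
      critical_invariants(2)[OF crit \<gamma>] by metis
  have \<tau>: "\<tau> t = - 9 * \<kappa>\<^sup>2" for t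
    using critical_invariants(1)[OF crit \<gamma>] k by metis
  obtain \<mu> where \<mu>: "cmod \<mu> = 1" "\<And>t. a (t + T) = a t" "\<And>t. F1 (t + T) = \<mu> *s F1 t"
    "\<And>t. F2 (t + T) = \<mu> *s F2 t" "\<And>t. F3 (t + T) = \<mu> *s F3 t"
    using periodic_frame[OF \<gamma> T(2) k \<tau>] by blast
  obtain \<sigma> S where \<sigma>: "\<And>t. (\<sigma> has_real_derivative a t) (at t)" "smooth_on UNIV \<sigma>" "bij \<sigma>"
    "\<sigma> 0 = 0" and S: "S > 0" "\<And>t. \<sigma> (t + T) = \<sigma> t + S"
    using arclength_exists[OF T(1) \<mu>(2)] by blast
  have \<sigma>T: "\<sigma> T = S" using S(2)[of 0] \<sigma>(4) by simp
  have ST: "\<sigma> T > 0" using S \<sigma>T by simp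
  note ci = closed_invariants[OF k \<tau> \<sigma>(1,4) ST \<mu>(3-5) \<mu>(1)]
  \<comment> \<open>The third part of \<open>ci\<close> is stated at a root of the cubic; any real
    one discharges this premise.\<close>
  obtain y0 where "(y0 + 2 * \<kappa>)\<^sup>2 * (y0 - 4 * \<kappa>) = 1" using cubic_root_exists by blast
  then have "(complex_of_real y0 + of_real (2 * \<kappa>))\<^sup>2 * (complex_of_real y0 - of_real (4 * \<kappa>)) = 1"
    by (metis of_real_add of_real_diff of_real_mult of_real_power of_real_1)
  then have simple: "32 * \<kappa> ^ 3 \<noteq> - 1" using ci(3) by blast
  obtain y1 y2 y3 where y: "\<kappa> < 0" "4 * \<kappa> < y1" "y1 < 2 * \<kappa>" "2 * \<kappa> < y2" "y2 < - 2 * \<kappa>"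
    "- 2 * \<kappa> < y3" "y1 + y2 + y3 = 0" "y1\<^sup>2 + y1 * y2 + y2\<^sup>2 = 12 * \<kappa>\<^sup>2"
    and roots: "\<And>y. y \<in> {y1, y2, y3} \<Longrightarrow> (y + 2 * \<kappa>)\<^sup>2 * (y - 4 * \<kappa>) = 1"
    using cubic_real_roots[OF ci(2) simple] by blast
  have croot: "(complex_of_real y + of_real (2 * \<kappa>))\<^sup>2 * (complex_of_real y - of_real (4 * \<kappa>)) = 1"
    if "y \<in> {y1, y2, y3}" for y
    using roots[OF that] by (metis of_real_add of_real_diff of_real_mult of_real_power of_real_1)
  define e where "e y = - 1 / (3 * (y\<^sup>2 - 4 * \<kappa>\<^sup>2))" for y
  define W where "W y = of_real (e y) *s eigen \<kappa> (of_real y) 0" for y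
  have WW: "herm (W y) (W y) = of_real (1 / (3 * (y + 2 * (- \<kappa>))))" if "y \<in> {y1, y2, y3}" for y
  proof -
    have nz: "y + 2 * \<kappa> \<noteq> 0" "y - 2 * \<kappa> \<noteq> 0" using that y by auto
    \<comment> \<open>Replacing 1 by the cubic turns the norm of \<open>eigen\<close> into a
      product, against which the squared coefficient \<open>e y\<close> cancels.\<close>
    have "1 + (y + 2 * \<kappa>) * (y + 2 * \<kappa>) * (y + y - 2 * \<kappa>) = 3 * (y + 2 * \<kappa>)\<^sup>2 * (y - 2 * \<kappa>)"
      using roots[OF that] by (simp add: power2_eq_square algebra_simps)
    then have "herm (W y) (W y) = of_real (e y * (e y * (3 * (y + 2 * \<kappa>)\<^sup>2 * (y - 2 * \<kappa>))))"
      unfolding W_def herm_linear herm_eigen by simp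
    also have "e y = - 1 / (3 * ((y + 2 * \<kappa>) * (y - 2 * \<kappa>)))"
      by (simp add: e_def power2_eq_square algebra_simps)
    also have "\<dots> * (\<dots> * (3 * (y + 2 * \<kappa>)\<^sup>2 * (y - 2 * \<kappa>))) = 1 / (3 * (y + 2 * (- \<kappa>)))"
      using nz by (simp add: divide_simps) (simp add: power2_eq_square algebra_simps)
    finally show ?thesis .
  qed
  \<comment> \<open>This is minus the value at -2\<kappa> of the monic cubic with roots y1, y2, y3,
    where the factor (y + 2\<kappa>)^2 vanishes.\<close>
  have prod: "(y1 + 2 * \<kappa>) * (y2 + 2 * \<kappa>) * (y3 + 2 * \<kappa>) = 1"
  proof -
    have y3: "y3 = - y1 - y2" using y(7) by simp
    have "(y1 + 2 * \<kappa>) * (y2 + 2 * \<kappa>) * (y3 + 2 * \<kappa>) - (y1 + 2 * \<kappa>)\<^sup>2 * (y1 - 4 * \<kappa>)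
      = - (y1 + 2 * \<kappa>) * (y1\<^sup>2 + y1 * y2 + y2\<^sup>2 - 12 * \<kappa>\<^sup>2)"
      unfolding y3 by (simp add: power2_eq_square algebra_simps)
    then show ?thesis using roots[of y1] y(8) by simp
  qed
  \<comment> \<open>With x the third root, y + z - 2\<kappa> is -(x + 2\<kappa>), so the product in
    \<open>herm_eigen\<close> becomes 1 minus the product just computed.\<close>
  have ortho: "herm (W y) (W z) = 0" if "x + y + z = 0" "(x + 2 * \<kappa>) * (y + 2 * \<kappa>) * (z + 2 * \<kappa>) = 1" for x y z
  proof -
    have x: "x = - y - z" using that(1) by simp
    have "1 + (y + 2 * \<kappa>) * (z + 2 * \<kappa>) * (y + z - 2 * \<kappa>) = 1 - (x + 2 * \<kappa>) * (y + 2 * \<kappa>) * (z + 2 * \<kappa>)"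
      unfolding x by (simp add: algebra_simps)
    then have "1 + (y + 2 * \<kappa>) * (z + 2 * \<kappa>) * (y + z - 2 * \<kappa>) = 0"
      using that(2) by simp
    then show ?thesis unfolding W_def herm_linear herm_eigen by simp
  qed
  have F: "F1 t = exp (\<i> * of_real (y1 * \<sigma> t)) *s W y1 + exp (\<i> * of_real (y2 * \<sigma> t)) *s W y2
      + exp (\<i> * of_real (y3 * \<sigma> t)) *s W y3" for t
  proof -
    have "of_real (e y) *s eigen \<kappa> (of_real y) t = exp (\<i> * of_real (y * \<sigma> t)) *s W y" if "y \<in> {y1, y2, y3}" for y
      unfolding W_def by (subst eigen_eq[OF k \<tau> croot[OF that] \<sigma>(1,4)])
        (simp add: vector_smult_assoc mult_ac)
    then show ?thesis
      using F1_eq_eigen_sum[OF y(7,8), of t] y unfolding e_def[symmetric] by simp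
  qed
  have period: "\<exists>m. (y - y1) * S = 2 * pi * of_int m" if "y \<in> {y1, y2, y3}" for y
  proof -
    have "exp (\<i> * of_real y * of_real S) = exp (\<i> * of_real y1 * of_real S)"
      using ci(1)[OF croot[OF that]] ci(1)[OF croot[of y1]] \<sigma>T by simp
    then obtain n :: int where n: "\<i> * of_real y * of_real S = \<i> * of_real y1 * of_real S + of_int (2 * n) * of_real pi * \<i>"
      unfolding exp_eq by (auto simp: mult_ac)
    then have "y * S = y1 * S + 2 * of_int n * pi" by (simp add: complex_eq_iff)
    then show ?thesis by (intro exI[of _ n]) (simp add: algebra_simps)
  qed
  obtain m n where mn: "(y2 - y1) * S = 2 * pi * of_int m" "(y3 - y1) * S = 2 * pi * of_int n"
    using period[of y2] period[of y3] by auto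
  show ?thesis
  proof (rule that[of "- \<kappa>" y1 y2 y3 "W y1" "W y2" "W y3" \<sigma> S m n])
    show "deriv \<sigma> t > 0" for t using DERIV_imp_deriv[OF \<sigma>(1)] a_pos by metis
    show "herm (W y1) (W y2) = 0"
      by (rule ortho[of y3]) (use y(7) prod in \<open>linarith, simp add: mult_ac\<close>)
    show "herm (W y1) (W y3) = 0"
      by (rule ortho[of y2]) (use y(7) prod in \<open>linarith, simp add: mult_ac\<close>)
    show "herm (W y2) (W y3) = 0"
      by (rule ortho[of y1]) (use y(7) prod in \<open>linarith, simp add: mult_ac\<close>)
    show "\<gamma> t = proj (exp (\<i> * of_real (y1 * \<sigma> t)) *s W y1 + exp (\<i> * of_real (y2 * \<sigma> t)) *s W y2
      + exp (\<i> * of_real (y3 * \<sigma> t)) *s W y3)" for t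
      using \<gamma>[of t] F[of t] by simp
  qed (use y WW[of y1] WW[of y2] WW[of y3] \<sigma> S mn in auto)
qed

section \<open>Symmetrical configurations\<close>

lemma act_proj: "act A (proj z) = proj (A *v z)"
  unfolding act_def proj_def by (auto simp: vector_scalar_commute image_iff)

text \<open>The columns of \<open>U_mat\<close>; the first one spans the negative direction.\<close>

definition "u1 = (vector [1 / of_real (sqrt 2), 0, \<i> / of_real (sqrt 2)] :: complex^3)"
definition "u2 = (vector [0, 1, 0] :: complex^3)"
definition "u3 = (vector [\<i> / of_real (sqrt 2), 0, 1 / of_real (sqrt 2)] :: complex^3)"

lemma sqrt2_sqr: "complex_of_real (sqrt 2) * complex_of_real (sqrt 2) = 2"
  by (simp flip: of_real_mult)

lemma u_basis_gram:
  "herm u1 u1 = - 1" "herm u2 u2 = 1" "herm u3 u3 = 1"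
  "herm u1 u2 = 0" "herm u1 u3 = 0" "herm u2 u3 = 0"
  "herm u2 u1 = 0" "herm u3 u1 = 0" "herm u3 u2 = 0"
  by (simp_all add: herm_eq u1_def u2_def u3_def sqrt2_sqr)

lemma u_basis_parseval:
  "herm x y = - (cnj (herm u1 x) * herm u1 y) + cnj (herm u2 x) * herm u2 y
    + cnj (herm u3 x) * herm u3 y"
proof -
  have "2 * herm x y = 2 * (- (cnj (herm u1 x) * herm u1 y) + cnj (herm u2 x) * herm u2 y
    + cnj (herm u3 x) * herm u3 y)"
    by (simp add: herm_eq u1_def u2_def u3_def field_simps sqrt2_sqr)
  then show ?thesis by (metis mult_cancel_left zero_neq_numeral)
qed

text \<open>An isometry of the form has determinant of modulus one; multiplying by an inverse cube
  root of it gives determinant one and leaves the action on lines unchanged.\<close>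

lemma G_grp_of_isometry:
  assumes "\<And>i j. herm (column i A) (column j A) = hmat $ i $ j"
  obtains \<omega> B where "\<omega> \<noteq> 0" "B \<in> G_grp" "\<And>x. B *v x = \<omega> *s (A *v x)"
proof -
  have ent: "(adjoint_mat A ** hmat ** A) $ i $ j = herm (column i A) (column j A)" for A i j
    by (simp add: matrix_matrix_mult_def adjoint_mat_def herm_def matrix_vector_mult_def column_def sum_3 algebra_simps)
  have h: "adjoint_mat A ** hmat ** A = hmat"
    unfolding vec_eq_iff ent by (simp add: assms)
  have dh: "det hmat = - 1" by (simp add: det_3 hmat_def)
  have "det (adjoint_mat A) = cnj (det A)" by (simp add: det_3 adjoint_mat_def algebra_simps)
  moreover have "det (adjoint_mat A) * det hmat * det A = det hmat"
    using arg_cong[OF h, of det] by (simp add: det_mul)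
  ultimately have "cnj (det A) * det A = 1" using dh by simp
  then have n1: "cmod (det A) = 1"
    by (metis complex_mod_sqrt_Re_mult_cnj mult.commute one_complex.sel(1) real_sqrt_one)
  define \<omega> where "\<omega> = exp (- Ln (det A) / 3)"
  have d0: "det A \<noteq> 0" using n1 by auto
  have w3: "\<omega> ^ 3 * det A = 1"
  proof -
    have "\<omega> ^ 3 = exp (- Ln (det A))" unfolding \<omega>_def by (subst exp_of_nat_mult[symmetric]) simp
    then show ?thesis using d0 by (simp add: exp_minus)
  qed
  then have "cmod \<omega> ^ 3 = 1" using n1 by (metis mult.right_neutral norm_mult norm_one norm_power)
  then have w1: "cmod \<omega> = 1" using power_eq_imp_eq_base[of "cmod \<omega>" 3 1] by simp
  then have wc: "\<omega> * cnj \<omega> = 1" using complex_norm_square[of \<omega>] by simp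
  define B where "B = (\<chi> i j. \<omega> * A $ i $ j)"
  have Bv: "B *v x = \<omega> *s (A *v x)" for x
    by (simp add: B_def matrix_vector_mult_def vec_eq_iff sum_3 algebra_simps)
  have "det B = \<omega> ^ 3 * det A" by (simp add: B_def det_3 power3_eq_cube algebra_simps)
  moreover have "column j B = \<omega> *s column j A" for j by (simp add: B_def column_def vec_eq_iff)
  then have "herm (column i B) (column j B) = hmat $ i $ j" for i j
    using wc by (simp add: herm_linear assms)
  then have "adjoint_mat B ** hmat ** B = hmat" unfolding vec_eq_iff ent by simp
  ultimately have "B \<in> G_grp" using w3 by (simp add: G_grp_def)
  moreover have "\<omega> \<noteq> 0" using w1 by auto
  ultimately show ?thesis using that Bv by blast
qed

text \<open>The map sends each u to the corresponding w. The minus sign appears because the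
  coordinate along \<open>u1\<close>, of norm -1, is -\<open>herm u1 x\<close>.\<close>

lemma G_grp_frame_map:
  assumes "herm w1 w1 = - 1" "herm w2 w2 = 1" "herm w3 w3 = 1"
    "herm w1 w2 = 0" "herm w1 w3 = 0" "herm w2 w3 = 0"
  obtains \<omega> B where "\<omega> \<noteq> 0" "B \<in> G_grp"
    "\<And>x. B *v x = \<omega> *s (- herm u1 x *s w1 + herm u2 x *s w2 + herm u3 x *s w3)"
proof -
  define f where "f x = - herm u1 x *s w1 + herm u2 x *s w2 + herm u3 x *s w3" for x
  have lin: "Vector_Spaces.linear (*s) (*s) f"
    by unfold_locales (auto simp: f_def herm_linear vec_eq_iff algebra_simps)
  have sym: "herm w2 w1 = 0" "herm w3 w1 = 0" "herm w3 w2 = 0"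
    using assms herm_sym[of w1 w2] herm_sym[of w1 w3] herm_sym[of w2 w3] by auto
  have iso: "herm (f x) (f y) = herm x y" for x y
    unfolding u_basis_parseval[of x y] f_def by (simp add: herm_linear assms sym)
  have "herm (axis i 1) (axis j 1) = hmat $ i $ j" for i j
    using exhaust_3[of i] exhaust_3[of j] by (auto simp: herm_eq hmat_def axis_def)
  moreover have "column i (matrix f) = f (axis i 1)" for i
    by (simp add: column_def matrix_def)
  ultimately have "herm (column i (matrix f)) (column j (matrix f)) = hmat $ i $ j" for i j
    using iso by metis
  from G_grp_of_isometry[OF this]
  obtain \<omega> B where "\<omega> \<noteq> 0" "B \<in> G_grp" "\<And>x. B *v x = \<omega> *s (matrix f *v x)" by blast
  then show ?thesis
    using that[of \<omega> B] unfolding matrix_works[OF lin] f_def by blast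
qed

section \<open>The model curve and the torus in the eigenbasis of \<open>U_mat\<close>\<close>

definition diag3 :: "complex \<Rightarrow> complex \<Rightarrow> complex \<Rightarrow> complex^3^3"
  where "diag3 x y z = vector [vector [x, 0, 0], vector [0, y, 0], vector [0, 0, z]]"

lemma diag3_nth:
  "diag3 x y z $ i $ j = (if i = j then (if i = 1 then x else if i = 2 then y else z) else 0)"
  using exhaust_3[of i] exhaust_3[of j] by (auto simp: diag3_def)

lemma mat_exp_diag3: "mat_exp (diag3 x y z) = diag3 (exp x) (exp y) (exp z)"
proof -
  have mul: "diag3 x y z ** diag3 x' y' z' = diag3 (x * x') (y * y') (z * z')" for x' y' z'
    unfolding vec_eq_iff matrix_matrix_mult_def using exhaust_3
    by (auto simp: diag3_nth sum_3 forall_3)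
  have "mat 1 = diag3 1 1 1"
    unfolding vec_eq_iff by (auto simp: diag3_nth mat_def)
  then have pow: "((**) (diag3 x y z) ^^ n) (mat 1) = diag3 (x ^ n) (y ^ n) (z ^ n)" for n
    by (induction n) (simp_all add: mul)
  have "(\<lambda>n. (1 / fact n) *\<^sub>R diag3 (x ^ n) (y ^ n) (z ^ n)) sums diag3 (exp x) (exp y) (exp z)"
    unfolding sums_def
  proof (intro vec_tendstoI)
    fix i j :: 3
    have e: "(\<lambda>N. \<Sum>n<N. w ^ n / fact n) \<longlonglongrightarrow> exp w" for w :: complex
      using exp_converges[of w] by (simp add: sums_def scaleR_conv_of_real[where 'a = complex] divide_inverse mult.commute)
    show "(\<lambda>N. (\<Sum>n<N. (1 / fact n) *\<^sub>R diag3 (x ^ n) (y ^ n) (z ^ n)) $ i $ j)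
        \<longlonglongrightarrow> diag3 (exp x) (exp y) (exp z) $ i $ j"
      using e[of x] e[of y] e[of z]
      by (auto simp: diag3_nth scaleR_conv_of_real[where 'a = complex] divide_inverse mult.commute)
  qed
  then show ?thesis unfolding mat_exp_def pow by (simp add: sums_iff)
qed

lemma matrix_inv_U_mat: "matrix_inv U_mat = adjoint_mat U_mat"
proof -
  have 1: "U_mat ** adjoint_mat U_mat = mat 1" "adjoint_mat U_mat ** U_mat = mat 1"
    unfolding vec_eq_iff forall_3 U_mat_def adjoint_mat_def
    by (simp_all add: matrix_matrix_mult_def sum_3 mat_def sqrt2_sqr)
  then have "U_mat ** matrix_inv U_mat = mat 1 \<and> matrix_inv U_mat ** U_mat = mat 1"
    unfolding matrix_inv_def by (rule_tac someI[of _ "adjoint_mat U_mat"]) simp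
  then have "matrix_inv U_mat = (adjoint_mat U_mat ** U_mat) ** matrix_inv U_mat"
    using 1 by simp
  also have "\<dots> = adjoint_mat U_mat"
    using \<open>U_mat ** _ = _ \<and> _\<close> by (simp add: matrix_mul_assoc[symmetric])
  finally show ?thesis .
qed

text \<open>The expansion of (1, \<rho>, \<i>\<rho>^2/2) in the basis u1, u2, u3, with its three
  terms multiplied by x, y, z. The model curve and the torus both act on the base point through such
  phases.\<close>

definition eta_vec :: "real \<Rightarrow> complex \<Rightarrow> complex \<Rightarrow> complex \<Rightarrow> complex^3"
  where "eta_vec \<rho> x y z = (x * of_real ((2 + \<rho>\<^sup>2) / (2 * sqrt 2))) *s u1 + (y * of_real \<rho>) *s u2
    + (z * \<i> * of_real ((\<rho>\<^sup>2 - 2) / (2 * sqrt 2))) *s u3"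

lemma eta_curve_eq:
  "eta_curve r \<rho> s = proj (eta_vec \<rho> (exp (- \<i> * of_real (e23 r \<rho> * s)))
    (exp (\<i> * of_real ((1 + r) * e23 r \<rho> * s))) (exp (- \<i> * of_real (r * e23 r \<rho> * s))))"
proof -
  define x y z where "x = - \<i> * of_real (e23 r \<rho> * s)" and "y = \<i> * of_real ((1 + r) * e23 r \<rho> * s)"
    and "z = - \<i> * of_real (r * e23 r \<rho> * s)"
  have e: "e21 r \<rho> = r * e23 r \<rho>" "e22 r \<rho> = - ((1 + r) * e23 r \<rho>)"
    by (simp_all only: e21_def e22_def e23_def minus_mult_left)
  have "s *\<^sub>R D2 r \<rho> = diag3 x y z"
    unfolding vec_eq_iff forall_3 D2_def e
    by (simp add: diag3_nth x_def y_def z_def mult_ac scaleR_conv_of_real[where 'a = complex])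
  then have "eta_curve r \<rho> s = proj ((U_mat ** diag3 (exp x) (exp y) (exp z) ** adjoint_mat U_mat)
      *v vector [1, of_real \<rho>, \<i> * of_real (\<rho>^2) / 2])"
    unfolding eta_curve_def S_pt_def act_proj by (simp add: mat_exp_diag3 matrix_inv_U_mat)
  also have "(U_mat ** diag3 (exp x) (exp y) (exp z) ** adjoint_mat U_mat)
      *v vector [1, of_real \<rho>, \<i> * of_real (\<rho>^2) / 2] = eta_vec \<rho> (exp x) (exp y) (exp z)"
    unfolding vec_eq_iff forall_3
    by (simp add: matrix_vector_mul_assoc[symmetric])
       (simp add: matrix_vector_mult_def sum_3 U_mat_def adjoint_mat_def diag3_nth eta_vec_def u1_def u2_def u3_def field_simps sqrt2_sqr)
  finally show ?thesis unfolding x_def y_def z_def .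
qed

text \<open>\<open>R_mat\<close> is diagonal in the same basis, since a plane rotation has
  eigenvectors (1, \<i>) and (\<i>, 1). Torus angles can thus be read off from the phases of the
  model curve.\<close>

lemma R_mat_eta:
  "act (R_mat \<theta>1 \<theta>2) (S_pt \<rho>) = proj (eta_vec \<rho> (cis ((\<theta>1 - \<theta>2) / 3)) (cis ((\<theta>1 + 2 * \<theta>2) / 3))
    (cis (- (2 * \<theta>1 + \<theta>2) / 3)))"
proof -
  let ?p = "cis (- (\<theta>1 + 2 * \<theta>2) / 6)" and ?c = "complex_of_real (cos (\<theta>1 / 2))"
    and ?s = "complex_of_real (sin (\<theta>1 / 2))"
  have "(\<theta>1 - \<theta>2) / 3 = - (\<theta>1 + 2 * \<theta>2) / 6 + \<theta>1 / 2" "- (2 * \<theta>1 + \<theta>2) / 3 = - (\<theta>1 + 2 * \<theta>2) / 6 + - (\<theta>1 / 2)"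
    by (simp_all add: field_simps)
  then have "cis ((\<theta>1 - \<theta>2) / 3) = ?p * cis (\<theta>1 / 2)" "cis (- (2 * \<theta>1 + \<theta>2) / 3) = ?p * cis (- (\<theta>1 / 2))"
    by (simp_all only: cis_mult)
  moreover have "cis (\<theta>1 / 2) = ?c + \<i> * ?s" "cis (- (\<theta>1 / 2)) = ?c - \<i> * ?s"
    by (simp_all add: complex_eq_iff)
  ultimately have e: "cis ((\<theta>1 - \<theta>2) / 3) = ?p * (?c + \<i> * ?s)" "cis (- (2 * \<theta>1 + \<theta>2) / 3) = ?p * (?c - \<i> * ?s)"
    by simp_all
  have "R_mat \<theta>1 \<theta>2 *v vector [1, of_real \<rho>, \<i> * of_real (\<rho>^2) / 2] =
    eta_vec \<rho> (cis ((\<theta>1 - \<theta>2) / 3)) (cis ((\<theta>1 + 2 * \<theta>2) / 3)) (cis (- (2 * \<theta>1 + \<theta>2) / 3))"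
    unfolding e vec_eq_iff forall_3
    by (simp add: matrix_vector_mult_def sum_3 R_mat_def eta_vec_def u1_def u2_def u3_def field_simps sqrt2_sqr)
  then show ?thesis by (simp add: S_pt_def act_proj)
qed

text \<open>Divided by |y1|, the denominators y + 2c of the three spectral norms are -A^2, w + 1 + r
  and B^2. The identity between them says that the reciprocals sum to zero, that is, that
  \<open>F1\<close> is null. The value of \<rho>^2 is what makes (2 + \<rho>^2) / (2 - \<rho>^2)
  equal to B / A.\<close>

lemma clifford_param_square:
  fixes r :: real
  assumes "- 2 < r" "r < - (1 / 2)"
  defines "w \<equiv> sqrt ((1 + r + r\<^sup>2) / 3)"
  defines "A \<equiv> sqrt (1 - w)" and "B \<equiv> sqrt (w - r)"
  shows "0 < A" "A < B" "A\<^sup>2 = 1 - w" "B\<^sup>2 = w - r" "w + 1 + r > 0" "(B\<^sup>2 - A\<^sup>2) * (w + 1 + r) = A\<^sup>2 * B\<^sup>2"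
    "(clifford_param r)\<^sup>2 = 2 * (B - A) / (B + A)" "0 < clifford_param r" "clifford_param r < sqrt 2"
proof -
  have "1 + r + r\<^sup>2 = (1/2 + r)\<^sup>2 + 3/4" by (simp add: power2_eq_square field_simps)
  also have "\<dots> > 0" by (rule add_nonneg_pos) auto
  finally have pos: "1 + r + r\<^sup>2 > 0" .
  then have w2: "3 * w\<^sup>2 = 1 + r + r\<^sup>2" and w0: "w > 0" by (simp_all add: w_def)
  have "(r + 2) * (r - 1) < 0" using assms(1,2) by (intro mult_pos_neg) auto
  then have "w\<^sup>2 < 1\<^sup>2" using w2 by (simp add: power2_eq_square algebra_simps)
  then have w1: "w < 1" by (rule power2_less_imp_less) simp
  have "(2 * w)\<^sup>2 - (1 + r)\<^sup>2 = (1 - r)\<^sup>2 / 3"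
    using w2 by (simp add: power2_eq_square field_simps)
  moreover have "(1 - r)\<^sup>2 / 3 > 0" using assms(2) by simp
  ultimately have "(2 * w)\<^sup>2 > (1 + r)\<^sup>2" by linarith
  then have 2: "\<bar>1 + r\<bar> < 2 * w" using w0 by - (rule power2_less_imp_less, auto)
  have "3 * (w\<^sup>2 - (1 + r)\<^sup>2) = (- 1 - 2 * r) * (r + 2)"
    using w2 by (simp add: power2_eq_square algebra_simps)
  moreover have "(- 1 - 2 * r) * (r + 2) > 0" using assms(1,2) by (intro mult_pos_pos) auto
  ultimately have "0 < 3 * (w\<^sup>2 - (1 + r)\<^sup>2)" by (simp only:)
  then have "(1 + r)\<^sup>2 < w\<^sup>2" by simp
  then have "\<bar>1 + r\<bar> < w" using w0 by - (rule power2_less_imp_less, auto)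
  then show w1r: "w + 1 + r > 0" using w0 by linarith
  show A0: "0 < A" using w1 by (simp add: A_def)
  show AB: "A < B" using 2 by (simp add: A_def B_def)
  show A2: "A\<^sup>2 = 1 - w" using w1 by (simp add: A_def)
  show B2: "B\<^sup>2 = w - r" using w0 assms(2) by (simp add: B_def)
  show "(B\<^sup>2 - A\<^sup>2) * (w + 1 + r) = A\<^sup>2 * B\<^sup>2"
    unfolding A2 B2 using w2 by (simp add: power2_eq_square algebra_simps)
  define X where "X = 2 * (B - A) / (B + A)"
  have s3: "sqrt (3 * (1 + r + r\<^sup>2)) = 3 * w"
    using w2 w0 by (intro real_sqrt_unique) (auto simp: power_mult_distrib)
  have pos2: "2 * w + (1 + r) > 0" using 2 by linarith
  \<comment> \<open>Denests the inner radical: after eliminating w^2, its radicand times (1 - r)^2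
    is the square of 3 A B (2w + 1 + r).\<close>
  define Q where "Q = 3 * (A * B) * (2 * w + (1 + r)) / (1 - r)"
  have "Q\<^sup>2 * (1 - r)\<^sup>2 = 9 * ((1 - w) * (w - r)) * (2 * w + (1 + r))\<^sup>2"
    using assms(2) by (simp add: Q_def power_mult_distrib power_divide A2 B2)
  also have "(1 - w) * (w - r) = w * (1 + r) - (1 + 4 * r + r\<^sup>2) / 3"
    using w2 by (simp add: power2_eq_square field_simps)
  also have "(2 * w + (1 + r))\<^sup>2 = (7 + 10 * r + 7 * r\<^sup>2) / 3 + 4 * (1 + r) * w"
    using w2 by (simp add: power2_eq_square field_simps)
  also have "9 * (w * (1 + r) - (1 + 4 * r + r\<^sup>2) / 3) * ((7 + 10 * r + 7 * r\<^sup>2) / 3 + 4 * (1 + r) * w)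
      = 12 * (1 + r)\<^sup>2 * (3 * w\<^sup>2) + 9 * (1 - r)\<^sup>2 * ((1 + r) * w) - (1 + 4 * r + r\<^sup>2) * (7 + 10 * r + 7 * r\<^sup>2)"
    by (simp add: power2_eq_square field_simps)
  also have "\<dots> = (5 + 8 * r + 5 * r\<^sup>2 + 9 * (1 + r) * w) * (1 - r)\<^sup>2"
    unfolding w2 by (simp add: power2_eq_square algebra_simps)
  finally have Q2: "Q\<^sup>2 = 5 + 8 * r + 5 * r\<^sup>2 + 9 * (1 + r) * w"
    using assms(2) by simp
  have "Q \<ge> 0" using A0 AB pos2 assms(2) by (simp add: Q_def)
  then have sQ: "sqrt (5 + 8 * r + 5 * r\<^sup>2 + 3 * (1 + r) * (3 * w)) = Q"
    using Q2 by (intro real_sqrt_unique) auto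
  have sum: "A\<^sup>2 + B\<^sup>2 = 1 - r" "B\<^sup>2 - A\<^sup>2 = 2 * w - (1 + r)" by (simp_all add: A2 B2)
  have w2': "(2 * w + (1 + r)) * (2 * w - (1 + r)) = (1 - r)\<^sup>2 / 3"
    using w2 by (simp add: power2_eq_square field_simps)
  have "(6 + 6 * r + 4 * (3 * w) - 4 * Q) * (1 - r) = 6 * (2 * w + (1 + r)) * ((1 - r) - 2 * (A * B))"
    using assms(2) by (simp add: Q_def field_simps)
  also have "(1 - r) - 2 * (A * B) = (B - A)\<^sup>2"
    unfolding sum(1)[symmetric] by (simp add: power2_eq_square algebra_simps)
  also have "(B - A)\<^sup>2 = X / 2 * (2 * w - (1 + r))"
    unfolding sum(2)[symmetric] using A0 AB by (simp add: X_def power2_eq_square field_simps)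
  also have "6 * (2 * w + (1 + r)) * (X / 2 * (2 * w - (1 + r))) = 3 * X * ((2 * w + (1 + r)) * (2 * w - (1 + r)))"
    by simp
  also have "\<dots> = X * (1 - r) * (1 - r)" unfolding w2' by (simp add: power2_eq_square)
  finally have "6 + 6 * r + 4 * (3 * w) - 4 * Q = X * (1 - r)" using assms(2) by simp
  then have cp: "clifford_param r = sqrt X"
    unfolding clifford_param_def s3 sQ using assms(2) by simp
  have X0: "X > 0" using A0 AB by (simp add: X_def)
  then show "(clifford_param r)\<^sup>2 = 2 * (B - A) / (B + A)" unfolding cp by (simp add: X_def)
  show "0 < clifford_param r" using X0 cp by simp
  have "X < 2" using A0 AB by (simp add: X_def field_simps)
  then show "clifford_param r < sqrt 2" using cp by simp
qed

text \<open>Positivity makes the parameter change by E0 / \<open>e23\<close> orientation preserving.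
  It holds because e23 = -P / (2x), where -P is a sum of a square and a positive term with positive
  coefficients, and x is a power of a nonzero base.\<close>

lemma e23_pos:
  assumes "- 2 < r" "r < - (1 / 2)" "0 < \<rho>" "\<rho> < sqrt 2"
  shows "e23 r \<rho> > 0"
proof -
  define P where "P = - 4 + 4 * r - 12 * \<rho>\<^sup>2 * (1 + r) + (r - 1) * \<rho> ^ 4"
  define x where "x = ((2 + 3 * r - 3 * r\<^sup>2 - 2 * r ^ 3) * (- 4 * \<rho> + \<rho> ^ 5)) powr (2 / 3)"
  have "\<rho>\<^sup>2 < (sqrt 2)\<^sup>2" using assms(3,4) by (intro power_strict_mono) auto
  then have r2: "\<rho>\<^sup>2 < 2" by simp
  have "2 + 3 * r - 3 * r\<^sup>2 - 2 * r ^ 3 = (1 - r) * (2 * r + 1) * (r + 2)"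
    by (simp add: power2_eq_square power3_eq_cube algebra_simps)
  moreover have "- 4 * \<rho> + \<rho> ^ 5 = \<rho> * (\<rho>\<^sup>2 - 2) * (\<rho>\<^sup>2 + 2)"
    by (simp add: power2_eq_square eval_nat_numeral algebra_simps)
  moreover have "\<rho>\<^sup>2 + 2 \<noteq> 0" by (metis add_nonneg_pos less_irrefl zero_le_power2 zero_less_numeral)
  ultimately have "(2 + 3 * r - 3 * r\<^sup>2 - 2 * r ^ 3) * (- 4 * \<rho> + \<rho> ^ 5) \<noteq> 0"
    using assms r2 by auto
  then have x0: "x > 0" by (simp add: x_def)
  have "- P = (1 - r) * (\<rho>\<^sup>2 - 2)\<^sup>2 + 8 * (r + 2) * \<rho>\<^sup>2"
    by (simp add: P_def power2_eq_square eval_nat_numeral algebra_simps)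
  also have "\<dots> > 0"
  proof (rule add_nonneg_pos)
    show "0 \<le> (1 - r) * (\<rho>\<^sup>2 - 2)\<^sup>2" "0 < 8 * (r + 2) * \<rho>\<^sup>2" using assms by auto
  qed
  finally have P0: "P < 0" by simp
  have "mu2 r \<rho> = P / (P - 2 * x)" by (simp add: mu2_def P_def x_def)
  moreover have "1 - P / (P - 2 * x) = - (2 * x) / (P - 2 * x)" using P0 x0 by (simp add: field_simps)
  ultimately have "e23 r \<rho> = (P / (P - 2 * x)) / (- (2 * x) / (P - 2 * x))" by (simp add: e23_def)
  also have "\<dots> = (- P) / (2 * x)" using P0 x0 by (simp add: field_simps)
  also have "\<dots> > 0" using P0 x0 by (intro divide_pos_pos) auto
  finally show ?thesis .
qed

section \<open>Knot type of the model curve\<close>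

lemma u_basis_independent:
  assumes "x1 *s u1 + x2 *s u2 + x3 *s u3 = y1 *s u1 + y2 *s u2 + y3 *s u3"
  shows "x1 = y1" "x2 = y2" "x3 = y3"
proof -
  have "herm u (x1 *s u1 + x2 *s u2 + x3 *s u3) = herm u (y1 *s u1 + y2 *s u2 + y3 *s u3)" for u
    using assms by simp
  from this[of u1] this[of u2] this[of u3] show "x1 = y1" "x2 = y2" "x3 = y3"
    by (simp_all add: herm_linear u_basis_gram)
qed

lemma eta_vec_smult: "eta_vec \<rho> (c * x) (c * y) (c * z) = c *s eta_vec \<rho> x y z"
  by (simp add: eta_vec_def vec_eq_iff algebra_simps)

lemma eta_vec_eqD:
  assumes "0 < \<rho>" "\<rho> < sqrt 2" "proj (eta_vec \<rho> x y z) = proj (eta_vec \<rho> x' y' z')" "x' \<noteq> 0"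
  obtains c where "x' = c * x" "y' = c * y" "z' = c * z"
proof -
  have "(2 + \<rho>\<^sup>2) / (2 * sqrt 2) \<noteq> 0"
    by (simp add: add_nonneg_eq_0_iff)
  moreover have "\<rho>\<^sup>2 < (sqrt 2)\<^sup>2" using assms(1,2) by (intro power_strict_mono) auto
  then have "(\<rho>\<^sup>2 - 2) / (2 * sqrt 2) \<noteq> 0" by simp
  ultimately have nz: "complex_of_real ((2 + \<rho>\<^sup>2) / (2 * sqrt 2)) \<noteq> 0"
    "complex_of_real ((\<rho>\<^sup>2 - 2) / (2 * sqrt 2)) \<noteq> 0" "complex_of_real \<rho> \<noteq> 0"
    using assms(1) by (simp_all only: of_real_eq_0_iff) auto
  have "eta_vec \<rho> x' y' z' \<noteq> 0"
  proof
    assume "eta_vec \<rho> x' y' z' = 0"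
    then have "eta_vec \<rho> x' y' z' = 0 *s u1 + 0 *s u2 + 0 *s u3" by simp
    then show False
      unfolding eta_vec_def using u_basis_independent(1) nz(1) assms(4) by (metis mult_eq_0_iff)
  qed
  then obtain c where "eta_vec \<rho> x' y' z' = c *s eta_vec \<rho> x y z"
    using proj_eqD[OF assms(3)] by blast
  then have "eta_vec \<rho> x' y' z' = eta_vec \<rho> (c * x) (c * y) (c * z)" by (simp add: eta_vec_smult)
  from u_basis_independent[OF this[unfolded eta_vec_def]] nz
  have "x' = c * x" "y' = c * y" "z' = c * z" by auto
  then show ?thesis using that by blast
qed

lemma exp_i_eq_imp:
  assumes "exp (\<i> * of_real x) = exp (\<i> * of_real y)"
  obtains n :: int where "x = y + 2 * pi * of_int n"
proof -
  obtain n :: int where "\<i> * of_real x = \<i> * of_real y + (of_int (2 * n) * pi) * \<i>"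
    using assms unfolding exp_eq by blast
  then have "x = y + 2 * pi * of_int n" by (simp add: complex_eq_iff)
  then show ?thesis using that by blast
qed

text \<open>Dividing by the phase of \<open>u1\<close> leaves two relative phases of speeds (2 + r)
  E and (1 - r) E, in the ratio p : q. Coprimality makes their common period \<open>T\<close>
  minimal, which gives simplicity.\<close>

lemma eta_curve_torus_knot:
  fixes p q :: int
  assumes pq: "0 < p" "0 < q" "coprime p q"
    and r: "r = (real_of_int p - 2 * real_of_int q) / (real_of_int p + real_of_int q)"
    and \<rho>: "0 < \<rho>" "\<rho> < sqrt 2" and E0: "e23 r \<rho> > 0"
  shows "torus_knot_type \<rho> (eta_curve r \<rho>) p q"
proof -
  define E where "E = e23 r \<rho>"
  have E: "E > 0" using E0 by (simp add: E_def)
  have sum: "real_of_int p + real_of_int q > 0" using pq by simp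
  have rp: "2 + r = 3 * real_of_int p / (real_of_int p + real_of_int q)"
    "1 - r = 3 * real_of_int q / (real_of_int p + real_of_int q)"
    using sum by (simp_all add: r field_simps)
  \<comment> \<open>The time in which the relative phases turn p and q times.\<close>
  define T where "T = 2 * pi * (real_of_int p + real_of_int q) / (3 * E)"
  have T: "T > 0" using sum E by (simp add: T_def)
  have qT: "(1 - r) * E * T = 2 * pi * of_int q" "(2 + r) * E * T = 2 * pi * of_int p"
  proof -
    have aux: "3 * a / s * E * (2 * pi * s / (3 * E)) = 2 * pi * a" if "s > 0" for a s
      using that E by (simp add: field_simps)
    show "(1 - r) * E * T = 2 * pi * of_int q" "(2 + r) * E * T = 2 * pi * of_int p"
      unfolding rp T_def by (rule aux[OF sum])+
  qed
  have eta: "eta_curve r \<rho> s = proj (eta_vec \<rho> 1 (exp (\<i> * of_real ((2 + r) * E * s)))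
      (exp (\<i> * of_real ((1 - r) * E * s))))" for s
  proof -
    have "eta_vec \<rho> (exp (- \<i> * of_real (E * s))) (exp (\<i> * of_real ((1 + r) * E * s))) (exp (- \<i> * of_real (r * E * s)))
      = exp (- \<i> * of_real (E * s)) *s eta_vec \<rho> 1 (exp (\<i> * of_real ((2 + r) * E * s))) (exp (\<i> * of_real ((1 - r) * E * s)))"
      unfolding eta_vec_smult[symmetric] by (simp add: algebra_simps flip: exp_add)
    then show ?thesis unfolding eta_curve_eq E_def[symmetric] by (simp add: proj_smult)
  qed
  have per: "exp (\<i> * of_real (x + 2 * pi * of_int n)) = exp (\<i> * of_real x)" for x and n :: int
    unfolding exp_eq by (intro exI[of _ n]) (simp add: algebra_simps)
  have "eta_curve r \<rho> (t + T) = eta_curve r \<rho> t" for t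
  proof -
    have "(2 + r) * E * (t + T) = (2 + r) * E * t + 2 * pi * of_int p"
      "(1 - r) * E * (t + T) = (1 - r) * E * t + 2 * pi * of_int q"
      using qT by (simp_all only: distrib_left)
    then show ?thesis unfolding eta by (simp only: per)
  qed
  moreover have "inj_on (eta_curve r \<rho>) {0..<T}"
  proof (rule inj_onI)
    fix s t assume st: "s \<in> {0..<T}" "t \<in> {0..<T}" and eq: "eta_curve r \<rho> s = eta_curve r \<rho> t"
    obtain c :: complex where "1 = c * 1" "exp (\<i> * of_real ((2 + r) * E * t)) = c * exp (\<i> * of_real ((2 + r) * E * s))"
      "exp (\<i> * of_real ((1 - r) * E * t)) = c * exp (\<i> * of_real ((1 - r) * E * s))"
      using eta_vec_eqD[OF \<rho> eq[unfolded eta]] by auto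
    then have "exp (\<i> * of_real ((2 + r) * E * t)) = exp (\<i> * of_real ((2 + r) * E * s))"
      "exp (\<i> * of_real ((1 - r) * E * t)) = exp (\<i> * of_real ((1 - r) * E * s))" by simp_all
    then obtain m n :: int where mn: "(2 + r) * E * t = (2 + r) * E * s + 2 * pi * of_int m"
      "(1 - r) * E * t = (1 - r) * E * s + 2 * pi * of_int n"
      using exp_i_eq_imp by metis
    define X where "X = (t - s) / T"
    have tX: "t = s + X * T" using T by (simp add: X_def)
    have "X * ((2 + r) * E * T) = 2 * pi * of_int m" "X * ((1 - r) * E * T) = 2 * pi * of_int n"
      using mn unfolding tX by (simp_all add: algebra_simps)
    then have X: "X * of_int p = of_int m" "X * of_int q = of_int n" unfolding qT by simp_all
    \<comment> \<open>If X p and X q are integers, so is X by Bezout; since |X| < 1, it is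
      0.\<close>
    obtain u v where "u * p + v * q = gcd p q" using bezout_int by blast
    then have uv: "u * p + v * q = 1" using pq(3) by simp
    have "X = X * of_int (u * p + v * q)" by (simp add: uv)
    also have "\<dots> = of_int u * (X * of_int p) + of_int v * (X * of_int q)" by (simp add: algebra_simps)
    also have "\<dots> = of_int (u * m + v * n)" unfolding X by simp
    finally have Xi: "X = of_int (u * m + v * n)" .
    have "\<bar>t - s\<bar> < T" using st by auto
    then have "\<bar>X\<bar> < 1" using T by (simp add: X_def abs_divide)
    then have "u * m + v * n = 0" unfolding Xi by linarith
    then show "s = t" using tX Xi by simp
  qed
  ultimately have "simple_closed_curve (eta_curve r \<rho>)"
    unfolding simple_closed_curve_def using T by blast
  moreover have "eta_curve r \<rho> t = act (R_mat ((r - 1) * E * t + 0) ((2 + r) * E * t + 0)) (S_pt \<rho>)" for t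
  proof -
    \<comment> \<open>The angles (r - 1) E t and (2 + r) E t solve the linear system equating the
      phases in \<open>R_mat_eta\<close> with those of \<open>eta_curve_eq\<close>.\<close>
    have "((r - 1) * E * t - (2 + r) * E * t) / 3 = - (E * t)"
      "((r - 1) * E * t + 2 * ((2 + r) * E * t)) / 3 = (1 + r) * E * t"
      "- (2 * ((r - 1) * E * t) + (2 + r) * E * t) / 3 = - (r * E * t)"
      by (simp_all add: field_simps)
    then show ?thesis
      unfolding R_mat_eta eta_curve_eq E_def[symmetric] by (simp add: cis_conv_exp)
  qed
  moreover have "real_of_int p / real_of_int q = - ((2 + r) * E) / ((r - 1) * E)"
  proof -
    have "- ((2 + r) * E) / ((r - 1) * E) = (2 + r) / (1 - r)"
      using E pq sum rp by (simp add: divide_simps) (simp add: algebra_simps)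
    also have "\<dots> = real_of_int p / real_of_int q" unfolding rp using sum pq by simp
    finally show ?thesis by simp
  qed
  moreover have "(r - 1) * E \<noteq> 0" using E rp(2) sum pq by (auto simp: field_simps)
  ultimately show ?thesis
    unfolding torus_knot_type_def using pq by blast
qed

lemma eta_vec_herm_coeffs:
  "herm u1 (eta_vec \<rho> x y z) = - (x * of_real ((2 + \<rho>\<^sup>2) / (2 * sqrt 2)))"
  "herm u2 (eta_vec \<rho> x y z) = y * of_real \<rho>"
  "herm u3 (eta_vec \<rho> x y z) = z * \<i> * of_real ((\<rho>\<^sup>2 - 2) / (2 * sqrt 2))"
  by (simp_all add: eta_vec_def herm_linear u_basis_gram del: of_real_divide)

text \<open>The components W have prescribed norms, so rescaling them to an orthonormal frame and
  sending the u basis there takes the model orbit to the given one, provided one factor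
  \<open>m\<close> fits all three norms. That is what the choice of \<rho> ensures. Here
  \<open>c\<close> stands for y + c in the denominators, hence for twice the constant of
  \<open>closed_critical_curve_spectral\<close>.\<close>

lemma orbit_congruent_eta:
  assumes r: "- 2 < r" "r < - (1 / 2)" and E0: "E0 > 0"
  defines "\<rho> \<equiv> clifford_param r" and "c \<equiv> E0 * sqrt ((1 + r + r\<^sup>2) / 3)"
  assumes W: "herm W1 W1 = of_real (1 / (3 * (- E0 + c)))" "herm W2 W2 = of_real (1 / (3 * ((1 + r) * E0 + c)))"
    "herm W3 W3 = of_real (1 / (3 * (- r * E0 + c)))" "herm W1 W2 = 0" "herm W1 W3 = 0" "herm W2 W3 = 0"
  obtains A where "A \<in> G_grp" "\<And>x. act A (eta_curve r \<rho> (x * (E0 / e23 r \<rho>))) =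
    proj (exp (\<i> * of_real (- E0 * x)) *s W1 + exp (\<i> * of_real ((1 + r) * E0 * x)) *s W2
      + exp (\<i> * of_real (- r * E0 * x)) *s W3)"
proof -
  define w where "w = sqrt ((1 + r + r\<^sup>2) / 3)"
  define P where "P = sqrt (1 - w)"
  define Q where "Q = sqrt (w - r)"
  note cl = clifford_param_square[OF r, folded w_def, folded P_def Q_def, folded \<rho>_def]
  have rho2: "\<rho>\<^sup>2 = 2 * (Q - P) / (Q + P)" by (rule cl(7))
  have QP: "Q + P > 0" "Q > 0" using cl(1,2) by simp_all
  have Epos: "e23 r \<rho> > 0" by (rule e23_pos[OF r cl(8,9)])
  have cw: "c = E0 * w" by (simp add: c_def w_def)
  have n: "3 * (- E0 + c) = - (3 * E0 * P\<^sup>2)" "3 * (- r * E0 + c) = 3 * E0 * Q\<^sup>2"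
    "3 * ((1 + r) * E0 + c) = 3 * E0 * (w + 1 + r)"
    by (simp_all add: cw cl(3,4) algebra_simps)
  \<comment> \<open>Solves m^2 / (3 E0 P^2) = a1^2; the condition for a3 then holds by symmetry in P
    and Q, and the one for \<rho> by the identity \<open>cl(6)\<close>.\<close>
  define m where "m = sqrt (6 * E0) * P * Q / (P + Q)"
  have m0: "m > 0" using E0 cl(1) QP by (simp add: m_def)
  have m2: "m\<^sup>2 = 6 * E0 * P\<^sup>2 * Q\<^sup>2 / (P + Q)\<^sup>2"
    using E0 by (simp add: m_def power_mult_distrib power_divide)
  define a1 where "a1 = (2 + \<rho>\<^sup>2) / (2 * sqrt 2)"
  define a3 where "a3 = (\<rho>\<^sup>2 - 2) / (2 * sqrt 2)"
  have half: "4 * x / s / (2 * sqrt 2) = sqrt 2 * x / s" for x s :: real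
  proof -
    have "4 * x / s / (2 * sqrt 2) = (2 / sqrt 2) * x / s" by simp
    then show ?thesis by (simp only: real_div_sqrt)
  qed
  have a1: "a1 = sqrt 2 * Q / (P + Q)"
  proof -
    have "2 + \<rho>\<^sup>2 = 4 * Q / (P + Q)" unfolding rho2 using QP by (simp add: field_simps)
    then show ?thesis unfolding a1_def by (simp only: half)
  qed
  have a3: "a3 = - (sqrt 2 * P / (P + Q))"
  proof -
    have "\<rho>\<^sup>2 - 2 = - (4 * P / (P + Q))" unfolding rho2 using QP by (simp add: field_simps)
    then show ?thesis unfolding a3_def by (simp only: half minus_divide_left[symmetric])
  qed
  have nz: "a1 \<noteq> 0" "a3 \<noteq> 0" "\<rho> \<noteq> 0" using QP cl(1,8) by (auto simp: a1 a3)
  have P0: "P \<noteq> 0" "Q \<noteq> 0" "P + Q \<noteq> 0" "E0 \<noteq> 0" "w + 1 + r \<noteq> 0" using cl(1,5) QP E0 by auto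
  have "m\<^sup>2 / a1\<^sup>2 * (1 / (- (3 * E0 * P\<^sup>2))) = - 1"
    unfolding m2 a1 using P0 by (simp add: power_mult_distrib power_divide field_simps)
  then have k1: "(m / a1) * ((m / a1) * (1 / (3 * (- E0 + c)))) = - 1"
    unfolding n by (simp add: power2_eq_square)
  have "m\<^sup>2 / a3\<^sup>2 * (1 / (3 * E0 * Q\<^sup>2)) = 1"
    unfolding m2 a3 using P0 by (simp add: power_mult_distrib power_divide field_simps)
  then have k3: "(m / a3) * ((m / a3) * (1 / (3 * (- r * E0 + c)))) = 1"
    unfolding n by (simp add: power2_eq_square)
  have f2: "m\<^sup>2 * (1 / (3 * E0 * (w + 1 + r))) = \<rho>\<^sup>2"
  proof -
    have e: "2 * (P\<^sup>2 * Q\<^sup>2) / (P + Q)\<^sup>2 = \<rho>\<^sup>2 * (w + 1 + r)"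
    proof -
      have "\<rho>\<^sup>2 = 2 * (Q\<^sup>2 - P\<^sup>2) / (P + Q)\<^sup>2"
        unfolding rho2 using QP
        by (subst frac_eq_eq, simp, simp add: add.commute, simp add: power2_eq_square algebra_simps)
      then show ?thesis unfolding cl(6)[symmetric] by simp
    qed
    have "6 * e * x * y / u * (1 / (3 * e * v)) = 2 * (x * y) / u / v" if "e \<noteq> 0" for e x y u v :: real
      using that by simp
    from this[OF P0(4)]
    have "m\<^sup>2 * (1 / (3 * E0 * (w + 1 + r))) = 2 * (P\<^sup>2 * Q\<^sup>2) / (P + Q)\<^sup>2 / (w + 1 + r)"
      unfolding m2 .
    also have "\<dots> = \<rho>\<^sup>2" unfolding e using P0(5) by simp
    finally show ?thesis .
  qed
  have g2: "(m / \<rho>) * ((m / \<rho>) * x) = m\<^sup>2 * x / \<rho>\<^sup>2" for x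
    by (simp add: power2_eq_square)
  have k2: "(m / \<rho>) * ((m / \<rho>) * (1 / (3 * ((1 + r) * E0 + c)))) = 1"
    unfolding n g2 f2 using nz(3) by simp
  define w1 where "w1 = of_real (m / a1) *s W1"
  define w2 where "w2 = of_real (m / \<rho>) *s W2"
  \<comment> \<open>The factor -\<i> compensates the \<i> in the third coefficient of
    \<open>eta_vec\<close>.\<close>
  define w3 where "w3 = (- \<i> * of_real (m / a3)) *s W3"
  have "herm w1 w1 = of_real ((m / a1) * ((m / a1) * (1 / (3 * (- E0 + c)))))"
    "herm w2 w2 = of_real ((m / \<rho>) * ((m / \<rho>) * (1 / (3 * ((1 + r) * E0 + c)))))"
    "herm w3 w3 = of_real ((m / a3) * ((m / a3) * (1 / (3 * (- r * E0 + c)))))"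
    unfolding w1_def w2_def w3_def herm_linear W by (simp_all add: mult_ac)
  then have g: "herm w1 w1 = - 1" "herm w2 w2 = 1" "herm w3 w3 = 1"
    unfolding k1 k2 k3 by simp_all
  have g': "herm w1 w2 = 0" "herm w1 w3 = 0" "herm w2 w3 = 0"
    unfolding w1_def w2_def w3_def herm_linear W by simp_all
  obtain \<omega> A where A: "\<omega> \<noteq> 0" "A \<in> G_grp"
    "\<And>x. A *v x = \<omega> *s (- herm u1 x *s w1 + herm u2 x *s w2 + herm u3 x *s w3)"
    using G_grp_frame_map[OF g g'] by blast
  show ?thesis
  proof (rule that[OF A(2)])
    fix x
    define X Y Z where "X = exp (\<i> * of_real (- E0 * x))" and "Y = exp (\<i> * of_real ((1 + r) * E0 * x))"
      and "Z = exp (\<i> * of_real (- r * E0 * x))"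
    have "- \<i> * of_real (e23 r \<rho> * (x * (E0 / e23 r \<rho>))) = \<i> * of_real (- E0 * x)"
      "\<i> * of_real ((1 + r) * e23 r \<rho> * (x * (E0 / e23 r \<rho>))) = \<i> * of_real ((1 + r) * E0 * x)"
      "- \<i> * of_real (r * e23 r \<rho> * (x * (E0 / e23 r \<rho>))) = \<i> * of_real (- r * E0 * x)"
      using Epos by (simp_all add: mult_ac)
    then have "eta_curve r \<rho> (x * (E0 / e23 r \<rho>)) = proj (eta_vec \<rho> X Y Z)"
      unfolding eta_curve_eq X_def Y_def Z_def by (simp only:)
    then have "act A (eta_curve r \<rho> (x * (E0 / e23 r \<rho>))) = proj (A *v eta_vec \<rho> X Y Z)"
      by (simp add: act_proj)
    also have "A *v eta_vec \<rho> X Y Z = (\<omega> * of_real m) *s (X *s W1 + Y *s W2 + Z *s W3)"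
      unfolding A(3) eta_vec_herm_coeffs a1_def[symmetric] a3_def[symmetric] w1_def w2_def w3_def
      using nz by (simp add: vec_eq_iff algebra_simps)
    also have "proj \<dots> = proj (X *s W1 + Y *s W2 + Z *s W3)"
      using A(1) m0 by (intro proj_smult) simp
    finally show "act A (eta_curve r \<rho> (x * (E0 / e23 r \<rho>))) = proj (exp (\<i> * of_real (- E0 * x)) *s W1
      + exp (\<i> * of_real ((1 + r) * E0 * x)) *s W2 + exp (\<i> * of_real (- r * E0 * x)) *s W3)"
      unfolding X_def Y_def Z_def .
  qed
qed

theorem theorem5p1:
  fixes \<gamma> :: "real \<Rightarrow> (complex^3) set"
  assumes "closed_critical_curve \<gamma>"
  shows "\<exists>(p::int) (q::int) (r::real) (\<rho>::real) \<eta>.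
    0 < p \<and> 0 < q \<and> real_of_int p / real_of_int q \<in> {0<..<1} \<and>
    r = (real_of_int p - 2 * real_of_int q) / (real_of_int p + real_of_int q) \<and>
    \<rho> = clifford_param r \<and>
    symmetrical_configuration_2 r \<rho> \<eta> \<and>
    torus_knot_type \<rho> \<eta> p q \<and>
    congruent_curves \<gamma> \<eta>"
proof -
  obtain c y1 y2 y3 :: real and W1 W2 W3 :: "complex^3" and \<sigma> S and m n :: int
    where c: "c > 0" "- 4 * c < y1" "y1 < - 2 * c" "- 2 * c < y2" "y2 < 2 * c" "2 * c < y3"
    and y: "y1 + y2 + y3 = 0" "y1\<^sup>2 + y1 * y2 + y2\<^sup>2 = 12 * c\<^sup>2"
    and W: "herm W1 W1 = of_real (1 / (3 * (y1 + 2 * c)))" "herm W2 W2 = of_real (1 / (3 * (y2 + 2 * c)))"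
    "herm W3 W3 = of_real (1 / (3 * (y3 + 2 * c)))"
    "herm W1 W2 = 0" "herm W1 W3 = 0" "herm W2 W3 = 0"
    and \<sigma>: "smooth_on UNIV \<sigma>" "bij \<sigma>" "\<And>t. deriv \<sigma> t > 0"
    and \<gamma>: "\<And>t. \<gamma> t = proj (exp (\<i> * of_real (y1 * \<sigma> t)) *s W1 + exp (\<i> * of_real (y2 * \<sigma> t)) *s W2
      + exp (\<i> * of_real (y3 * \<sigma> t)) *s W3)"
    and S: "S > 0" "(y2 - y1) * S = 2 * pi * of_int m" "(y3 - y1) * S = 2 * pi * of_int n"
    using closed_critical_curve_spectral[OF assms] by metis
  \<comment> \<open>The component at y1 is the only one of negative norm, so it has to correspond to
    \<open>u1\<close>, whose frequency along the model curve is -\<open>e23\<close>. The order y1 <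
    y2 < y3 then places r between -2 and -1/2.\<close>
  define E0 where "E0 = - y1"
  define r where "r = y3 / y1"
  have E0: "E0 > 0" using c by (simp add: E0_def)
  have ys: "y1 = - E0" "y3 = - r * E0" "y2 = (1 + r) * E0"
    using y(1) E0 by (simp_all add: E0_def r_def algebra_simps)
  have "y1 < y2" "y2 < y3" using c by auto
  then have "- E0 < (1 + r) * E0" "(1 + r) * E0 < (- r) * E0" unfolding ys by simp_all
  then have "- 1 * E0 < (1 + r) * E0" "(1 + r) * E0 < (- r) * E0" by simp_all
  then have r: "- 2 < r" "r < - (1 / 2)" using E0 by (simp_all only: mult_less_cancel_right_pos)
  have "0 < (y2 - y1) * S" "(y2 - y1) * S < (y3 - y1) * S" using c S(1) by simp_all
  then have mn: "0 < m" "m < n" unfolding S(2,3) by (simp_all add: zero_less_mult_iff)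
  \<comment> \<open>The given period may cover the underlying closed curve several times, so the
    turning numbers m and n are reduced.\<close>
  define p where "p = m div gcd m n"
  define q where "q = n div gcd m n"
  have g: "m = p * gcd m n" "n = q * gcd m n" "gcd m n > 0" using mn by (simp_all add: p_def q_def)
  have pq: "coprime p q" using mn unfolding p_def q_def by (intro div_gcd_coprime) auto
  have pq0: "0 < p" "p < q"
    using mn g by (metis zero_less_mult_pos2, metis mult_less_cancel_right_pos)
  then have q0: "0 < q" by simp
  have "(2 + r) * E0 * S * real_of_int q = (1 - r) * E0 * S * real_of_int p"
  proof -
    have "(2 + r) * E0 = y2 - y1" "(1 - r) * E0 = y3 - y1" unfolding ys by (simp_all add: algebra_simps)
    then have "(2 + r) * E0 * S = 2 * pi * (of_int p * of_int (gcd m n))"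
      "(1 - r) * E0 * S = 2 * pi * (of_int q * of_int (gcd m n))"
      using S(2,3) g(1,2) by (simp_all only: flip: of_int_mult)
    then show ?thesis by simp
  qed
  then have "(2 + r) * real_of_int q = (1 - r) * real_of_int p" using E0 S(1) by (simp add: mult_ac)
  then have rpq: "r = (real_of_int p - 2 * real_of_int q) / (real_of_int p + real_of_int q)"
    using pq0 q0 by (simp add: field_simps)
  have rat: "r \<in> \<rat>" unfolding rpq by simp
  define \<rho> where "\<rho> = clifford_param r"
  have \<rho>: "0 < \<rho>" "\<rho> < sqrt 2" using clifford_param_square(8,9)[OF r] by (simp_all add: \<rho>_def)
  have E: "e23 r \<rho> > 0" by (rule e23_pos[OF r \<rho>])
  \<comment> \<open>With y2 = (1 + r) E0, the relation y1^2 + y1 y2 + y2^2 = 12 c^2 reads E0^2 (1 +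
    r + r^2) = 12 c^2.\<close>
  have "2 * c = E0 * sqrt ((1 + r + r\<^sup>2) / 3)"
  proof -
    have "(2 * c / E0)\<^sup>2 = (1 + r + r\<^sup>2) / 3"
      using y(2) E0 unfolding ys by (simp add: power2_eq_square field_simps)
    then have "sqrt ((1 + r + r\<^sup>2) / 3) = 2 * c / E0"
      using c(1) E0 by (intro real_sqrt_unique) auto
    then show ?thesis using E0 by simp
  qed
  note W' = W[unfolded ys, unfolded this]
  obtain A where A: "A \<in> G_grp" "\<And>x. act A (eta_curve r \<rho> (x * (E0 / e23 r \<rho>))) =
    proj (exp (\<i> * of_real (- E0 * x)) *s W1 + exp (\<i> * of_real ((1 + r) * E0 * x)) *s W2
      + exp (\<i> * of_real (- r * E0 * x)) *s W3)"
    using orbit_congruent_eta[OF r E0 W'] unfolding \<rho>_def by blast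
  have "congruent_curves \<gamma> (eta_curve r \<rho>)"
    unfolding congruent_curves_def
  proof (intro bexI[OF _ A(1)] exI conjI allI)
    let ?s = "E0 / e23 r \<rho>"
    have s: "?s > 0" using E0 E by simp
    show "smooth_on UNIV (\<lambda>t. \<sigma> t * ?s)" by (intro smooth \<sigma> open_UNIV)
    have "bij (\<lambda>x. x * ?s)"
      by (rule bij_betw_byWitness[where f' = "\<lambda>x. x / ?s"]) (use s in auto)
    then show "bij (\<lambda>t. \<sigma> t * ?s)" using bij_comp[OF \<sigma>(2)] by (simp add: o_def)
    fix t
    have "(\<sigma> has_real_derivative deriv \<sigma> t) (at t)"
      using smooth_on_has_real_derivative[OF \<sigma>(1)] DERIV_imp_deriv by metis
    then have "((\<lambda>t. \<sigma> t * ?s) has_real_derivative deriv \<sigma> t * ?s) (at t)"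
      by (rule DERIV_cmult_right)
    then have "deriv (\<lambda>t. \<sigma> t * ?s) t = deriv \<sigma> t * ?s" by (rule DERIV_imp_deriv)
    then show "0 < deriv (\<lambda>t. \<sigma> t * ?s) t" using mult_pos_pos[OF \<sigma>(3)[of t] s] by simp
    show "\<gamma> t = act A (eta_curve r \<rho> (\<sigma> t * ?s))" unfolding A(2) \<gamma> ys ..
  qed
  moreover have "torus_knot_type \<rho> (eta_curve r \<rho>) p q"
    by (rule eta_curve_torus_knot[OF pq0(1) q0 pq rpq \<rho> E])
  moreover have "symmetrical_configuration_2 r \<rho> (eta_curve r \<rho>)"
    unfolding symmetrical_configuration_2_def using rat r \<rho> by simp
  ultimately show ?thesis
    using pq0 q0 rpq \<rho>_def by (intro exI[of _ p] exI[of _ q] exI[of _ r] exI[of _ \<rho>] exI[of _ "eta_curve r \<rho>"]) simp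
qed

end
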